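(* Let $\mathcal X=(x_n)_{n\ge1}$ be a complete and minimal sequence of vectors in a Hilbert space $\mathcal H$, with biorthogonal sequence $\mathcal X^*=(x_n^* )_{n\ge1}$. The following assertions are equivalent: (i) $\mathcal X$ is an AOB in $\mathcal H$; (ii) there exists an operator $U_{\mathcal X}\in\mathcal{UK}(\mathcal H,\ell^2)$ such that $U_{\mathcal X}(x_n)=e_n$, $n\ge1$; (iii) the Gram matrix $\Gamma_{\mathcal X}$ defines a bounded invertible operator on $\ell^2$ of the form $I+K$ with $K$ compact; (iv) $J_{\mathcal X^*}\in\mathcal{UK}(\mathcal H,\ell^2)$; (v) $\mathcal X^*$ is a complete AOB in $\mathcal H$; (vi) there exists an invertible operator $U_{\mathcal X}:\mathcal H\to\ell^2$ such that $U_{\mathcal X}(x_n)=e_n$, $n\ge1$, and, if $U_{\mathcal X,N}:\mathrm{span}(x_n:n\ge N)\to\mathrm{span}(e_n:n\ge N)$ is the restriction of $U_{\mathcal X}$ to $\mathrm{span}(x_n:n\ge N)$, then $\lim_{N\to\infty}\|U_{\mathcal X,N}\|=1=\lim_{N\to\infty}\|U_{\mathcal X,N}^{-1}\|$; (vii) for every $N\ge1$ there are two constants $C_N,C_N^*>0$ such that $${C_N^*}^{-1}\|f\|^2_{\mathcal H}\le\sum_{n\ge N}|\langle f,x_n\rangle_{\mathcal H}|^2\le C_N\|f\|^2_{\mathcal H}$$ for every $f\in\mathcal H\ominus\mathrm{span}(x_1,\dots,x_{N-1})$, and $\lim_{N\to\infty}C_N=1=\lim_{N\to\infty}C_N^*$;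 (viii) $\mathcal X^*$ is complete in $\mathcal H$ and for every $N\ge1$ there are two constants $C_N,C_N^*>0$ such that $$\sum_{n\ge N}|\langle f,x_n\rangle_{\mathcal H}|^2\le C_N\|f\|^2_{\mathcal H}\quad\text{and}\quad\sum_{n\ge N}|\langle f,x_n^*\rangle_{\mathcal H}|^2\le C_N^*\|f\|^2_{\mathcal H}$$ for every $f\in\mathcal H$, and $\lim_{N\to\infty}C_N=1=\lim_{N\to\infty}C_N^*$.
   Context: $\mathrm{span}(\dots)$ denotes the closed linear span. $(x_n)$ is *complete* if $\mathrm{span}(x_n:n\ge1)=\mathcal H$ and *minimal* if $x_n\notin\mathrm{span}(x_\ell:\ell\ne n)$ for every $n$. For complete minimal $\mathcal X$, the biorthogonal is the unique sequence $(x_n^* )$ in $\mathcal H$ with $\langle x_\ell,x_n^*\rangle=\delta_{n,\ell}$. $(e_n)_{n\ge1}$ is the canonical orthonormal basis of $\ell^2=\ell^2(\mathbb N)$. A sequence $(x_n)_{n\ge1}$ is an *asymptotically orthonormal basic sequence* (AOB) if for all $N\ge1$ there are constants $c_N,C_N>0$ with $c_N\sum_{n\ge N}|a_n|^2\le\|\sum_{n\ge N}a_nx_n\|^2_{\mathcal H}\le C_N\sum_{n\ge N}|a_n|^2$ for every finitely supported complex sequence $(a_n)_n$, and $\lim_N c_N=1=\lim_N C_N$. The Gram matrix is $\Gamma_{\mathcal X}=(\langle x_n,x_p\rangle_{\mathcal H})_{n,p\ge1}$. The interpolation operator $J_{\mathcal X^*}$ is $J_{\mathcal X^*}f=(\langle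 f,x_n\rangle_{\mathcal H})_{n\ge1}$, $f\in\mathcal H$. For Hilbert spaces $\mathcal H_1,\mathcal H_2$, $T\in\mathcal{UK}(\mathcal H_1,\mathcal H_2)$ means that $T$ is a bounded invertible operator from $\mathcal H_1$ onto $\mathcal H_2$ of the form $T=U+K$ with $U:\mathcal H_1\to\mathcal H_2$ unitary and $K:\mathcal H_1\to\mathcal H_2$ compact. *)

theory Defs
  imports "HOL-Analysis.Analysis"
begin

section \<open>Complex Hilbert spaces\<close>

text \<open>The inner product is linear in the first argument. Norm and topology are those of the
  underlying real inner product space, whose inner product is the real part of the complex one;
  in particular the square of \<open>norm x\<close> is \<open>cinner x x\<close>.\<close>

class complex_inner = real_inner +
  fixes scaleC :: "complex \<Rightarrow> 'a \<Rightarrow> 'a" (infixr "*\<^sub>C" 75)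
    and cinner :: "'a \<Rightarrow> 'a \<Rightarrow> complex"
  assumes scaleC_add_right: "c *\<^sub>C (x + y) = c *\<^sub>C x + c *\<^sub>C y"
    and scaleC_add_left: "(c + d) *\<^sub>C x = c *\<^sub>C x + d *\<^sub>C x"
    and scaleC_scaleC: "c *\<^sub>C (d *\<^sub>C x) = (c * d) *\<^sub>C x"
    and scaleC_of_real: "of_real r *\<^sub>C x = r *\<^sub>R x"
    and cinner_commute: "cinner x y = cnj (cinner y x)"
    and cinner_add_left: "cinner (x + y) z = cinner x z + cinner y z"
    and cinner_scaleC_left: "cinner (c *\<^sub>C x) y = c * cinner x y"
    and inner_eq_Re_cinner: "inner x y = Re (cinner x y)"

class chilbert_space = complex_inner + complete_space

interpretation complex_vector: vector_space "scaleC :: complex \<Rightarrow> 'a \<Rightarrow> 'a::complex_inner"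
proof
  show "1 *\<^sub>C x = x" for x :: 'a
    using scaleC_of_real[of 1 x] by simp
qed (rule scaleC_add_right scaleC_add_left scaleC_scaleC)+

definition closed_span :: "'a::complex_inner set \<Rightarrow> 'a set" where
  "closed_span S = closure (complex_vector.span S)"

definition orth_complement :: "'a::complex_inner set \<Rightarrow> 'a set" where
  "orth_complement S = {f. \<forall>g\<in>S. cinner f g = 0}"


section \<open>The Hilbert space of square-summable complex sequences\<close>

text \<open>Throughout, sequences are indexed from 0, so the tail starting at the \<open>N\<close>-th term for
  \<open>N \<ge> 1\<close> becomes the tail starting at index \<open>N\<close> for \<open>N \<ge> 0\<close>.\<close>

typedef ell2 = "{a :: nat \<Rightarrow> complex. summable (\<lambda>n. (cmod (a n))\<^sup>2)}"
  morphisms coord Abs_ell2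
  by (rule exI[of _ "\<lambda>_. 0"]) simp

setup_lifting type_definition_ell2

lemma summable_coord: "summable (\<lambda>n. (cmod (coord a n))\<^sup>2)"
  using coord by auto

lemma ell2_eqI: "(\<And>n. coord a n = coord b n) \<Longrightarrow> a = b"
  by (simp add: coord_inject[symmetric] fun_eq_iff)

lemma cmod_add_sq_le: "(cmod (a + b))\<^sup>2 \<le> 2 * (cmod a)\<^sup>2 + 2 * (cmod b)\<^sup>2"
proof -
  have "(cmod (a + b))\<^sup>2 \<le> (cmod a + cmod b)\<^sup>2"
    by (intro power_mono norm_triangle_ineq) auto
  also have "\<dots> \<le> 2 * (cmod a)\<^sup>2 + 2 * (cmod b)\<^sup>2"
    using zero_le_power2[of "cmod a - cmod b"] by (simp add: power2_eq_square algebra_simps)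
  finally show ?thesis .
qed

lemma summable_sq_add:
  assumes "summable (\<lambda>n. (cmod (a n))\<^sup>2)" "summable (\<lambda>n. (cmod (b n))\<^sup>2)"
  shows "summable (\<lambda>n. (cmod (a n + b n))\<^sup>2)"
proof (rule summable_comparison_test'[where N = 0])
  show "summable (\<lambda>n. 2 * (cmod (a n))\<^sup>2 + 2 * (cmod (b n))\<^sup>2)"
    using assms by (intro summable_add summable_mult)
qed (use cmod_add_sq_le in auto)

lemma summable_sq_scale:
  assumes "summable (\<lambda>n. (cmod (a n))\<^sup>2)"
  shows "summable (\<lambda>n. (cmod (c * a n))\<^sup>2)"
  using summable_mult[OF assms, of "(cmod c)\<^sup>2"] by (simp add: norm_mult power_mult_distrib)

lemma summable_coord_mult: "summable (\<lambda>n. coord a n * cnj (coord b n))"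
proof (rule summable_comparison_test'[where N = 0])
  show "summable (\<lambda>n. (cmod (coord a n))\<^sup>2 + (cmod (coord b n))\<^sup>2)"
    by (intro summable_add summable_coord)
next
  fix n
  have "2 * (cmod (coord a n) * cmod (coord b n)) \<le> (cmod (coord a n))\<^sup>2 + (cmod (coord b n))\<^sup>2"
    using zero_le_power2[of "cmod (coord a n) - cmod (coord b n)"]
    by (simp add: power2_eq_square algebra_simps)
  moreover have "0 \<le> cmod (coord a n) * cmod (coord b n)"
    by simp
  ultimately show "norm (coord a n * cnj (coord b n)) \<le> (cmod (coord a n))\<^sup>2 + (cmod (coord b n))\<^sup>2"
    by (simp only: norm_mult complex_mod_cnj)
qed

instantiation ell2 :: complex_inner
begin

lift_definition zero_ell2 :: ell2 is "\<lambda>_. 0" by simp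
lift_definition plus_ell2 :: "ell2 \<Rightarrow> ell2 \<Rightarrow> ell2" is "\<lambda>a b n. a n + b n"
  by (rule summable_sq_add)
lift_definition scaleC_ell2 :: "complex \<Rightarrow> ell2 \<Rightarrow> ell2" is "\<lambda>c a n. c * a n"
  by (rule summable_sq_scale)
lift_definition uminus_ell2 :: "ell2 \<Rightarrow> ell2" is "\<lambda>a n. - a n" by simp
lift_definition minus_ell2 :: "ell2 \<Rightarrow> ell2 \<Rightarrow> ell2" is "\<lambda>a b n. a n - b n"
  using summable_sq_add[where b = "\<lambda>n. - b n" for b] by simp
definition scaleR_ell2 :: "real \<Rightarrow> ell2 \<Rightarrow> ell2" where
  "scaleR_ell2 r a = complex_of_real r *\<^sub>C a"
definition cinner_ell2 :: "ell2 \<Rightarrow> ell2 \<Rightarrow> complex" where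
  "cinner_ell2 a b = (\<Sum>n. coord a n * cnj (coord b n))"
definition inner_ell2 :: "ell2 \<Rightarrow> ell2 \<Rightarrow> real" where
  "inner_ell2 a b = Re (cinner a b)"
definition norm_ell2 :: "ell2 \<Rightarrow> real" where
  "norm_ell2 a = sqrt (\<Sum>n. (cmod (coord a n))\<^sup>2)"
definition sgn_ell2 :: "ell2 \<Rightarrow> ell2" where
  "sgn_ell2 a = inverse (norm a) *\<^sub>R a"
definition dist_ell2 :: "ell2 \<Rightarrow> ell2 \<Rightarrow> real" where
  "dist_ell2 a b = norm (a - b)"
definition uniformity_ell2 :: "(ell2 \<times> ell2) filter" where
  "uniformity_ell2 = (INF e\<in>{0<..}. principal {(x, y). dist x y < e})"
definition open_ell2 :: "ell2 set \<Rightarrow> bool" where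
  "open_ell2 U \<longleftrightarrow> (\<forall>x\<in>U. \<forall>\<^sub>F (x', y) in uniformity. x' = x \<longrightarrow> y \<in> U)"

instance
proof
  note simps = plus_ell2.rep_eq zero_ell2.rep_eq scaleC_ell2.rep_eq uminus_ell2.rep_eq
    minus_ell2.rep_eq scaleR_ell2_def
  fix a b d :: ell2 and r s :: real and c c' :: complex
  show "a + b + d = a + (b + d)" "a + b = b + a" "0 + a = a" "- a + a = 0" "a - b = a + - b"
    "r *\<^sub>R (a + b) = r *\<^sub>R a + r *\<^sub>R b" "(r + s) *\<^sub>R a = r *\<^sub>R a + s *\<^sub>R a"
    "r *\<^sub>R s *\<^sub>R a = (r * s) *\<^sub>R a" "1 *\<^sub>R a = a"
    "c *\<^sub>C (a + b) = c *\<^sub>C a + c *\<^sub>C b" "(c + c') *\<^sub>C a = c *\<^sub>C a + c' *\<^sub>C a"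
    "c *\<^sub>C c' *\<^sub>C a = (c * c') *\<^sub>C a" "of_real r *\<^sub>C a = r *\<^sub>R a"
    by (rule ell2_eqI; simp add: simps algebra_simps)+
  show "dist a b = norm (a - b)" by (rule dist_ell2_def)
  show "sgn a = inverse (norm a) *\<^sub>R a" by (rule sgn_ell2_def)
  show "uniformity = (INF e\<in>{0<..}. principal {(x, y :: ell2). dist x y < e})"
    by (rule uniformity_ell2_def)
  show "open U \<longleftrightarrow> (\<forall>x\<in>U. \<forall>\<^sub>F (x', y) in uniformity. x' = x \<longrightarrow> y \<in> U)" for U :: "ell2 set"
    by (rule open_ell2_def)
  show comm: "cinner a b = cnj (cinner b a)" for a b :: ell2
    unfolding cinner_ell2_def
    by (simp add: bounded_linear.suminf[OF bounded_linear_cnj summable_coord_mult] mult.commute)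
  show add: "cinner (a + b) d = cinner a d + cinner b d" for a b d :: ell2
    unfolding cinner_ell2_def
    by (simp add: simps distrib_right suminf_add[OF summable_coord_mult summable_coord_mult])
  show scale: "cinner (c *\<^sub>C a) b = c * cinner a b" for c and a b :: ell2
    unfolding cinner_ell2_def
    by (simp add: simps mult.assoc suminf_mult[OF summable_coord_mult])
  show "inner a b = Re (cinner a b)" by (rule inner_ell2_def)
  show "inner a b = inner b a"
    by (simp add: inner_ell2_def comm[of a b])
  show "inner (a + b) d = inner a d + inner b d"
    by (simp add: inner_ell2_def add)
  show "inner (r *\<^sub>R a) b = r * inner a b"
    by (simp add: inner_ell2_def scaleR_ell2_def scale)
  have sq: "inner a a = (\<Sum>n. (cmod (coord a n))\<^sup>2)" for a
  proof -
    have "cinner a a = (\<Sum>n. complex_of_real ((cmod (coord a n))\<^sup>2))"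
      unfolding cinner_ell2_def complex_norm_square ..
    also have "\<dots> = complex_of_real (\<Sum>n. (cmod (coord a n))\<^sup>2)"
      by (rule suminf_of_real[OF summable_coord, symmetric])
    finally show ?thesis
      by (simp add: inner_ell2_def)
  qed
  show "0 \<le> inner a a"
    unfolding sq by (intro suminf_nonneg summable_coord) simp
  show "inner a a = 0 \<longleftrightarrow> a = 0"
    unfolding sq suminf_eq_zero_iff[OF summable_coord zero_le_power2]
    by (auto simp: simps intro: ell2_eqI)
  show "norm a = sqrt (inner a a)"
    unfolding sq norm_ell2_def ..
qed

end

instance ell2 :: chilbert_space
proof
  fix X :: "nat \<Rightarrow> ell2"
  assume X: "Cauchy X"
  have part: "(\<Sum>k<m. (cmod (coord a k))\<^sup>2) \<le> (norm a)\<^sup>2" for a m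
    unfolding norm_ell2_def
    by (subst real_sqrt_pow2) (auto intro!: suminf_nonneg sum_le_suminf summable_coord)
  have diff: "coord (a - b) k = coord a k - coord b k" for a b k
    by (simp add: minus_ell2.rep_eq)
  have "Cauchy (\<lambda>i. coord (X i) k)" for k
  proof (rule metric_CauchyI)
    fix e :: real assume "e > 0"
    with X obtain M where M: "\<And>m n. m \<ge> M \<Longrightarrow> n \<ge> M \<Longrightarrow> dist (X m) (X n) < e"
      by (meson metric_CauchyD)
    have "dist (coord a k) (coord b k) \<le> dist a b" for a b
    proof (rule power2_le_imp_le)
      have "(cmod (coord (a - b) k))\<^sup>2 \<le> (\<Sum>j<Suc k. (cmod (coord (a - b) j))\<^sup>2)"
        by (simp add: sum_nonneg)
      also have "\<dots> \<le> (norm (a - b))\<^sup>2" by (rule part)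
      finally show "(dist (coord a k) (coord b k))\<^sup>2 \<le> (dist a b)\<^sup>2"
        by (simp add: dist_norm diff)
    qed simp
    with M show "\<exists>M. \<forall>m\<ge>M. \<forall>n\<ge>M. dist (coord (X m) k) (coord (X n) k) < e"
      by (meson le_less_trans)
  qed
  then have "\<exists>l. (\<lambda>i. coord (X i) k) \<longlonglongrightarrow> l" for k
    by (simp add: Cauchy_convergent_iff convergent_def)
  then obtain L where L: "\<And>k. (\<lambda>i. coord (X i) k) \<longlonglongrightarrow> L k"
    by metis
  have tail: "\<exists>M. \<forall>i\<ge>M. \<forall>m. (\<Sum>k<m. (cmod (coord (X i) k - L k))\<^sup>2) \<le> e\<^sup>2" if "e > 0" for e
  proof -
    from X that obtain M where M: "\<And>m n. m \<ge> M \<Longrightarrow> n \<ge> M \<Longrightarrow> dist (X m) (X n) < e"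
      by (meson metric_CauchyD)
    have "(\<Sum>k<m. (cmod (coord (X i) k - L k))\<^sup>2) \<le> e\<^sup>2" if "i \<ge> M" for i m
    proof (rule tendsto_upperbound)
      show "(\<lambda>j. \<Sum>k<m. (cmod (coord (X i) k - coord (X j) k))\<^sup>2)
              \<longlonglongrightarrow> (\<Sum>k<m. (cmod (coord (X i) k - L k))\<^sup>2)"
        by (intro tendsto_intros L)
      show "\<forall>\<^sub>F j in sequentially. (\<Sum>k<m. (cmod (coord (X i) k - coord (X j) k))\<^sup>2) \<le> e\<^sup>2"
        using eventually_ge_at_top[of M]
      proof eventually_elim
        case (elim j)
        have "(norm (X i - X j))\<^sup>2 \<le> e\<^sup>2"
          using M[OF that elim] by (intro power_mono) (auto simp: dist_norm)
        then show ?case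
          using part[of "X i - X j" m] by (simp add: diff)
      qed
    qed simp
    then show ?thesis by blast
  qed
  have summ: "summable (\<lambda>k. (cmod (coord (X i) k - L k))\<^sup>2)"
    if "\<forall>m. (\<Sum>k<m. (cmod (coord (X i) k - L k))\<^sup>2) \<le> e\<^sup>2" for i e
    using that by (intro summableI_nonneg_bounded[where x = "e\<^sup>2"]) auto
  obtain M where "\<forall>m. (\<Sum>k<m. (cmod (coord (X M) k - L k))\<^sup>2) \<le> 1\<^sup>2"
    using tail[of 1] by auto
  from summable_sq_add[OF summable_coord[of "X M"] summable_sq_scale[OF summ[OF this], of "-1"]]
  have Ls: "summable (\<lambda>k. (cmod (L k))\<^sup>2)" by simp
  define l where "l = Abs_ell2 L"
  have l: "coord l = L"
    unfolding l_def using Ls by (simp add: Abs_ell2_inverse)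
  have "X \<longlonglongrightarrow> l"
  proof (rule metric_LIMSEQ_I)
    fix e :: real assume "e > 0"
    then obtain M where M: "\<And>i m. i \<ge> M \<Longrightarrow> (\<Sum>k<m. (cmod (coord (X i) k - L k))\<^sup>2) \<le> (e/2)\<^sup>2"
      using tail[of "e/2"] by auto
    have "dist (X i) l < e" if "i \<ge> M" for i
    proof -
      have "(\<Sum>k. (cmod (coord (X i) k - L k))\<^sup>2) \<le> (e/2)\<^sup>2"
        using M[OF that] by (intro suminf_le_const summ[where e = "e/2"]) auto
      then have "norm (X i - l) \<le> e/2"
        unfolding norm_ell2_def diff l using \<open>e > 0\<close> by (intro real_le_lsqrt) auto
      with \<open>e > 0\<close> show ?thesis by (simp add: dist_norm)
    qed
    then show "\<exists>M. \<forall>i\<ge>M. dist (X i) l < e" by blast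
  qed
  then show "convergent X" by (rule convergentI)
qed

lift_definition ell2_basis :: "nat \<Rightarrow> ell2" is "\<lambda>n k. if k = n then 1 else 0"
proof -
  fix n :: nat
  show "summable (\<lambda>k. (cmod (if k = n then 1 else 0))\<^sup>2)"
    by (rule summable_finite[of "{n}"]) auto
qed


section \<open>Operators\<close>

definition bounded_op :: "('a::complex_inner \<Rightarrow> 'b::complex_inner) \<Rightarrow> bool" where
  "bounded_op T \<longleftrightarrow> bounded_linear T \<and> (\<forall>c x. T (c *\<^sub>C x) = c *\<^sub>C T x)"

definition invertible_op :: "('a::complex_inner \<Rightarrow> 'b::complex_inner) \<Rightarrow> bool" where
  "invertible_op T \<longleftrightarrow> bounded_op T \<and> (\<exists>S. bounded_op S \<and> S \<circ> T = id \<and> T \<circ> S = id)"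

definition unitary_op :: "('a::complex_inner \<Rightarrow> 'b::complex_inner) \<Rightarrow> bool" where
  "unitary_op U \<longleftrightarrow> bounded_op U \<and> surj U \<and> (\<forall>x y. cinner (U x) (U y) = cinner x y)"

definition compact_op :: "('a::complex_inner \<Rightarrow> 'b::complex_inner) \<Rightarrow> bool" where
  "compact_op K \<longleftrightarrow> bounded_op K \<and> compact (closure (K ` cball 0 1))"

definition UK :: "('a::complex_inner \<Rightarrow> 'b::complex_inner) set" where
  "UK = {T. invertible_op T \<and> (\<exists>U K. unitary_op U \<and> compact_op K \<and> T = (\<lambda>x. U x + K x))}"

text \<open>Operator norm of the restriction of \<open>T\<close> to a subspace \<open>S\<close>; the quotient is 0 at \<open>x = 0\<close>,
  as in \<^const>\<open>onorm\<close>.\<close>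

definition onorm_on :: "'a::real_normed_vector set \<Rightarrow> ('a \<Rightarrow> 'b::real_normed_vector) \<Rightarrow> real" where
  "onorm_on S T = (SUP x\<in>S. norm (T x) / norm x)"

definition matrix_defines_op :: "(nat \<Rightarrow> nat \<Rightarrow> complex) \<Rightarrow> (ell2 \<Rightarrow> ell2) \<Rightarrow> bool" where
  "matrix_defines_op M T \<longleftrightarrow> (\<forall>a n. (\<lambda>p. M n p * coord a p) sums coord (T a) n)"


section \<open>Sequences of vectors\<close>

definition complete_seq :: "(nat \<Rightarrow> 'a::complex_inner) \<Rightarrow> bool" where
  "complete_seq x \<longleftrightarrow> closed_span (range x) = UNIV"

definition minimal_seq :: "(nat \<Rightarrow> 'a::complex_inner) \<Rightarrow> bool" where
  "minimal_seq x \<longleftrightarrow> (\<forall>n. x n \<notin> closed_span (x ` {l. l \<noteq> n}))"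

text \<open>Only meaningful for complete minimal sequences in a Hilbert space, where the
  biorthogonal sequence exists and is unique.\<close>

definition biorthogonal :: "(nat \<Rightarrow> 'a::complex_inner) \<Rightarrow> nat \<Rightarrow> 'a" where
  "biorthogonal x = (THE y. \<forall>l n. cinner (x l) (y n) = (if l = n then 1 else 0))"

definition AOB :: "(nat \<Rightarrow> 'a::complex_inner) \<Rightarrow> bool" where
  "AOB x \<longleftrightarrow> (\<exists>c C :: nat \<Rightarrow> real.
     (\<forall>N. c N > 0 \<and> C N > 0 \<and>
       (\<forall>a :: nat \<Rightarrow> complex. finite {n. a n \<noteq> 0} \<longrightarrow>
          c N * (\<Sum>n | n \<ge> N \<and> a n \<noteq> 0. (cmod (a n))\<^sup>2)
            \<le> (norm (\<Sum>n | n \<ge> N \<and> a n \<noteq> 0. a n *\<^sub>C x n))\<^sup>2 \<and>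
          (norm (\<Sum>n | n \<ge> N \<and> a n \<noteq> 0. a n *\<^sub>C x n))\<^sup>2
            \<le> C N * (\<Sum>n | n \<ge> N \<and> a n \<noteq> 0. (cmod (a n))\<^sup>2))) \<and>
     c \<longlonglongrightarrow> 1 \<and> C \<longlonglongrightarrow> 1)"

definition gram_matrix :: "(nat \<Rightarrow> 'a::complex_inner) \<Rightarrow> nat \<Rightarrow> nat \<Rightarrow> complex" where
  "gram_matrix x n p = cinner (x n) (x p)"

text \<open>The formal map \<open>f \<mapsto> (\<langle>f, x\<^sub>n\<rangle>)\<^sub>n\<close>, with values in all complex sequences. When \<open>x\<close> is
  complete and minimal, this is the interpolation operator attached to the biorthogonal
  sequence of \<open>x\<close>: it sends the \<open>n\<close>-th biorthogonal vector to the \<open>n\<close>-th unit sequence.\<close>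

definition interpolation_map :: "(nat \<Rightarrow> 'a::complex_inner) \<Rightarrow> 'a \<Rightarrow> nat \<Rightarrow> complex" where
  "interpolation_map x f = (\<lambda>n. cinner f (x n))"

definition all_equivalent :: "bool list \<Rightarrow> bool" where
  "all_equivalent Ps \<longleftrightarrow> (\<forall>P\<in>set Ps. \<forall>Q\<in>set Ps. P \<longleftrightarrow> Q)"

end

theory Submission
  imports Defs
begin

text \<open>All conditions are compared with one property, \<open>AO_basis x\<close>: there is a bounded invertible
  operator \<open>A\<close> from \<open>ell2\<close> to the Hilbert space that maps the unit vectors to the \<open>x n\<close> and is
  asymptotically isometric, which means that \<open>\<parallel>A a\<parallel>\<^sup>2 / \<parallel>a\<parallel>\<^sup>2\<close> is close to 1 for all nonzero \<open>a\<close>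
  supported far out. The adjoint of \<open>A\<close> is explicit, \<open>f \<mapsto> (cinner f (x n))\<^sub>n\<close>, and the Gram operator is
  \<open>G = adj A \<circ> A\<close>.

  The central fact is that, for bounded \<open>A\<close>, being asymptotically isometric means that \<open>G - I\<close> is
  compact. A compact operator is small on sequences supported far out
  (\<open>compact_op_small_on_tails\<close>); conversely, the compression of the self-adjoint operator \<open>G - I\<close>
  to far tails has small quadratic form \<open>\<parallel>A a\<parallel>\<^sup>2 - \<parallel>a\<parallel>\<^sup>2\<close> and therefore small norm, and it differs
  from \<open>G - I\<close> by a finite rank operator (\<open>compact_gram_if_asymp_isometric\<close>). From this follow:

  \<^item> the condition on the Gram matrix, which is \<open>G\<close> up to conjugation of coordinates;

  \<^item> the condition on the operator \<open>U = A\<inverse>\<close>: the positive square root \<open>S\<close> of \<open>G\<close> is the identity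
    plus a compact operator, \<open>S \<circ> U\<close> is unitary, and \<open>U - S \<circ> U\<close> is compact
    (\<open>UK_if_asymp_isometric\<close>); conversely, an inverse of a unitary plus compact operator is an
    isometry plus a compact operator and hence asymptotically isometric;

  \<^item> duality: the synthesis operator \<open>B\<close> of the biorthogonal sequence is the inverse of \<open>adj A\<close>, and its
    Gram operator is the inverse of \<open>G\<close>, so that \<open>AO_basis\<close> passes to the biorthogonal sequence
    (\<open>AO_basis_dual\<close>). This gives the conditions on the biorthogonal sequence and on the
    interpolation operator, which is \<open>adj A = B\<inverse>\<close>.

  The remaining conditions restate the two-sided bounds for \<open>A\<close> or \<open>B\<close> on tails. Where the
  operator is not given by the condition itself, it has to be constructed: boundedness comes from
  the upper (Bessel) bounds by \<open>synthesis_op_exists\<close>, and invertibility from completeness or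
  biorthogonality together with \<open>coercive_invertible\<close>, applied to \<open>adj A \<circ> A\<close> or \<open>A \<circ> adj A\<close>.\<close>

section \<open>Complex inner products\<close>

instance chilbert_space \<subseteq> banach ..

lemma cinner_add_right: "cinner x (y + z) = cinner x y + cinner x (z::'a::complex_inner)"
  by (metis cinner_add_left cinner_commute complex_cnj_add)

lemma cinner_scaleC_right: "cinner x (c *\<^sub>C y) = cnj c * cinner x (y::'a::complex_inner)"
  by (metis cinner_commute cinner_scaleC_left complex_cnj_mult)

lemma cinner_zero_left [simp]: "cinner 0 (y::'a::complex_inner) = 0"
  using cinner_add_left[of 0 0 y] by simp

lemma cinner_zero_right [simp]: "cinner (y::'a::complex_inner) 0 = 0"
  using cinner_add_right[of y 0 0] by simp

lemma cinner_diff_left: "cinner (x - y) z = cinner x z - cinner y (z::'a::complex_inner)"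
  using cinner_add_left[of "x - y" y z] by simp

lemma cinner_sum_left: "cinner (\<Sum>i\<in>F. f i) y = (\<Sum>i\<in>F. cinner (f i) (y::'a::complex_inner))"
  by (induction F rule: infinite_finite_induct) (auto simp: cinner_add_left)

lemma cinner_sum_right: "cinner y (\<Sum>i\<in>F. f i) = (\<Sum>i\<in>F. cinner (y::'a::complex_inner) (f i))"
  by (induction F rule: infinite_finite_induct) (auto simp: cinner_add_right)

lemma scaleC_zero_right [simp]: "c *\<^sub>C (0::'a::complex_inner) = 0"
  by (rule complex_vector.scale_zero_right)

lemma scaleC_zero_left [simp]: "0 *\<^sub>C (x::'a::complex_inner) = 0"
  by (rule complex_vector.scale_zero_left)

lemma scaleC_one [simp]: "1 *\<^sub>C (x::'a::complex_inner) = x"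
  by (rule complex_vector.scale_one)

lemma scaleR_eq_scaleC: "r *\<^sub>R (x::'a::complex_inner) = of_real r *\<^sub>C x"
  by (simp add: scaleC_of_real)

lemma cinner_self: "cinner x x = of_real ((norm (x::'a::complex_inner))\<^sup>2)"
proof (rule complex_eqI)
  show "Re (cinner x x) = Re (of_real ((norm x)\<^sup>2))"
    by (simp add: inner_eq_Re_cinner[symmetric] power2_norm_eq_inner)
  show "Im (cinner x x) = Im (of_real ((norm x)\<^sup>2))"
    using arg_cong[OF cinner_commute[of x x], of Im] by simp
qed

lemma norm_scaleC: "norm (c *\<^sub>C (x::'a::complex_inner)) = cmod c * norm x"
proof -
  have "complex_of_real ((norm (c *\<^sub>C x))\<^sup>2) = c * cnj c * of_real ((norm x)\<^sup>2)"
    by (simp only: cinner_self[symmetric] cinner_scaleC_left cinner_scaleC_right mult_ac)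
  also have "\<dots> = of_real ((cmod c * norm x)\<^sup>2)"
    by (simp add: complex_norm_square[symmetric] power_mult_distrib)
  finally have "(norm (c *\<^sub>C x))\<^sup>2 = (cmod c * norm x)\<^sup>2"
    by (simp only: of_real_eq_iff)
  then show ?thesis
    by (rule power2_eq_imp_eq) auto
qed

lemma cmod_cinner_le: "cmod (cinner x y) \<le> norm x * norm (y::'a::complex_inner)"
proof -
  \<comment> \<open>Rotating \<open>x\<close> by a phase makes the complex inner product equal to the real one.\<close>
  define c where "c = cnj (sgn (cinner x y))"
  have "c * cinner x y = of_real (cmod (cinner x y))"
  proof (cases "cinner x y = 0")
    case False
    have "c * cinner x y = cinner x y * cnj (cinner x y) / of_real (cmod (cinner x y))"
      by (simp add: c_def sgn_eq)
    also have "\<dots> = of_real (cmod (cinner x y))"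
      using False by (simp add: complex_norm_square[symmetric] power2_eq_square)
    finally show ?thesis .
  qed (simp add: c_def)
  then have "cmod (cinner x y) = inner (c *\<^sub>C x) y"
    by (simp add: inner_eq_Re_cinner cinner_scaleC_left)
  also have "\<dots> \<le> norm (c *\<^sub>C x) * norm y"
    by (rule norm_cauchy_schwarz)
  also have "\<dots> \<le> norm x * norm y"
    by (intro mult_right_mono) (auto simp: norm_scaleC c_def norm_sgn)
  finally show ?thesis .
qed

lemma cinner_eq_inner: "cinner x y = Complex (inner x y) (inner x (\<i> *\<^sub>C (y::'a::complex_inner)))"
  by (rule complex_eqI) (simp_all add: inner_eq_Re_cinner cinner_scaleC_right)

lemma bounded_linear_cinner_left: "bounded_linear (\<lambda>x. cinner x (y::'a::complex_inner))"
proof (rule bounded_linear_intro)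
  show "cinner (x + z) y = cinner x y + cinner z y" for x z by (rule cinner_add_left)
  show "cinner (r *\<^sub>R x) y = r *\<^sub>R cinner x y" for r x
    by (simp add: scaleR_eq_scaleC cinner_scaleC_left scaleR_conv_of_real)
  show "norm (cinner x y) \<le> norm x * norm y" for x by (rule cmod_cinner_le)
qed

lemma bounded_linear_cinner_right: "bounded_linear (\<lambda>y. cinner (x::'a::complex_inner) y)"
proof (rule bounded_linear_intro)
  show "cinner x (y + z) = cinner x y + cinner x z" for y z by (rule cinner_add_right)
  show "cinner x (r *\<^sub>R y) = r *\<^sub>R cinner x y" for r y
    by (simp add: scaleR_eq_scaleC cinner_scaleC_right scaleR_conv_of_real)
  show "norm (cinner x y) \<le> norm y * norm x" for y
    using cmod_cinner_le[of x y] by (simp add: mult.commute)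
qed

lemma eq_zero_if_cinner_self: "cinner x x = 0 \<Longrightarrow> (x::'a::complex_inner) = 0"
  by (simp add: cinner_self)


section \<open>Closed linear spans and orthogonality\<close>

lemma span_subset_closed_span: "complex_vector.span S \<subseteq> closed_span (S::'a::complex_inner set)"
  unfolding closed_span_def by (rule closure_subset)

lemma closed_span_superset: "S \<subseteq> closed_span (S::'a::complex_inner set)"
  using complex_vector.span_superset span_subset_closed_span by blast

lemma closed_span_minimal:
  fixes S :: "'a::complex_inner set"
  assumes "S \<subseteq> M" "complex_vector.subspace M" "closed M"
  shows "closed_span S \<subseteq> M"
  unfolding closed_span_def
  using assms by (meson closure_minimal complex_vector.span_minimal)

lemma closed_closed_span: "closed (closed_span (S::'a::complex_inner set))"
  by (simp add: closed_span_def)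

lemma bounded_linear_scaleC: "bounded_linear (\<lambda>x::'a::complex_inner. c *\<^sub>C x)"
proof (rule bounded_linear_intro)
  show "c *\<^sub>C (x + y) = c *\<^sub>C x + c *\<^sub>C y" for x y :: 'a by (rule scaleC_add_right)
  show "c *\<^sub>C (r *\<^sub>R x) = r *\<^sub>R (c *\<^sub>C x)" for r and x :: 'a
    by (simp add: scaleR_eq_scaleC scaleC_scaleC mult.commute)
  show "norm (c *\<^sub>C x) \<le> norm x * cmod c" for x :: 'a
    by (simp add: norm_scaleC mult.commute)
qed

lemma subspace_closed_span: "complex_vector.subspace (closed_span (S::'a::complex_inner set))"
proof (rule complex_vector.subspaceI)
  have sub: "complex_vector.subspace (complex_vector.span S)"
    by (rule complex_vector.subspace_span)
  show "0 \<in> closed_span S"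
    using span_subset_closed_span complex_vector.span_zero by blast
  show "c *\<^sub>C y \<in> closed_span S" if y: "y \<in> closed_span S" for c y
  proof -
    obtain f where f: "\<And>n::nat. f n \<in> complex_vector.span S" "f \<longlonglongrightarrow> y"
      using y unfolding closed_span_def closure_sequential by blast
    have "(\<lambda>n. c *\<^sub>C f n) \<longlonglongrightarrow> c *\<^sub>C y"
      by (rule bounded_linear.tendsto[OF bounded_linear_scaleC f(2)])
    moreover have "c *\<^sub>C f n \<in> complex_vector.span S" for n
      by (rule complex_vector.span_scale[OF f(1)])
    ultimately show ?thesis
      unfolding closed_span_def closure_sequential
      by (intro exI[of _ "\<lambda>n. c *\<^sub>C f n"] conjI allI)
  qed
  show "y + z \<in> closed_span S" if y: "y \<in> closed_span S" and z: "z \<in> closed_span S" for y z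
  proof -
    obtain f g where f: "\<And>n::nat. f n \<in> complex_vector.span S" "f \<longlonglongrightarrow> y"
      and g: "\<And>n::nat. g n \<in> complex_vector.span S" "g \<longlonglongrightarrow> z"
      using y z unfolding closed_span_def closure_sequential by blast
    have "(\<lambda>n. f n + g n) \<longlonglongrightarrow> y + z"
      by (intro tendsto_add f g)
    moreover have "f n + g n \<in> complex_vector.span S" for n
      by (rule complex_vector.span_add[OF f(1) g(1)])
    ultimately show ?thesis
      unfolding closed_span_def closure_sequential
      by (intro exI[of _ "\<lambda>n. f n + g n"] conjI allI)
  qed
qed

lemma closed_subspace_orth:
  "closed {g::'a::complex_inner. cinner f g = 0}"
  "complex_vector.subspace {g::'a::complex_inner. cinner f g = 0}"
proof -
  show "closed {g. cinner f g = 0}"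
    by (intro closed_Collect_eq continuous_intros
        linear_continuous_on bounded_linear_cinner_right)
  show "complex_vector.subspace {g. cinner f g = 0}"
    by (rule complex_vector.subspaceI) (auto simp: cinner_add_right cinner_scaleC_right)
qed

lemma orth_complement_closed_span:
  "orth_complement (closed_span S) = {f::'a::complex_inner. \<forall>g\<in>S. cinner f g = 0}"
proof (intro set_eqI iffI)
  fix f assume "f \<in> {f. \<forall>g\<in>S. cinner f g = 0}"
  then have "closed_span S \<subseteq> {g. cinner f g = 0}"
    by (intro closed_span_minimal closed_subspace_orth) auto
  then show "f \<in> orth_complement (closed_span S)"
    by (auto simp: orth_complement_def)
next
  fix f assume "f \<in> orth_complement (closed_span S)"
  then show "f \<in> {f. \<forall>g\<in>S. cinner f g = 0}"
    using closed_span_superset by (auto simp: orth_complement_def)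
qed

lemma complete_seq_orth_zero:
  assumes "complete_seq x" "\<And>n. cinner f (x n) = 0"
  shows "(f::'a::complex_inner) = 0"
proof -
  have "f \<in> orth_complement (closed_span (range x))"
    unfolding orth_complement_closed_span using assms(2) by auto
  then show ?thesis
    using assms(1) by (auto simp: complete_seq_def orth_complement_def intro: eq_zero_if_cinner_self)
qed

lemma parallelogram_midpoint:
  fixes x a b :: "'a::real_inner"
  shows "(dist a b)\<^sup>2 = 2 * (norm (x - a))\<^sup>2 + 2 * (norm (x - b))\<^sup>2 - 4 * (norm (x - (1/2) *\<^sub>R (a + b)))\<^sup>2"
  unfolding dist_norm power2_norm_eq_inner
  by (simp add: inner_diff_left inner_diff_right inner_add_left inner_add_right inner_commute
      algebra_simps)

lemma linear_coeff_zero_if_quadratic_nonneg: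
  fixes a b :: real
  assumes "\<And>t. 0 \<le> - 2 * t * a + t\<^sup>2 * b" "b \<ge> 0"
  shows "a = 0"
proof (rule ccontr)
  assume "a \<noteq> 0"
  define t where "t = a / (b + 1)"
  have ta: "t * (b + 1) = a" and t0: "t \<noteq> 0"
    using \<open>b \<ge> 0\<close> \<open>a \<noteq> 0\<close> by (auto simp: t_def)
  have "- 2 * t * a + t\<^sup>2 * b = - (t\<^sup>2 * (b + 2))"
    unfolding ta[symmetric] by (simp add: power2_eq_square algebra_simps)
  moreover have "t\<^sup>2 * (b + 2) > 0"
    using t0 \<open>b \<ge> 0\<close> by simp
  ultimately show False
    using assms(1)[of t] by linarith
qed

text \<open>The orthogonal projection of \<open>x\<close> onto a closed subspace is its nearest point there; a minimizing
  sequence is Cauchy by the parallelogram law.\<close>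

lemma orthogonal_projection_exists:
  fixes x :: "'a::chilbert_space"
  assumes M: "complex_vector.subspace M" "closed M"
  obtains p where "p \<in> M" "\<And>m. m \<in> M \<Longrightarrow> cinner (x - p) m = 0"
proof -
  have zero: "0 \<in> M" and add: "\<And>a b. a \<in> M \<Longrightarrow> b \<in> M \<Longrightarrow> a + b \<in> M"
    and sc: "\<And>c a. a \<in> M \<Longrightarrow> c *\<^sub>C a \<in> M"
    using M(1) by (auto simp: complex_vector.subspace_def)
  have scR: "r *\<^sub>R a \<in> M" if "a \<in> M" for r a
    using sc[OF that] by (simp add: scaleR_eq_scaleC)
  \<comment> \<open>\<open>d\<close> is the squared distance from \<open>x\<close> to \<open>M\<close>.\<close>
  define d where "d = (INF m\<in>M. (norm (x - m))\<^sup>2)"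
  have bdd: "bdd_below ((\<lambda>m. (norm (x - m))\<^sup>2) ` M)"
    by (rule bdd_belowI[of _ 0]) auto
  have d_le: "d \<le> (norm (x - m))\<^sup>2" if "m \<in> M" for m
    unfolding d_def by (rule cINF_lower[OF bdd that])
  have "\<exists>m\<in>M. (norm (x - m))\<^sup>2 < d + 1 / real (Suc n)" for n
    using cINF_less_iff[OF _ bdd, of "d + 1 / real (Suc n)"] zero
    by (auto simp: d_def)
  then obtain m where m: "\<And>n. m n \<in> M" "\<And>n. (norm (x - m n))\<^sup>2 < d + 1 / real (Suc n)"
    by metis
  have close: "(dist (m i) (m j))\<^sup>2 < 4 / real (Suc N)" if "i \<ge> N" "j \<ge> N" for i j N
  proof -
    have "1 / real (Suc i) \<le> 1 / real (Suc N)" "1 / real (Suc j) \<le> 1 / real (Suc N)"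
      using that by (auto simp: frac_le)
    moreover have "d \<le> (norm (x - (1/2) *\<^sub>R (m i + m j)))\<^sup>2"
      by (intro d_le scR add m)
    ultimately show ?thesis
      using m(2)[of i] m(2)[of j] unfolding parallelogram_midpoint[of _ _ x] by simp
  qed
  have "Cauchy m"
  proof (rule metric_CauchyI)
    fix e :: real assume "e > 0"
    then obtain N where N: "4 / e\<^sup>2 < real N"
      using reals_Archimedean2 by blast
    then have "4 / e\<^sup>2 < real (Suc N)"
      by simp
    then have "4 / real (Suc N) < e\<^sup>2"
      using \<open>e > 0\<close> by (simp add: field_simps del: of_nat_Suc)
    then have "(dist (m i) (m j))\<^sup>2 < e\<^sup>2" if "i \<ge> N" "j \<ge> N" for i j
      using close[OF that] by linarith
    then show "\<exists>N. \<forall>i\<ge>N. \<forall>j\<ge>N. dist (m i) (m j) < e"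
      using \<open>e > 0\<close> by (meson power_less_imp_less_base less_imp_le)
  qed
  then obtain p where p: "m \<longlonglongrightarrow> p"
    using Cauchy_convergent convergent_def by blast
  have pM: "p \<in> M"
    using closed_sequentially[OF M(2) m(1) p] .
  have "(\<lambda>n. (norm (x - m n))\<^sup>2) \<longlonglongrightarrow> (norm (x - p))\<^sup>2"
    by (intro tendsto_intros p)
  moreover have "(\<lambda>n. d + 1 / real (Suc n)) \<longlonglongrightarrow> d + 0"
    by (intro tendsto_add tendsto_const LIMSEQ_Suc lim_1_over_n)
  moreover have "\<exists>N. \<forall>n\<ge>N. (norm (x - m n))\<^sup>2 \<le> d + 1 / real (Suc n)"
    using less_imp_le[OF m(2)] by blast
  ultimately have "(norm (x - p))\<^sup>2 \<le> d + 0"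
    by (rule LIMSEQ_le)
  then have p_min: "(norm (x - p))\<^sup>2 \<le> d" by simp
  \<comment> \<open>Minimality in the real direction \<open>q\<close>; the complex statement follows by also taking \<open>\<i> q\<close>.\<close>
  have re: "inner (x - p) q = 0" if "q \<in> M" for q
  proof -
    have "0 \<le> - 2 * t * inner (x - p) q + t\<^sup>2 * (norm q)\<^sup>2" for t
    proof -
      have "(norm (x - p))\<^sup>2 \<le> (norm ((x - p) - t *\<^sub>R q))\<^sup>2"
        using p_min d_le[OF add[OF pM scR[OF that]], of t] unfolding diff_diff_eq
        by (rule order_trans)
      also have "\<dots> = (norm (x - p))\<^sup>2 - 2 * t * inner (x - p) q + t\<^sup>2 * (norm q)\<^sup>2"
        unfolding power2_norm_eq_inner power2_eq_square[of t] inner_diff_left[of "x - p"]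
          inner_diff_right[of _ "x - p"] inner_scaleR_left inner_scaleR_right
          inner_commute[of q "x - p"]
        by (simp only: algebra_simps mult_2)
      finally show ?thesis by simp
    qed
    then show ?thesis
      by (rule linear_coeff_zero_if_quadratic_nonneg) simp
  qed
  have "cinner (x - p) q = 0" if "q \<in> M" for q
    using re[OF that] re[OF sc[OF that]] by (simp add: cinner_eq_inner complex_eq_iff)
  with pM show ?thesis
    by (rule that)
qed

text \<open>The \<open>n\<close>-th biorthogonal vector is the component of \<open>x n\<close> orthogonal to all other \<open>x l\<close>, which is
  nonzero by minimality, divided by its squared norm.\<close>

lemma biorthogonal_exists:
  fixes x :: "nat \<Rightarrow> 'a::chilbert_space"
  assumes "minimal_seq x"
  shows "\<exists>y. \<forall>l n. cinner (x l) (y n) = (if l = n then 1 else 0)"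
proof -
  have "\<exists>z. \<forall>l. cinner (x l) z = (if l = n then 1 else 0)" for n
  proof -
    define M where "M = closed_span (x ` {l. l \<noteq> n})"
    obtain p where p: "p \<in> M" "\<And>m. m \<in> M \<Longrightarrow> cinner (x n - p) m = 0"
      using orthogonal_projection_exists[of M "x n"] subspace_closed_span closed_closed_span
      unfolding M_def by blast
    define w where "w = x n - p"
    have w0: "w \<noteq> 0"
      using p(1) assms by (auto simp: minimal_seq_def M_def w_def)
    have wM: "cinner m w = 0" if "m \<in> M" for m
      using p(2)[OF that] cinner_commute[of m w] by (simp add: w_def)
    have 1: "cinner (x l) w = 0" if "l \<noteq> n" for l
    proof (rule wM)
      show "x l \<in> M"
        unfolding M_def using that by (intro subsetD[OF closed_span_superset]) auto
    qed
    have 2: "cinner (x n) w = of_real ((norm w)\<^sup>2)"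
      using wM[OF p(1)] cinner_self[of w] by (simp add: w_def cinner_diff_left)
    define k where "k = complex_of_real ((norm w)\<^sup>2)"
    have k: "k \<noteq> 0" "cinner (x n) w = k"
      using 2 w0 by (simp_all add: k_def)
    have "cinner (x l) (cnj (inverse k) *\<^sub>C w) = (if l = n then 1 else 0)" for l
      unfolding cinner_scaleC_right using 1[of l] k by (cases "l = n") simp_all
    then show ?thesis by blast
  qed
  then show ?thesis by metis
qed

lemma biorthogonal_eqI:
  fixes x :: "nat \<Rightarrow> 'a::complex_inner"
  assumes "complete_seq x" "\<And>l n. cinner (x l) (y n) = (if l = n then 1 else 0)"
  shows "biorthogonal x = y"
  unfolding biorthogonal_def
proof (rule the_equality)
  show "\<forall>l n. cinner (x l) (y n) = (if l = n then 1 else 0)"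
    using assms(2) by blast
  fix z assume z: "\<forall>l n. cinner (x l) (z n) = (if l = n then 1 else 0)"
  show "z = y"
  proof
    fix n
    have "cinner (z n - y n) (x l) = 0" for l
      using z assms(2) cinner_commute[of "z n" "x l"] cinner_commute[of "y n" "x l"]
      by (simp add: cinner_diff_left)
    from complete_seq_orth_zero[OF assms(1) this] show "z n = y n"
      by simp
  qed
qed

lemma cinner_biorthogonal:
  fixes x :: "nat \<Rightarrow> 'a::chilbert_space"
  assumes "complete_seq x" "minimal_seq x"
  shows "cinner (x l) (biorthogonal x n) = (if l = n then 1 else 0)"
proof -
  obtain y where y: "\<And>l n. cinner (x l) (y n) = (if l = n then 1 else 0)"
    using biorthogonal_exists[OF assms(2)] by blast
  then show ?thesis
    using biorthogonal_eqI[OF assms(1) y] by simp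
qed


section \<open>Bounded operators\<close>

lemma bounded_opI:
  fixes T :: "'a::complex_inner \<Rightarrow> 'b::complex_inner"
  assumes "\<And>x y. T (x + y) = T x + T y" "\<And>c x. T (c *\<^sub>C x) = c *\<^sub>C T x"
    "\<And>x. norm (T x) \<le> M * norm x"
  shows "bounded_op T"
  unfolding bounded_op_def
proof (intro conjI allI)
  show "bounded_linear T"
  proof (rule bounded_linear_intro)
    show "norm (T x) \<le> norm x * M" for x
      using assms(3)[of x] by (simp add: mult.commute)
  qed (simp_all add: assms scaleR_eq_scaleC)
qed (rule assms)

lemma bounded_op_bounded_linear: "bounded_op T \<Longrightarrow> bounded_linear T"
  by (simp add: bounded_op_def)

lemma bounded_op_scaleC: "bounded_op T \<Longrightarrow> T (c *\<^sub>C x) = c *\<^sub>C T x"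
  by (simp add: bounded_op_def)

lemma bounded_op_scaleR: "bounded_op T \<Longrightarrow> T (r *\<^sub>R x) = r *\<^sub>R T x"
  by (simp add: scaleR_eq_scaleC bounded_op_scaleC)

lemma bounded_op_add: "bounded_op T \<Longrightarrow> T (x + y) = T x + T y"
  by (rule linear_add[OF bounded_linear.linear[OF bounded_op_bounded_linear]])

lemma bounded_op_diff: "bounded_op T \<Longrightarrow> T (x - y) = T x - T y"
  by (rule linear_diff[OF bounded_linear.linear[OF bounded_op_bounded_linear]])

lemma bounded_op_zero: "bounded_op T \<Longrightarrow> T 0 = 0"
  by (rule linear_0[OF bounded_linear.linear[OF bounded_op_bounded_linear]])

lemma bounded_op_sum: "bounded_op T \<Longrightarrow> T (\<Sum>i\<in>F. f i) = (\<Sum>i\<in>F. T (f i))"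
  by (rule linear_sum[OF bounded_linear.linear[OF bounded_op_bounded_linear]])

lemma bounded_op_bound:
  assumes "bounded_op T"
  obtains M where "M > 0" "\<And>x. norm (T x) \<le> M * norm x"
  using bounded_linear.pos_bounded[OF bounded_op_bounded_linear[OF assms]]
  by (auto simp: mult.commute)

lemma bounded_op_tendsto: "bounded_op T \<Longrightarrow> (f \<longlongrightarrow> l) F \<Longrightarrow> ((\<lambda>x. T (f x)) \<longlongrightarrow> T l) F"
  by (rule bounded_linear.tendsto[OF bounded_op_bounded_linear])

lemma bounded_op_id: "bounded_op (\<lambda>x. x)"
  by (rule bounded_opI[where M = 1]) auto

lemma bounded_op_compose:
  assumes "bounded_op S" "bounded_op T"
  shows "bounded_op (\<lambda>x. S (T x))"
  using bounded_linear_compose[of S T] assms by (auto simp: bounded_op_def)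

lemma bounded_op_plus:
  assumes "bounded_op S" "bounded_op T"
  shows "bounded_op (\<lambda>x. S x + T x)"
  using bounded_linear_add[of S T] assms by (auto simp: bounded_op_def scaleC_add_right)

lemma bounded_op_scale:
  assumes "bounded_op T"
  shows "bounded_op (\<lambda>x. c *\<^sub>C T x)"
  using bounded_linear_compose[OF bounded_linear_scaleC[of c], of T] assms
  by (auto simp: bounded_op_def scaleC_scaleC mult.commute)

lemma scaleC_minus_one: "(-1) *\<^sub>C (x::'a::complex_inner) = - x"
  using complex_vector.scale_minus_left[of 1 x] by simp

lemma bounded_op_minus:
  assumes "bounded_op S" "bounded_op T"
  shows "bounded_op (\<lambda>x. S x - T x)"
  using bounded_op_plus[OF assms(1) bounded_op_scale[OF assms(2), of "-1"]]
  by (simp add: scaleC_minus_one)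

lemma bounded_op_scaleR_op: "bounded_op T \<Longrightarrow> bounded_op (\<lambda>x. r *\<^sub>R T x)"
  using bounded_op_scale[of T "of_real r"] by (simp add: scaleR_eq_scaleC)

lemma cinner_preserving_if_inner:
  fixes U :: "'a::complex_inner \<Rightarrow> 'b::complex_inner"
  assumes "bounded_op U" "\<And>x y. inner (U x) (U y) = inner x y"
  shows "cinner (U x) (U y) = cinner x y"
  using assms(2)[of x y] assms(2)[of x "\<i> *\<^sub>C y"]
  by (simp add: cinner_eq_inner bounded_op_scaleC[OF assms(1)])

lemma invertible_opI:
  fixes T :: "'a::complex_inner \<Rightarrow> 'b::complex_inner"
  assumes T: "bounded_op T" "surj T" and bd: "\<And>x. norm x \<le> M * norm (T x)"
  shows "invertible_op T"
proof -
  have "inj T"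
  proof (rule injI)
    fix x y assume "T x = T y"
    then show "x = y"
      using bd[of "x - y"] by (simp add: bounded_op_diff[OF T(1)])
  qed
  define S where "S = inv T"
  have ST: "S (T x) = x" for x
    using \<open>inj T\<close> by (simp add: S_def)
  have TS: "T (S y) = y" for y
    using \<open>surj T\<close> by (simp add: S_def surj_f_inv_f)
  have "bounded_op S"
  proof (rule bounded_opI)
    show "S (x + y) = S x + S y" for x y
      using ST[of "S x + S y"] by (simp add: bounded_op_add[OF T(1)] TS)
    show "S (c *\<^sub>C x) = c *\<^sub>C S x" for c x
      using ST[of "c *\<^sub>C S x"] by (simp add: bounded_op_scaleC[OF T(1)] TS)
    show "norm (S x) \<le> M * norm x" for x
      using bd[of "S x"] by (simp add: TS)
  qed
  then show ?thesis
    unfolding invertible_op_def using T(1) ST TS by (auto simp: fun_eq_iff)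
qed

lemma invertible_opE:
  assumes "invertible_op T"
  obtains S where "bounded_op T" "bounded_op S" "\<And>x. S (T x) = x" "\<And>y. T (S y) = y"
  using assms unfolding invertible_op_def by (auto simp: fun_eq_iff)

lemma invertible_opI_inverse:
  assumes "bounded_op T" "bounded_op S" "\<And>x. S (T x) = x" "\<And>y. T (S y) = y"
  shows "invertible_op T"
  unfolding invertible_op_def using assms by (auto simp: fun_eq_iff)

lemma norm_cancel: "(norm x)\<^sup>2 \<le> c * norm x \<Longrightarrow> c \<ge> 0 \<Longrightarrow> norm (x::'a::real_normed_vector) \<le> c"
  by (cases "norm x = 0") (simp_all add: power2_eq_square)

text \<open>For small \<open>t > 0\<close> the map \<open>x \<mapsto> x - t (G x - y)\<close> is a contraction, and its fixed point
  solves \<open>G x = y\<close>.\<close>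

lemma coercive_invertible:
  fixes G :: "'a::chilbert_space \<Rightarrow> 'a"
  assumes G: "bounded_op G" and c: "c > 0" "\<And>x. inner (G x) x \<ge> c * (norm x)\<^sup>2"
  shows "invertible_op G"
proof -
  obtain M0 where M0: "M0 > 0" "\<And>x. norm (G x) \<le> M0 * norm x"
    using bounded_op_bound[OF G] by blast
  define M where "M = max M0 c"
  have M: "M > 0" "M \<ge> c" "norm (G x) \<le> M * norm x" for x
    using M0(1) M0(2)[of x] mult_right_mono[of M0 M "norm x"] by (auto simp: M_def)
  \<comment> \<open>The value of \<open>t\<close> that minimizes \<open>1 - 2 t c + t\<^sup>2 M\<^sup>2\<close>.\<close>
  define t where "t = c / M\<^sup>2"
  define q where "q = sqrt (1 - c\<^sup>2 / M\<^sup>2)"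
  have cM: "c\<^sup>2 / M\<^sup>2 \<le> 1" "c\<^sup>2 / M\<^sup>2 > 0" "t > 0"
    using M c power_mono[of c M 2] by (auto simp: t_def)
  have q: "0 \<le> q" "q < 1" "q\<^sup>2 = 1 - c\<^sup>2 / M\<^sup>2"
    using cM by (auto simp: q_def)
  have contr: "norm (x - t *\<^sub>R G x) \<le> q * norm x" for x
  proof (rule power2_le_imp_le)
    have "(norm (x - t *\<^sub>R G x))\<^sup>2 = (norm x)\<^sup>2 - 2 * t * inner (G x) x + t\<^sup>2 * (norm (G x))\<^sup>2"
      unfolding power2_norm_eq_inner power2_eq_square[of t] inner_diff_left[of "x"]
          inner_diff_right[of _ "x"] inner_scaleR_left inner_scaleR_right
          inner_commute[of x "G x"]
      by (simp only: algebra_simps mult_2)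
    also have "\<dots> \<le> (norm x)\<^sup>2 - 2 * t * (c * (norm x)\<^sup>2) + t\<^sup>2 * (M * norm x)\<^sup>2"
      using cM c(2)[of x] M(3)[of x]
      by (intro add_mono diff_mono mult_left_mono power_mono) auto
    also have "\<dots> = (1 - 2 * t * c + t\<^sup>2 * M\<^sup>2) * (norm x)\<^sup>2"
      by (simp add: algebra_simps power_mult_distrib)
    also have "1 - 2 * t * c + t\<^sup>2 * M\<^sup>2 = q\<^sup>2"
      using M(1) unfolding q(3) t_def by (simp add: field_simps power2_eq_square)
    finally show "(norm (x - t *\<^sub>R G x))\<^sup>2 \<le> (q * norm x)\<^sup>2"
      by (simp add: power_mult_distrib)
  qed (use q in simp)
  have "surj G"
    unfolding surj_def
  proof
    fix y
    have "\<exists>!x. x - t *\<^sub>R (G x - y) = x"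
    proof (rule banach_fix_type)
      show "\<forall>x z. dist (x - t *\<^sub>R (G x - y)) (z - t *\<^sub>R (G z - y)) \<le> q * dist x z"
      proof (intro allI)
        fix x z :: 'a
        have "x - t *\<^sub>R (G x - y) - (z - t *\<^sub>R (G z - y)) = (x - z) - t *\<^sub>R G (x - z)"
          by (simp add: bounded_op_diff[OF G] algebra_simps)
        then show "dist (x - t *\<^sub>R (G x - y)) (z - t *\<^sub>R (G z - y)) \<le> q * dist x z"
          using contr[of "x - z"] by (simp only: dist_norm)
      qed
    qed (use q in auto)
    then obtain x where "x - t *\<^sub>R (G x - y) = x" by blast
    then have "y = G x"
      using cM by simp
    then show "\<exists>x. y = G x" by blast
  qed
  moreover have "norm x \<le> inverse c * norm (G x)" for x
  proof -
    have "c * (norm x)\<^sup>2 \<le> norm (G x) * norm x"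
      using c(2)[of x] norm_cauchy_schwarz[of "G x" x] by linarith
    then have "(norm x)\<^sup>2 \<le> (inverse c * norm (G x)) * norm x"
      using c(1) by (simp add: field_simps)
    then show ?thesis
      by (rule norm_cancel) (use c in simp)
  qed
  ultimately show ?thesis
    using G by (intro invertible_opI) auto
qed

text \<open>By polarization, a bound for the quadratic form of a self-adjoint operator bounds its norm.\<close>

lemma symmetric_op_norm_le:
  fixes K :: "'a::complex_inner \<Rightarrow> 'a"
  assumes K: "bounded_op K" "\<And>x y. inner (K x) y = inner x (K y)"
    and e: "\<And>x. \<bar>inner (K x) x\<bar> \<le> e * (norm x)\<^sup>2"
  shows "norm (K x) \<le> e * norm x"
proof (cases "K x = 0 \<or> x = 0")
  case True
  have "0 \<le> e * norm x" if "x \<noteq> 0"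
  proof -
    have "0 \<le> (e * norm x) * norm x"
      using e[of x] by (simp add: power2_eq_square mult.assoc)
    then show ?thesis
      using that by (metis mult_neg_pos not_le zero_less_norm_iff)
  qed
  with True show ?thesis
    by (cases "x = 0") (simp_all add: bounded_op_zero[OF K(1)])
next
  case False
  \<comment> \<open>Rescaling \<open>x\<close> to the norm of \<open>K x\<close> makes the polarization estimate sharp.\<close>
  define s where "s = norm (K x) / norm x"
  have s: "s > 0"
    using False by (simp add: s_def)
  define u where "u = s *\<^sub>R x"
  define v where "v = K x"
  have nu: "norm u = norm v"
    using False by (simp add: u_def v_def s_def)
  have "4 * inner (K u) v = inner (K (u + v)) (u + v) - inner (K (u - v)) (u - v)"
    using K(2)[of v u]
    by (simp add: bounded_op_add[OF K(1)] bounded_op_diff[OF K(1)] inner_add_left inner_add_right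
        inner_diff_left inner_diff_right inner_commute[of v])
  also have "\<dots> \<le> e * (norm (u + v))\<^sup>2 + e * (norm (u - v))\<^sup>2"
    using e[of "u + v"] e[of "u - v"] by linarith
  also have "\<dots> = e * (2 * (norm u)\<^sup>2 + 2 * (norm v)\<^sup>2)"
    unfolding power2_norm_eq_inner
    by (simp add: inner_add_left inner_add_right inner_diff_left inner_diff_right algebra_simps)
  also have "\<dots> = 4 * e * (norm v)\<^sup>2"
    by (simp add: nu)
  finally have "inner (K u) v \<le> e * (norm v)\<^sup>2"
    by simp
  moreover have "inner (K u) v = s * (norm v)\<^sup>2"
    by (simp add: u_def v_def bounded_op_scaleR[OF K(1)] power2_norm_eq_inner)
  ultimately have "s \<le> e"
    using False by (simp add: v_def)
  then show ?thesis
    using False by (simp add: s_def field_simps)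
qed


section \<open>Compact operators\<close>

text \<open>Compactness in the form in which it is used: the image of the unit ball is totally bounded.\<close>

lemma compact_op_iff_totally_bounded:
  fixes K :: "'a::complex_inner \<Rightarrow> 'b::chilbert_space"
  shows "compact_op K \<longleftrightarrow>
    bounded_op K \<and> (\<forall>e>0. \<exists>F. finite F \<and> (\<forall>x. norm x \<le> 1 \<longrightarrow> (\<exists>y\<in>F. norm (K x - y) < e)))"
    (is "_ \<longleftrightarrow> bounded_op K \<and> ?tb")
proof -
  have "?tb" if cpt: "compact (closure (K ` cball 0 1))"
  proof (intro allI impI)
    fix e :: real assume "e > 0"
    then obtain F where F: "finite F" "closure (K ` cball 0 1) \<subseteq> (\<Union>y\<in>F. ball y e)"
      using cpt[unfolded compact_eq_totally_bounded, THEN conjunct2, rule_format, OF \<open>e > 0\<close>]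
      by (elim exE conjE)
    have "\<exists>y\<in>F. norm (K x - y) < e" if "norm x \<le> 1" for x
    proof -
      have "K x \<in> closure (K ` cball 0 1)"
        using that by (intro subsetD[OF closure_subset] imageI) simp
      then obtain y where "y \<in> F" "K x \<in> ball y e"
        using F(2) by blast
      then show ?thesis
        by (intro bexI[of _ y]) (auto simp: dist_norm norm_minus_commute)
    qed
    with F(1) show "\<exists>F. finite F \<and> (\<forall>x. norm x \<le> 1 \<longrightarrow> (\<exists>y\<in>F. norm (K x - y) < e))"
      by blast
  qed
  moreover have "compact (closure (K ` cball 0 1))" if tb: "?tb"
    unfolding compact_eq_totally_bounded
  proof (intro conjI allI impI)
    show "complete (closure (K ` cball 0 1))"
      by (simp add: complete_eq_closed)
    fix e :: real assume "e > 0"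
    then obtain F where F: "finite F" "\<And>x. norm x \<le> 1 \<Longrightarrow> \<exists>y\<in>F. norm (K x - y) < e / 2"
      using tb[rule_format, of "e / 2"] half_gt_zero[OF \<open>e > 0\<close>] by blast
    have "K ` cball 0 1 \<subseteq> (\<Union>y\<in>F. cball y (e / 2))"
    proof
      fix z assume "z \<in> K ` cball 0 1"
      then obtain x where x: "norm x \<le> 1" "z = K x" by auto
      obtain y where "y \<in> F" "norm (K x - y) < e / 2"
        using F(2)[OF x(1)] by blast
      then show "z \<in> (\<Union>y\<in>F. cball y (e / 2))"
        using x(2) by (intro UN_I[of y]) (auto simp: dist_norm norm_minus_commute)
    qed
    then have "closure (K ` cball 0 1) \<subseteq> (\<Union>y\<in>F. cball y (e / 2))"
      using F(1) by (intro closure_minimal closed_UN) auto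
    also have "\<dots> \<subseteq> (\<Union>y\<in>F. ball y e)"
      using \<open>e > 0\<close> by (intro UN_mono subset_refl) (auto simp: subset_iff)
    finally show "\<exists>F. finite F \<and> closure (K ` cball 0 1) \<subseteq> (\<Union>y\<in>F. ball y e)"
      using F(1) by blast
  qed
  ultimately show ?thesis
    unfolding compact_op_def by blast
qed

lemma compact_op_bounded_op: "compact_op K \<Longrightarrow> bounded_op K"
  by (simp add: compact_op_def)

lemma compact_op_netE:
  fixes K :: "'a::complex_inner \<Rightarrow> 'b::chilbert_space"
  assumes "compact_op K" "e > 0"
  obtains F where "finite F" "\<And>x. norm x \<le> 1 \<Longrightarrow> \<exists>y\<in>F. norm (K x - y) < e"
  using assms unfolding compact_op_iff_totally_bounded by blast

lemma compact_op_netI: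
  fixes K :: "'a::complex_inner \<Rightarrow> 'b::chilbert_space"
  assumes "bounded_op K"
    "\<And>e. e > 0 \<Longrightarrow> \<exists>F. finite F \<and> (\<forall>x. norm x \<le> 1 \<longrightarrow> (\<exists>y\<in>F. norm (K x - y) < e))"
  shows "compact_op K"
  using assms unfolding compact_op_iff_totally_bounded by blast

lemma compact_op_plus:
  fixes K L :: "'a::complex_inner \<Rightarrow> 'b::chilbert_space"
  assumes K: "compact_op K" and L: "compact_op L"
  shows "compact_op (\<lambda>x. K x + L x)"
proof (rule compact_op_netI)
  show "bounded_op (\<lambda>x. K x + L x)"
    by (intro bounded_op_plus compact_op_bounded_op K L)
  fix e :: real assume "e > 0"
  then have e: "e / 2 > 0" by simp
  obtain F where F: "finite F" "\<And>x. norm x \<le> 1 \<Longrightarrow> \<exists>y\<in>F. norm (K x - y) < e / 2"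
    using compact_op_netE[OF K e] by blast
  obtain F' where F': "finite F'" "\<And>x. norm x \<le> 1 \<Longrightarrow> \<exists>y\<in>F'. norm (L x - y) < e / 2"
    using compact_op_netE[OF L e] by blast
  show "\<exists>F. finite F \<and> (\<forall>x. norm x \<le> 1 \<longrightarrow> (\<exists>y\<in>F. norm (K x + L x - y) < e))"
  proof (intro exI[of _ "(\<lambda>(y, z). y + z) ` (F \<times> F')"] conjI allI impI)
    show "finite ((\<lambda>(y, z). y + z) ` (F \<times> F'))"
      using F(1) F'(1) by blast
    fix x :: 'a assume x: "norm x \<le> 1"
    obtain y z where y: "y \<in> F" "norm (K x - y) < e / 2" and z: "z \<in> F'" "norm (L x - z) < e / 2"
      using F(2)[OF x] F'(2)[OF x] by blast
    have "norm (K x + L x - (y + z)) < e"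
      using norm_triangle_ineq[of "K x - y" "L x - z"] y z by (simp add: algebra_simps)
    with y(1) z(1) show "\<exists>w\<in>(\<lambda>(y, z). y + z) ` (F \<times> F'). norm (K x + L x - w) < e"
      by (intro bexI[of _ "y + z"]) force+
  qed
qed

lemma compact_op_compose_left:
  fixes K :: "'a::complex_inner \<Rightarrow> 'b::chilbert_space" and T :: "'b \<Rightarrow> 'c::chilbert_space"
  assumes T: "bounded_op T" and K: "compact_op K"
  shows "compact_op (\<lambda>x. T (K x))"
proof (rule compact_op_netI)
  show "bounded_op (\<lambda>x. T (K x))"
    by (rule bounded_op_compose[OF T compact_op_bounded_op[OF K]])
  fix e :: real assume "e > 0"
  obtain M where M: "M > 0" "\<And>x. norm (T x) \<le> M * norm x"
    using bounded_op_bound[OF T] by blast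
  have e: "e / M > 0" using \<open>e > 0\<close> M by simp
  obtain F where F: "finite F" "\<And>x. norm x \<le> 1 \<Longrightarrow> \<exists>y\<in>F. norm (K x - y) < e / M"
    using compact_op_netE[OF K e] by blast
  show "\<exists>F. finite F \<and> (\<forall>x. norm x \<le> 1 \<longrightarrow> (\<exists>y\<in>F. norm (T (K x) - y) < e))"
  proof (intro exI[of _ "T ` F"] conjI allI impI)
    fix x :: 'a assume x: "norm x \<le> 1"
    obtain y where y: "y \<in> F" "norm (K x - y) < e / M"
      using F(2)[OF x] by blast
    have "norm (T (K x) - T y) \<le> M * norm (K x - y)"
      using M(2)[of "K x - y"] by (simp add: bounded_op_diff[OF T])
    also have "\<dots> < e"
      using y(2) M(1) by (simp add: field_simps)
    finally show "\<exists>w\<in>T ` F. norm (T (K x) - w) < e"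
      using y(1) by blast
  qed (use F in simp)
qed

lemma compact_op_compose_right:
  fixes K :: "'b::complex_inner \<Rightarrow> 'c::chilbert_space" and T :: "'a::complex_inner \<Rightarrow> 'b"
  assumes K: "compact_op K" and T: "bounded_op T"
  shows "compact_op (\<lambda>x. K (T x))"
proof (rule compact_op_netI)
  have bK: "bounded_op K" by (rule compact_op_bounded_op[OF K])
  show "bounded_op (\<lambda>x. K (T x))"
    by (rule bounded_op_compose[OF bK T])
  fix e :: real assume "e > 0"
  obtain M where M: "M > 0" "\<And>x. norm (T x) \<le> M * norm x"
    using bounded_op_bound[OF T] by blast
  have e: "e / M > 0" using \<open>e > 0\<close> M by simp
  obtain F where F: "finite F" "\<And>x. norm x \<le> 1 \<Longrightarrow> \<exists>y\<in>F. norm (K x - y) < e / M"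
    using compact_op_netE[OF K e] by blast
  show "\<exists>F. finite F \<and> (\<forall>x. norm x \<le> 1 \<longrightarrow> (\<exists>y\<in>F. norm (K (T x) - y) < e))"
  proof (intro exI[of _ "(\<lambda>y. M *\<^sub>R y) ` F"] conjI allI impI)
    fix x :: 'a assume x: "norm x \<le> 1"
    have "norm (T x) \<le> M"
      using M(2)[of x] x M(1) mult_left_mono[of "norm x" 1 M] by linarith
    then have "norm (inverse M *\<^sub>R T x) \<le> 1"
      using M(1) by (simp add: field_simps)
    then obtain y where y: "y \<in> F" "norm (K (inverse M *\<^sub>R T x) - y) < e / M"
      using F(2) by blast
    have "K (T x) - M *\<^sub>R y = M *\<^sub>R (K (inverse M *\<^sub>R T x) - y)"
      using M(1) by (simp add: bounded_op_scaleR[OF bK] scaleR_diff_right)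
    then have "norm (K (T x) - M *\<^sub>R y) = M * norm (K (inverse M *\<^sub>R T x) - y)"
      using M(1) by simp
    then have "norm (K (T x) - M *\<^sub>R y) < e"
      using y(2) M(1) by (simp only: pos_less_divide_eq mult.commute)
    then show "\<exists>w\<in>(\<lambda>y. M *\<^sub>R y) ` F. norm (K (T x) - w) < e"
      using y(1) by blast
  qed (use F in simp)
qed

lemma compact_op_uminus:
  fixes K :: "'a::complex_inner \<Rightarrow> 'b::chilbert_space"
  assumes "compact_op K"
  shows "compact_op (\<lambda>x. - K x)"
  using compact_op_compose_left[OF bounded_op_scale[OF bounded_op_id, of "-1"] assms]
  by (simp add: scaleC_minus_one)

lemma compact_op_limit:
  fixes K :: "'a::complex_inner \<Rightarrow> 'b::chilbert_space"
  assumes K: "bounded_op K"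
    and app: "\<And>e. e > 0 \<Longrightarrow> \<exists>L. compact_op L \<and> (\<forall>x. norm (K x - L x) \<le> e * norm x)"
  shows "compact_op K"
proof (rule compact_op_netI[OF K])
  fix e :: real assume "e > 0"
  then have e: "e / 2 > 0" by simp
  obtain L where L: "compact_op L" "\<And>x. norm (K x - L x) \<le> e / 2 * norm x"
    using app[OF e] by blast
  obtain F where F: "finite F" "\<And>x. norm x \<le> 1 \<Longrightarrow> \<exists>y\<in>F. norm (L x - y) < e / 2"
    using compact_op_netE[OF L(1) e] by blast
  have "\<exists>y\<in>F. norm (K x - y) < e" if x: "norm x \<le> 1" for x
  proof -
    obtain y where y: "y \<in> F" "norm (L x - y) < e / 2"
      using F(2)[OF x] by blast
    have "norm (K x - L x) \<le> e / 2"
      using L(2)[of x] mult_left_mono[OF x, of "e / 2"] \<open>e > 0\<close> by linarith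
    then have "norm (K x - y) < e"
      using norm_triangle_ineq[of "K x - L x" "L x - y"] y(2) by simp
    with y(1) show ?thesis by blast
  qed
  with F(1) show "\<exists>F. finite F \<and> (\<forall>x. norm x \<le> 1 \<longrightarrow> (\<exists>y\<in>F. norm (K x - y) < e))"
    by blast
qed

lemma compact_op_rank_one:
  fixes u :: "'a::complex_inner" and v :: "'b::chilbert_space"
  shows "compact_op (\<lambda>x. cinner x u *\<^sub>C v)"
proof (rule compact_op_netI)
  show "bounded_op (\<lambda>x. cinner x u *\<^sub>C v)"
  proof (rule bounded_opI)
    show "norm (cinner x u *\<^sub>C v) \<le> (norm u * norm v) * norm x" for x
      using mult_right_mono[OF cmod_cinner_le[of x u], of "norm v"]
      by (simp add: norm_scaleC ac_simps)
  qed (simp_all add: cinner_add_left scaleC_add_left cinner_scaleC_left scaleC_scaleC)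
  fix e :: real assume "e > 0"
  define d where "d = e / (norm v + 1)"
  have d: "d > 0" using \<open>e > 0\<close> by (simp add: d_def add_nonneg_pos)
  have "compact (cball (0::complex) (norm u))" by simp
  then obtain F where F: "finite F" "cball (0::complex) (norm u) \<subseteq> (\<Union>y\<in>F. ball y d)"
    unfolding compact_eq_totally_bounded using d by blast
  show "\<exists>F. finite F \<and> (\<forall>x. norm x \<le> 1 \<longrightarrow> (\<exists>y\<in>F. norm (cinner x u *\<^sub>C v - y) < e))"
  proof (intro exI[of _ "(\<lambda>y. y *\<^sub>C v) ` F"] conjI allI impI)
    fix x :: 'a assume x: "norm x \<le> 1"
    have "cmod (cinner x u) \<le> norm u"
      using cmod_cinner_le[of x u] mult_right_mono[OF x, of "norm u"] by simp
    then have "cinner x u \<in> (\<Union>y\<in>F. ball y d)"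
      by (intro subsetD[OF F(2)]) simp
    then obtain y where y: "y \<in> F" "norm (cinner x u - y) < d"
      by (auto simp: dist_norm norm_minus_commute)
    have "cinner x u *\<^sub>C v - y *\<^sub>C v = (cinner x u - y) *\<^sub>C v"
      by (simp add: complex_vector.scale_left_diff_distrib)
    then have "norm (cinner x u *\<^sub>C v - y *\<^sub>C v) = norm (cinner x u - y) * norm v"
      by (simp add: norm_scaleC)
    also have "\<dots> \<le> d * norm v"
      using y(2) by (intro mult_right_mono) auto
    also have "\<dots> < d * (norm v + 1)"
      using d by simp
    also have "\<dots> = e"
      by (simp add: d_def add_nonneg_eq_0_iff)
    finally show "\<exists>w\<in>(\<lambda>y. y *\<^sub>C v) ` F. norm (cinner x u *\<^sub>C v - w) < e"
      using y(1) by blast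
  qed (use F in simp)
qed

lemma compact_op_zero: "compact_op (\<lambda>x::'a::complex_inner. 0::'b::chilbert_space)"
  using compact_op_rank_one[of "0::'a" "0::'b"] by simp

lemma compact_op_sum:
  fixes K :: "'i \<Rightarrow> 'a::complex_inner \<Rightarrow> 'b::chilbert_space"
  assumes "\<And>i. i \<in> F \<Longrightarrow> compact_op (K i)"
  shows "compact_op (\<lambda>x. \<Sum>i\<in>F. K i x)"
  using assms
  by (induction F rule: infinite_finite_induct) (auto intro: compact_op_zero compact_op_plus)


section \<open>Tails in the sequence space\<close>

lemma coord_add [simp]: "coord (a + b) n = coord a n + coord b n"
  by (simp add: plus_ell2.rep_eq)

lemma coord_diff [simp]: "coord (a - b) n = coord a n - coord b n"
  by (simp add: minus_ell2.rep_eq)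

lemma coord_zero [simp]: "coord 0 n = 0"
  by (simp add: zero_ell2.rep_eq)

lemma coord_scaleC [simp]: "coord (c *\<^sub>C a) n = c * coord a n"
  by (simp add: scaleC_ell2.rep_eq)

lemma coord_basis: "coord (ell2_basis k) n = (if n = k then 1 else 0)"
  by (simp add: ell2_basis.rep_eq)

lemma coord_sum: "coord (\<Sum>i\<in>F. f i) n = (\<Sum>i\<in>F. coord (f i) n)"
  by (induction F rule: infinite_finite_induct) auto

lemma sums_norm_ell2: "(\<lambda>n. (cmod (coord a n))\<^sup>2) sums (norm a)\<^sup>2"
proof -
  have "(norm a)\<^sup>2 = (\<Sum>n. (cmod (coord a n))\<^sup>2)"
    unfolding norm_ell2_def
    by (intro real_sqrt_pow2 suminf_nonneg summable_coord) simp
  then show ?thesis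
    using summable_sums[OF summable_coord[of a]] by simp
qed

lemma sum_coord_le_norm: "finite F \<Longrightarrow> (\<Sum>n\<in>F. (cmod (coord a n))\<^sup>2) \<le> (norm a)\<^sup>2"
  using sum_le_suminf[OF summable_coord[of a], of F] sums_unique[OF sums_norm_ell2[of a]] by simp

lemma cinner_basis: "cinner a (ell2_basis n) = coord a n"
proof -
  have "cinner a (ell2_basis n) = (\<Sum>k\<in>{n}. coord a k * cnj (coord (ell2_basis n) k))"
    unfolding cinner_ell2_def by (rule suminf_finite) (auto simp: coord_basis)
  then show ?thesis by (simp add: coord_basis)
qed

lemma cinner_basis_basis: "cinner (ell2_basis l) (ell2_basis n) = (if l = n then 1 else 0)"
  unfolding cinner_basis coord_basis by auto

lemma norm_basis [simp]: "norm (ell2_basis n) = 1"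
proof -
  have "complex_of_real ((norm (ell2_basis n))\<^sup>2) = of_real 1"
    unfolding cinner_self[symmetric] cinner_basis_basis by simp
  then have "(norm (ell2_basis n))\<^sup>2 = 1"
    by (simp only: of_real_eq_iff)
  then show ?thesis
    using power2_eq_imp_eq[of "norm (ell2_basis n)" 1] by simp
qed

text \<open>\<open>head N a\<close> is the restriction of \<open>a\<close> to the indices below \<open>N\<close>, and \<open>tail N a\<close> is the remainder.\<close>

definition head :: "nat \<Rightarrow> ell2 \<Rightarrow> ell2" where
  "head N a = (\<Sum>k<N. coord a k *\<^sub>C ell2_basis k)"

definition tail :: "nat \<Rightarrow> ell2 \<Rightarrow> ell2" where
  "tail N a = a - head N a"

text \<open>The sequences supported on \<open>{N..}\<close>, that is, the closed span of the basis vectors with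
  index at least \<open>N\<close>.\<close>

definition tail_space :: "nat \<Rightarrow> ell2 set" where
  "tail_space N = {a. \<forall>n<N. coord a n = 0}"

lemma coord_head: "coord (head N a) n = (if n < N then coord a n else 0)"
proof -
  have "coord (head N a) n = (\<Sum>k<N. if k = n then coord a k else 0)"
    unfolding head_def coord_sum by (intro sum.cong) (auto simp: coord_basis)
  then show ?thesis by (simp add: sum.delta)
qed

lemma coord_tail: "coord (tail N a) n = (if n < N then 0 else coord a n)"
  by (simp add: tail_def coord_head)

lemma tail_in_tail_space: "tail N a \<in> tail_space N"
  by (simp add: tail_space_def coord_tail)

lemma tail_eq_self: "a \<in> tail_space N \<Longrightarrow> tail N a = a"
  by (intro ell2_eqI) (simp add: tail_space_def coord_tail)

lemma basis_in_tail_space: "n \<ge> N \<Longrightarrow> ell2_basis n \<in> tail_space N"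
  by (auto simp: tail_space_def coord_basis)

lemma tail_space_mono: "N \<le> M \<Longrightarrow> tail_space M \<subseteq> tail_space N"
  by (auto simp: tail_space_def)

lemma norm_tail_sq: "(norm (tail N a))\<^sup>2 = (norm a)\<^sup>2 - (\<Sum>k<N. (cmod (coord a k))\<^sup>2)"
proof -
  have "(\<lambda>n. (cmod (coord a n))\<^sup>2 - (if n \<in> {..<N} then (cmod (coord a n))\<^sup>2 else 0))
      sums ((norm a)\<^sup>2 - (\<Sum>k\<in>{..<N}. (cmod (coord a k))\<^sup>2))"
    by (intro sums_diff sums_norm_ell2 sums_If_finite_set) simp
  moreover have "(\<lambda>n. (cmod (coord a n))\<^sup>2 - (if n \<in> {..<N} then (cmod (coord a n))\<^sup>2 else 0))
      = (\<lambda>n. (cmod (coord (tail N a) n))\<^sup>2)"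
    by (auto simp: coord_tail)
  ultimately have "(\<lambda>n. (cmod (coord (tail N a) n))\<^sup>2)
      sums ((norm a)\<^sup>2 - (\<Sum>k<N. (cmod (coord a k))\<^sup>2))"
    by simp
  then show ?thesis
    using sums_unique2[OF sums_norm_ell2] by blast
qed

lemma norm_tail_le: "norm (tail N a) \<le> norm a"
  by (rule power2_le_imp_le) (simp_all add: norm_tail_sq sum_nonneg)

lemma tail_tendsto_zero: "(\<lambda>N. norm (tail N a)) \<longlonglongrightarrow> 0"
proof -
  have "(\<lambda>N. \<Sum>k<N. (cmod (coord a k))\<^sup>2) \<longlonglongrightarrow> (norm a)\<^sup>2"
    using sums_norm_ell2[of a] unfolding sums_def .
  then have "(\<lambda>N. (norm a)\<^sup>2 - (\<Sum>k<N. (cmod (coord a k))\<^sup>2)) \<longlonglongrightarrow> (norm a)\<^sup>2 - (norm a)\<^sup>2"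
    by (intro tendsto_diff tendsto_const)
  then have "(\<lambda>N. sqrt ((norm (tail N a))\<^sup>2)) \<longlonglongrightarrow> sqrt 0"
    unfolding norm_tail_sq by (intro tendsto_real_sqrt) simp
  then show ?thesis by simp
qed

lemma head_tendsto: "(\<lambda>N. head N a) \<longlonglongrightarrow> a"
proof -
  have "(\<lambda>N. norm (head N a - a)) \<longlonglongrightarrow> 0"
    using tail_tendsto_zero[of a] by (simp add: tail_def norm_minus_commute)
  then show ?thesis
    by (metis tendsto_norm_zero_iff LIM_zero_iff)
qed

lemma bounded_op_tail: "bounded_op (tail N)"
proof (rule bounded_opI)
  show "tail N (a + b) = tail N a + tail N b" for a b
    by (rule ell2_eqI) (simp add: coord_tail)
  show "tail N (c *\<^sub>C a) = c *\<^sub>C tail N a" for c a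
    by (rule ell2_eqI) (simp add: coord_tail)
  show "norm (tail N a) \<le> 1 * norm a" for a
    using norm_tail_le by simp
qed

lemma cinner_tail: "cinner (tail N a) b = cinner a (tail N b)"
  unfolding cinner_ell2_def by (intro arg_cong[where f = suminf]) (auto simp: coord_tail)

lemma inner_tail: "inner (tail N a) b = inner a (tail N b)"
  by (simp add: inner_eq_Re_cinner cinner_tail)

lemma compact_op_head: "compact_op (head N)"
proof -
  have "compact_op (\<lambda>a. \<Sum>k<N. cinner a (ell2_basis k) *\<^sub>C ell2_basis k)"
    by (intro compact_op_sum compact_op_rank_one)
  moreover have "(\<lambda>a. \<Sum>k<N. cinner a (ell2_basis k) *\<^sub>C ell2_basis k) = head N"
    by (simp add: fun_eq_iff head_def cinner_basis)
  ultimately show ?thesis by simp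
qed


section \<open>The adjoint of an operator on the sequence space\<close>

text \<open>On \<open>ell2\<close> the adjoint is explicit: it maps \<open>f\<close> to the sequence of its inner products with the
  images of the basis vectors, which is square-summable when \<open>A\<close> is bounded.\<close>

definition adj :: "(ell2 \<Rightarrow> 'a::complex_inner) \<Rightarrow> 'a \<Rightarrow> ell2" where
  "adj A f = Abs_ell2 (\<lambda>n. cinner f (A (ell2_basis n)))"

lemma op_head:
  assumes "bounded_op A"
  shows "A (head N a) = (\<Sum>k<N. coord a k *\<^sub>C A (ell2_basis k))"
  by (simp add: head_def bounded_op_sum[OF assms] bounded_op_scaleC[OF assms])

text \<open>Testing \<open>f\<close> against \<open>A v\<close>, where \<open>v\<close> has the first \<open>m\<close> inner products of \<open>f\<close> as coordinates, gives
  \<open>\<parallel>v\<parallel>\<^sup>2 \<le> M \<parallel>f\<parallel> \<parallel>v\<parallel>\<close>.\<close>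

lemma bessel_partial_sum:
  assumes A: "bounded_op A" and M: "M \<ge> 0" "\<And>a. norm (A a) \<le> M * norm (a :: ell2)"
  shows "(\<Sum>n<m. (cmod (cinner f (A (ell2_basis n))))\<^sup>2) \<le> M\<^sup>2 * (norm f)\<^sup>2"
proof -
  define s where "s = (\<Sum>n<m. (cmod (cinner f (A (ell2_basis n))))\<^sup>2)"
  define v where "v = (\<Sum>n<m. cinner f (A (ell2_basis n)) *\<^sub>C ell2_basis n)"
  have coord_v: "coord v n = (if n < m then cinner f (A (ell2_basis n)) else 0)" for n
  proof -
    have "coord v n = (\<Sum>k<m. if k = n then cinner f (A (ell2_basis k)) else 0)"
      unfolding v_def coord_sum by (intro sum.cong) (auto simp: coord_basis)
    then show ?thesis by (simp add: sum.delta)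
  qed
  have head_v: "head m v = v"
    by (rule ell2_eqI) (simp add: coord_head coord_v)
  have s0: "s \<ge> 0"
    unfolding s_def by (intro sum_nonneg) simp
  have "tail m v = 0"
    by (simp add: tail_def head_v)
  then have "(norm v)\<^sup>2 = (\<Sum>k<m. (cmod (coord v k))\<^sup>2)"
    using norm_tail_sq[of m v] by simp
  also have "\<dots> = s"
    unfolding s_def by (intro sum.cong) (auto simp: coord_v)
  finally have nv: "(norm v)\<^sup>2 = s" .
  have "A v = (\<Sum>k<m. coord v k *\<^sub>C A (ell2_basis k))"
    using op_head[OF A, of m v] by (simp only: head_v)
  then have "cinner f (A v) = (\<Sum>k<m. cnj (coord v k) * cinner f (A (ell2_basis k)))"
    by (simp add: cinner_sum_right cinner_scaleC_right)
  also have "\<dots> = (\<Sum>k<m. of_real ((cmod (cinner f (A (ell2_basis k))))\<^sup>2))"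
    unfolding complex_norm_square by (intro sum.cong) (auto simp: coord_v mult.commute)
  also have "\<dots> = of_real s"
    by (simp add: s_def)
  finally have "cinner f (A v) = of_real s" .
  then have "s = cmod (cinner f (A v))"
    using s0 by simp
  also have "\<dots> \<le> norm f * norm (A v)"
    by (rule cmod_cinner_le)
  also have "\<dots> \<le> norm f * (M * norm v)"
    by (intro mult_left_mono M) simp
  finally have "(norm v)\<^sup>2 \<le> (M * norm f) * norm v"
    by (simp add: nv ac_simps)
  then have "norm v \<le> M * norm f"
    by (rule norm_cancel) (use M in simp)
  then have "(norm v)\<^sup>2 \<le> (M * norm f)\<^sup>2"
    by (rule power_mono) simp
  then show ?thesis
    by (simp add: nv power_mult_distrib s_def)
qed

lemma coord_adj:
  assumes A: "bounded_op A"
  shows "coord (adj A f) n = cinner f (A (ell2_basis n))"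
proof -
  obtain M where M: "M > 0" "\<And>a. norm (A a) \<le> M * norm a"
    using bounded_op_bound[OF A] by blast
  have "summable (\<lambda>n. (cmod (cinner f (A (ell2_basis n))))\<^sup>2)"
  proof (rule summableI_nonneg_bounded)
    show "(\<Sum>n<m. (cmod (cinner f (A (ell2_basis n))))\<^sup>2) \<le> M\<^sup>2 * (norm f)\<^sup>2" for m
      by (rule bessel_partial_sum[OF A _ M(2)]) (use M in simp)
  qed simp
  then show ?thesis
    by (simp add: adj_def Abs_ell2_inverse)
qed

lemma cinner_adj:
  assumes A: "bounded_op A"
  shows "cinner f (A a) = cinner (adj A f) a"
proof -
  have "cinner f (A (head m a)) = cinner (adj A f) (head m a)" for m
    unfolding op_head[OF A] unfolding head_def
    by (simp add: cinner_sum_right cinner_scaleC_right cinner_basis coord_adj[OF A])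
  moreover have "(\<lambda>m. cinner f (A (head m a))) \<longlonglongrightarrow> cinner f (A a)"
    by (intro bounded_linear.tendsto[OF bounded_linear_cinner_right] bounded_op_tendsto[OF A]
        head_tendsto)
  moreover have "(\<lambda>m. cinner (adj A f) (head m a)) \<longlonglongrightarrow> cinner (adj A f) a"
    by (intro bounded_linear.tendsto[OF bounded_linear_cinner_right] head_tendsto)
  ultimately show ?thesis
    using LIMSEQ_unique by force
qed

lemma inner_adj: "bounded_op A \<Longrightarrow> inner f (A a) = inner (adj A f) a"
  by (simp add: inner_eq_Re_cinner cinner_adj)

lemma inner_adj': "bounded_op A \<Longrightarrow> inner (A a) f = inner a (adj A f)"
  using inner_adj[of A f a] by (simp add: inner_commute)

lemma bounded_op_adj:
  assumes A: "bounded_op A"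
  shows "bounded_op (adj A)"
proof -
  obtain M where M: "M > 0" "\<And>a. norm (A a) \<le> M * norm a"
    using bounded_op_bound[OF A] by blast
  show ?thesis
  proof (rule bounded_opI)
    show "adj A (f + g) = adj A f + adj A g" for f g
      by (rule ell2_eqI) (simp add: coord_adj[OF A] cinner_add_left)
    show "adj A (c *\<^sub>C f) = c *\<^sub>C adj A f" for c f
      by (rule ell2_eqI) (simp add: coord_adj[OF A] cinner_scaleC_left)
    show "norm (adj A f) \<le> M * norm f" for f
    proof (rule norm_cancel)
      have "(norm (adj A f))\<^sup>2 = inner f (A (adj A f))"
        by (simp add: inner_adj[OF A] power2_norm_eq_inner)
      also have "\<dots> \<le> norm f * norm (A (adj A f))"
        by (rule norm_cauchy_schwarz)
      also have "\<dots> \<le> norm f * (M * norm (adj A f))"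
        by (intro mult_left_mono M) simp
      finally show "(norm (adj A f))\<^sup>2 \<le> M * norm f * norm (adj A f)"
        by (simp add: ac_simps)
    qed (use M in simp)
  qed
qed

lemma bounded_op_gram: "bounded_op A \<Longrightarrow> bounded_op (\<lambda>a. adj A (A a))"
  by (rule bounded_op_compose[OF bounded_op_adj])

lemma inner_gram_self: "bounded_op A \<Longrightarrow> inner (adj A (A a)) a = (norm (A a))\<^sup>2"
  by (simp add: inner_adj[symmetric] power2_norm_eq_inner)

lemma gram_symmetric: "bounded_op A \<Longrightarrow> inner (adj A (A a)) b = inner a (adj A (A b))"
  by (simp add: inner_adj[symmetric] inner_adj'[symmetric])

lemma gram_coercive:
  assumes A: "bounded_op A" and c: "c > 0" "norm a \<le> c * norm (A a)"
  shows "inner (adj A (A a)) a \<ge> inverse (c\<^sup>2) * (norm a)\<^sup>2"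
proof -
  have "(norm a)\<^sup>2 \<le> (c * norm (A a))\<^sup>2"
    by (intro power_mono c) simp
  then show ?thesis
    using c(1) by (simp add: inner_gram_self[OF A] field_simps)
qed

text \<open>If \<open>G = adj A \<circ> A\<close> is invertible, then \<open>A \<circ> G\<inverse> \<circ> adj A\<close> is the projection onto the range
  of \<open>A\<close>, which is everything when no nonzero vector is orthogonal to that range.\<close>

lemma invertible_op_if_bounded_below:
  fixes A :: "ell2 \<Rightarrow> 'a::complex_inner"
  assumes A: "bounded_op A" and c: "c > 0" "\<And>a. norm a \<le> c * norm (A a)"
    and dense: "\<And>f. (\<And>n. cinner f (A (ell2_basis n)) = 0) \<Longrightarrow> f = 0"
  shows "invertible_op A"
proof (rule invertible_opI[OF A _ c(2)])
  have "invertible_op (\<lambda>a. adj A (A a))"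
  proof (rule coercive_invertible[OF bounded_op_gram[OF A]])
    show "inverse (c\<^sup>2) > 0" using c by simp
    show "inverse (c\<^sup>2) * (norm a)\<^sup>2 \<le> inner (adj A (A a)) a" for a
      by (rule gram_coercive[OF A c])
  qed
  then obtain H where H: "\<And>y. adj A (A (H y)) = y"
    using invertible_opE by blast
  show "surj A"
    unfolding surj_def
  proof
    fix f
    have "f - A (H (adj A f)) = 0"
    proof (rule dense)
      fix n
      have "adj A (f - A (H (adj A f))) = 0"
        by (simp add: bounded_op_diff[OF bounded_op_adj[OF A]] H)
      then show "cinner (f - A (H (adj A f))) (A (ell2_basis n)) = 0"
        using coord_adj[OF A, of "f - A (H (adj A f))" n] by simp
    qed
    then show "\<exists>a. f = A a" by auto
  qed
qed

text \<open>An upper bound for finite linear combinations suffices for \<open>a \<mapsto> \<Sum>n. coord a n *\<^sub>C x n\<close> to be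
  defined on all of \<open>ell2\<close> and bounded.\<close>

lemma synthesis_op_exists:
  fixes x :: "nat \<Rightarrow> 'a::chilbert_space"
  assumes C: "C \<ge> 0" and bd: "\<And>F a. finite F \<Longrightarrow>
    (norm (\<Sum>n\<in>F. a n *\<^sub>C x n))\<^sup>2 \<le> C * (\<Sum>n\<in>F. (cmod (a n))\<^sup>2)"
  shows "\<exists>A. bounded_op A \<and> (\<forall>n. A (ell2_basis n) = x n)"
proof -
  have sm: "summable (\<lambda>n. coord a n *\<^sub>C x n)" for a
    unfolding summable_Cauchy
  proof (intro allI impI)
    fix e :: real assume "e > 0"
    then have e: "e\<^sup>2 / (C + 1) > 0"
      using C by simp
    obtain N where N: "\<And>m n. m \<ge> N \<Longrightarrow> norm (\<Sum>k\<in>{m..<n}. (cmod (coord a k))\<^sup>2) < e\<^sup>2 / (C + 1)"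
      using summable_coord[of a, unfolded summable_Cauchy, rule_format, OF e] by blast
    have "norm (\<Sum>k\<in>{m..<n}. coord a k *\<^sub>C x k) < e" if "m \<ge> N" for m n
    proof (rule power_less_imp_less_base)
      define s where "s = (\<Sum>k\<in>{m..<n}. (cmod (coord a k))\<^sup>2)"
      have s: "s \<ge> 0" "s < e\<^sup>2 / (C + 1)"
        using N[OF that, of n] by (simp_all add: s_def sum_nonneg)
      have "(norm (\<Sum>k\<in>{m..<n}. coord a k *\<^sub>C x k))\<^sup>2 \<le> C * s"
        unfolding s_def by (rule bd) simp
      also have "\<dots> \<le> (C + 1) * s"
        using s by (intro mult_right_mono) auto
      also have "\<dots> < e\<^sup>2"
        using s(2) C by (simp add: field_simps)
      finally show "(norm (\<Sum>k\<in>{m..<n}. coord a k *\<^sub>C x k))\<^sup>2 < e\<^sup>2" .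
    qed (use \<open>e > 0\<close> in simp)
    then show "\<exists>N. \<forall>m\<ge>N. \<forall>n. norm (\<Sum>k\<in>{m..<n}. coord a k *\<^sub>C x k) < e"
      by blast
  qed
  define A where "A a = (\<Sum>n. coord a n *\<^sub>C x n)" for a
  have "bounded_op A"
  proof (rule bounded_opI)
    show "A (a + b) = A a + A b" for a b
      unfolding A_def using suminf_add[OF sm[of a] sm[of b]] by (simp add: scaleC_add_left)
    show "A (c *\<^sub>C a) = c *\<^sub>C A a" for c a
      unfolding A_def using bounded_linear.suminf[OF bounded_linear_scaleC sm[of a], of c]
      by (simp add: scaleC_scaleC)
    show "norm (A a) \<le> sqrt C * norm a" for a
    proof (rule LIMSEQ_le_const2)
      show "(\<lambda>m. norm (\<Sum>n<m. coord a n *\<^sub>C x n)) \<longlonglongrightarrow> norm (A a)"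
        unfolding A_def using summable_LIMSEQ[OF sm] by (rule tendsto_norm)
      have "norm (\<Sum>n<m. coord a n *\<^sub>C x n) \<le> sqrt C * norm a" for m
      proof (rule power2_le_imp_le)
        have "(norm (\<Sum>n<m. coord a n *\<^sub>C x n))\<^sup>2 \<le> C * (\<Sum>n<m. (cmod (coord a n))\<^sup>2)"
          by (rule bd) simp
        also have "\<dots> \<le> C * (norm a)\<^sup>2"
          by (intro mult_left_mono sum_coord_le_norm C) simp
        finally show "(norm (\<Sum>n<m. coord a n *\<^sub>C x n))\<^sup>2 \<le> (sqrt C * norm a)\<^sup>2"
          using C by (simp add: power_mult_distrib)
      qed (use C in simp)
      then show "\<exists>N. \<forall>m\<ge>N. norm (\<Sum>n<m. coord a n *\<^sub>C x n) \<le> sqrt C * norm a"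
        by blast
    qed
  qed
  moreover have "A (ell2_basis n) = x n" for n
  proof -
    have "A (ell2_basis n) = (\<Sum>k\<in>{n}. coord (ell2_basis n) k *\<^sub>C x k)"
      unfolding A_def by (rule suminf_finite) (auto simp: coord_basis)
    then show ?thesis by (simp add: coord_basis)
  qed
  ultimately show ?thesis by blast
qed


section \<open>Asymptotic isometries and compact perturbations\<close>

text \<open>Unit vectors supported further and further out converge weakly to zero, so a compact operator
  maps them to small vectors.\<close>

lemma compact_op_small_on_tails:
  fixes K :: "ell2 \<Rightarrow> 'a::chilbert_space"
  assumes K: "compact_op K" and "e > 0"
  shows "\<exists>N. \<forall>a\<in>tail_space N. norm (K a) \<le> e * norm a"
proof -
  have bK: "bounded_op K" by (rule compact_op_bounded_op[OF K])
  define d where "d = e / 2"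
  have d: "d > 0" "e = 2 * d" using \<open>e > 0\<close> by (simp_all add: d_def)
  obtain F where F: "finite F" "\<And>a. norm a \<le> 1 \<Longrightarrow> \<exists>y\<in>F. norm (K a - y) < d"
    using compact_op_netE[OF K d(1)] by blast
  have "\<forall>y\<in>F. \<forall>\<^sub>F N in sequentially. norm (tail N (adj K y)) < d\<^sup>2"
    using d by (intro ballI order_tendstoD(2)[OF tail_tendsto_zero]) simp
  then have "\<forall>\<^sub>F N in sequentially. \<forall>y\<in>F. norm (tail N (adj K y)) < d\<^sup>2"
    by (rule eventually_ball_finite[OF F(1)])
  then obtain N where N: "\<And>y. y \<in> F \<Longrightarrow> norm (tail N (adj K y)) < d\<^sup>2"
    unfolding eventually_sequentially by blast
  have unit: "norm (K a) \<le> 2 * d" if a: "a \<in> tail_space N" "norm a \<le> 1" for a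
  proof -
    obtain y where y: "y \<in> F" "norm (K a - y) < d"
      using F(2)[OF a(2)] by blast
    have "inner (K a) y = inner a (tail N (adj K y))"
      using inner_tail[of N a "adj K y"] tail_eq_self[OF a(1)] by (simp add: inner_adj'[OF bK])
    also have "\<dots> \<le> norm a * norm (tail N (adj K y))"
      by (rule norm_cauchy_schwarz)
    also have "\<dots> \<le> 1 * d\<^sup>2"
      using a(2) less_imp_le[OF N[OF y(1)]] by (intro mult_mono) auto
    finally have 1: "inner (K a) y \<le> d\<^sup>2" by simp
    have "inner (K a) (K a - y) \<le> norm (K a) * norm (K a - y)"
      by (rule norm_cauchy_schwarz)
    also have "\<dots> \<le> norm (K a) * d"
      using y(2) by (intro mult_left_mono) auto
    finally have 2: "(norm (K a))\<^sup>2 \<le> norm (K a) * d + d\<^sup>2"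
      using 1 by (simp add: inner_diff_right power2_norm_eq_inner)
    show ?thesis
    proof (rule ccontr)
      assume "\<not> ?thesis"
      then have "(norm (K a) - 2 * d) * (norm (K a) + d) > 0"
        using d(1) by (intro mult_pos_pos) auto
      then show False
        using 2 mult_pos_pos[OF d(1) d(1)] by (simp add: algebra_simps power2_eq_square)
    qed
  qed
  have "norm (K a) \<le> e * norm a" if a: "a \<in> tail_space N" for a
  proof (cases "a = 0")
    case False
    define b where "b = complex_of_real (inverse (norm a)) *\<^sub>C a"
    have "b \<in> tail_space N"
      using a by (simp add: b_def tail_space_def)
    moreover have "norm b \<le> 1"
      using False by (simp add: b_def norm_scaleC norm_inverse)
    ultimately have "norm (K b) \<le> e"
      using unit d(2) by simp
    moreover have "norm (K b) = inverse (norm a) * norm (K a)"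
      by (simp add: b_def bounded_op_scaleC[OF bK] norm_scaleC norm_inverse)
    ultimately show ?thesis
      using False by (simp add: field_simps)
  qed (simp add: bounded_op_zero[OF bK])
  then show ?thesis by blast
qed

text \<open>The operator is nearly isometric on sequences supported far out. For the synthesis operator
  of a sequence this is the asymptotic part of being an asymptotically orthonormal basic sequence,
  with the upper constants \<open>C\<^sub>N\<close> and the inverse lower constants \<open>1 / c\<^sub>N\<close> both tending to 1.\<close>

definition asymp_isometric :: "(ell2 \<Rightarrow> 'a::complex_inner) \<Rightarrow> bool" where
  "asymp_isometric A \<longleftrightarrow> (\<forall>e>0. \<exists>N. \<forall>a\<in>tail_space N.
     (norm (A a))\<^sup>2 \<le> (1 + e) * (norm a)\<^sup>2 \<and> (norm a)\<^sup>2 \<le> (1 + e) * (norm (A a))\<^sup>2)"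

lemma asymp_isometric_isometry_plus_compact:
  fixes W K :: "ell2 \<Rightarrow> 'a::chilbert_space"
  assumes W: "\<And>a. norm (W a) = norm a" and K: "compact_op K"
  shows "asymp_isometric (\<lambda>a. W a + K a)"
  unfolding asymp_isometric_def
proof (intro allI impI)
  fix e :: real assume "e > 0"
  \<comment> \<open>Small enough for \<open>(1 + d)\<^sup>2 \<le> 1 + e\<close> and \<open>1 \<le> (1 + e) (1 - d)\<^sup>2\<close>.\<close>
  define d where "d = e / (4 * (1 + e))"
  have d: "d > 0" "4 * d * (1 + e) = e" "4 * d < 1" "4 * d < e"
    using \<open>e > 0\<close> by (auto simp: d_def field_simps)
  obtain N where N: "\<And>a. a \<in> tail_space N \<Longrightarrow> norm (K a) \<le> d * norm a"
    using compact_op_small_on_tails[OF K d(1)] by blast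
  have "(norm (W a + K a))\<^sup>2 \<le> (1 + e) * (norm a)\<^sup>2 \<and> (norm a)\<^sup>2 \<le> (1 + e) * (norm (W a + K a))\<^sup>2"
    if a: "a \<in> tail_space N" for a
  proof
    have "norm (W a + K a) \<le> (1 + d) * norm a"
      using norm_triangle_ineq[of "W a" "K a"] N[OF a] by (simp add: W algebra_simps)
    then have "(norm (W a + K a))\<^sup>2 \<le> ((1 + d) * norm a)\<^sup>2"
      by (rule power_mono) simp
    also have "\<dots> \<le> (1 + e) * (norm a)\<^sup>2"
    proof -
      have "(1 + d)\<^sup>2 = 1 + 2 * d + d * d"
        by (simp add: power2_eq_square algebra_simps)
      moreover have "d * d \<le> 1 * d"
        using d by (intro mult_right_mono) auto
      ultimately have "(1 + d)\<^sup>2 \<le> 1 + e"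
        using d by linarith
      then show ?thesis
        by (simp add: power_mult_distrib mult_right_mono)
    qed
    finally show "(norm (W a + K a))\<^sup>2 \<le> (1 + e) * (norm a)\<^sup>2" .
    have "(1 - d) * norm a \<le> norm (W a + K a)"
      using norm_diff_ineq[of "W a" "K a"] N[OF a] by (simp add: W algebra_simps)
    then have "((1 - d) * norm a)\<^sup>2 \<le> (norm (W a + K a))\<^sup>2"
      using d by (intro power_mono) auto
    then have "(1 + e) * ((1 - d)\<^sup>2 * (norm a)\<^sup>2) \<le> (1 + e) * (norm (W a + K a))\<^sup>2"
      using \<open>e > 0\<close> by (simp add: power_mult_distrib)
    moreover have "1 * (norm a)\<^sup>2 \<le> ((1 + e) * (1 - d)\<^sup>2) * (norm a)\<^sup>2"
    proof (rule mult_right_mono)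
      have "(1 + e) * (1 - d)\<^sup>2 = (1 + e) - 2 * (d * (1 + e)) + (1 + e) * d\<^sup>2"
        by (simp add: power2_eq_square algebra_simps)
      moreover have "(1 + e) * d\<^sup>2 \<ge> 0"
        using \<open>e > 0\<close> by simp
      ultimately show "1 \<le> (1 + e) * (1 - d)\<^sup>2"
        using d(2) \<open>e > 0\<close> by linarith
    qed simp
    ultimately show "(norm a)\<^sup>2 \<le> (1 + e) * (norm (W a + K a))\<^sup>2"
      by (simp add: mult.assoc)
  qed
  then show "\<exists>N. \<forall>a\<in>tail_space N. (norm (W a + K a))\<^sup>2 \<le> (1 + e) * (norm a)\<^sup>2 \<and>
      (norm a)\<^sup>2 \<le> (1 + e) * (norm (W a + K a))\<^sup>2"
    by blast
qed

lemma asymp_isometric_if_compact_gram: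
  fixes A :: "ell2 \<Rightarrow> 'a::complex_inner"
  assumes A: "bounded_op A" and K: "compact_op (\<lambda>a. adj A (A a) - a)"
  shows "asymp_isometric A"
  unfolding asymp_isometric_def
proof (intro allI impI)
  fix e :: real assume "e > 0"
  \<comment> \<open>Chosen so that \<open>1 / (1 - d) = 1 + e\<close>.\<close>
  define d where "d = e / (1 + e)"
  have d: "d > 0" "(1 + e) * (1 - d) = 1" "d \<le> e"
    using \<open>e > 0\<close> by (auto simp: d_def field_simps)
  obtain N where N: "\<And>a. a \<in> tail_space N \<Longrightarrow> norm (adj A (A a) - a) \<le> d * norm a"
    using compact_op_small_on_tails[OF K d(1)] by blast
  have "(norm (A a))\<^sup>2 \<le> (1 + e) * (norm a)\<^sup>2 \<and> (norm a)\<^sup>2 \<le> (1 + e) * (norm (A a))\<^sup>2"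
    if a: "a \<in> tail_space N" for a
  proof -
    have "(norm (A a))\<^sup>2 - (norm a)\<^sup>2 = inner (adj A (A a) - a) a"
      by (simp add: inner_diff_left inner_gram_self[OF A] power2_norm_eq_inner)
    moreover have "\<bar>inner (adj A (A a) - a) a\<bar> \<le> norm (adj A (A a) - a) * norm a"
      by (rule Cauchy_Schwarz_ineq2)
    moreover have "norm (adj A (A a) - a) * norm a \<le> d * norm a * norm a"
      by (intro mult_right_mono N[OF a]) simp
    ultimately have *: "\<bar>(norm (A a))\<^sup>2 - (norm a)\<^sup>2\<bar> \<le> d * (norm a)\<^sup>2"
      by (simp add: power2_eq_square mult.assoc)
    have "d * (norm a)\<^sup>2 \<le> e * (norm a)\<^sup>2"
      using d by (intro mult_right_mono) auto
    with * have 1: "(norm (A a))\<^sup>2 \<le> (1 + e) * (norm a)\<^sup>2"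
      by (simp add: algebra_simps)
    have "(1 - d) * (norm a)\<^sup>2 \<le> (norm (A a))\<^sup>2"
      using * by (simp add: algebra_simps)
    then have "(1 + e) * ((1 - d) * (norm a)\<^sup>2) \<le> (1 + e) * (norm (A a))\<^sup>2"
      using \<open>e > 0\<close> by (intro mult_left_mono) auto
    then have "(norm a)\<^sup>2 \<le> (1 + e) * (norm (A a))\<^sup>2"
      using d(2) by (simp only: mult.assoc[symmetric] mult_1)
    with 1 show ?thesis by blast
  qed
  then show "\<exists>N. \<forall>a\<in>tail_space N. (norm (A a))\<^sup>2 \<le> (1 + e) * (norm a)\<^sup>2 \<and>
      (norm a)\<^sup>2 \<le> (1 + e) * (norm (A a))\<^sup>2"
    by blast
qed

text \<open>Conversely, up to finite rank the operator \<open>K = adj A \<circ> A - I\<close> is its compression to a tail,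
  whose norm is controlled by its quadratic form \<open>\<parallel>A a\<parallel>\<^sup>2 - \<parallel>a\<parallel>\<^sup>2\<close> because \<open>K\<close> is
  self-adjoint.\<close>

lemma compact_gram_if_asymp_isometric:
  fixes A :: "ell2 \<Rightarrow> 'a::complex_inner"
  assumes A: "bounded_op A" and asy: "asymp_isometric A"
  shows "compact_op (\<lambda>a. adj A (A a) - a)"
proof -
  define K where "K = (\<lambda>a. adj A (A a) - a)"
  have bK: "bounded_op K"
    unfolding K_def by (rule bounded_op_minus[OF bounded_op_gram[OF A] bounded_op_id])
  have symK: "inner (K a) b = inner a (K b)" for a b
    by (simp add: K_def inner_diff_left inner_diff_right gram_symmetric[OF A])
  have formK: "inner (K a) a = (norm (A a))\<^sup>2 - (norm a)\<^sup>2" for a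
    by (simp add: K_def inner_diff_left inner_gram_self[OF A] power2_norm_eq_inner)
  have "compact_op K"
  proof (rule compact_op_limit[OF bK])
    fix e :: real assume "e > 0"
    then obtain N where N: "\<And>a. a \<in> tail_space N \<Longrightarrow>
        (norm (A a))\<^sup>2 \<le> (1 + e) * (norm a)\<^sup>2 \<and> (norm a)\<^sup>2 \<le> (1 + e) * (norm (A a))\<^sup>2"
      using asy unfolding asymp_isometric_def by blast
    define T where "T = (\<lambda>a. tail N (K (tail N a)))"
    have bT: "bounded_op T"
      unfolding T_def
      by (rule bounded_op_compose[OF bounded_op_tail bounded_op_compose[OF bK bounded_op_tail]])
    have small: "norm (T a) \<le> e * norm a" for a
    proof (rule symmetric_op_norm_le[OF bT])
      show "inner (T a) b = inner a (T b)" for a b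
        by (simp add: T_def inner_tail symK)
      show "\<bar>inner (T a) a\<bar> \<le> e * (norm a)\<^sup>2" for a
      proof -
        define b where "b = tail N a"
        have "inner (T a) a = (norm (A b))\<^sup>2 - (norm b)\<^sup>2"
          by (simp add: T_def b_def inner_tail formK)
        moreover have Nb: "(norm (A b))\<^sup>2 \<le> (1 + e) * (norm b)\<^sup>2" "(norm b)\<^sup>2 \<le> (1 + e) * (norm (A b))\<^sup>2"
          using N[of b] tail_in_tail_space by (simp_all add: b_def)
        moreover have "(1 - e) * (norm b)\<^sup>2 \<le> (norm (A b))\<^sup>2"
        proof (cases "e \<ge> 1")
          case True
          then have "(1 - e) * (norm b)\<^sup>2 \<le> 0"
            by (intro mult_nonpos_nonneg) auto
          then show ?thesis
            by (rule order_trans) simp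
        next
          case False
          have "(1 - e) * (norm b)\<^sup>2 \<le> (1 - e) * ((1 + e) * (norm (A b))\<^sup>2)"
            using False Nb(2) by (intro mult_left_mono) auto
          also have "\<dots> = (1 - e\<^sup>2) * (norm (A b))\<^sup>2"
            by (simp add: algebra_simps power2_eq_square)
          also have "\<dots> \<le> 1 * (norm (A b))\<^sup>2"
            by (intro mult_right_mono) auto
          finally show ?thesis by simp
        qed
        ultimately have "\<bar>inner (T a) a\<bar> \<le> e * (norm b)\<^sup>2"
          by (simp add: algebra_simps)
        also have "\<dots> \<le> e * (norm a)\<^sup>2"
          using \<open>e > 0\<close> by (intro mult_left_mono power_mono) (auto simp: b_def norm_tail_le)
        finally show ?thesis .
      qed
    qed
    define L where "L = (\<lambda>a. head N (K a) + tail N (K (head N a)))"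
    have bH: "bounded_op (head N)"
      by (rule compact_op_bounded_op[OF compact_op_head])
    have "compact_op L"
      unfolding L_def
      by (intro compact_op_plus compact_op_compose_right[OF compact_op_head bK]
          compact_op_compose_left[OF bounded_op_compose[OF bounded_op_tail bK] compact_op_head])
    moreover have "K a - L a = T a" for a
    proof -
      have 1: "K a - head N (K a) = tail N (K a)"
        by (simp add: tail_def)
      have "tail N (K a) - tail N (K (head N a)) = tail N (K (a - head N a))"
        by (simp only: bounded_op_diff[OF bounded_op_tail] bounded_op_diff[OF bK])
      then show ?thesis
        using 1 by (simp add: L_def T_def tail_def[of N a] algebra_simps)
    qed
    ultimately show "\<exists>L. compact_op L \<and> (\<forall>a. norm (K a - L a) \<le> e * norm a)"
      using small by metis
  qed
  then show ?thesis by (simp add: K_def)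
qed


section \<open>Square roots of compact perturbations of the identity\<close>

text \<open>With \<open>G = M (I - B)\<close>, where \<open>M\<close> bounds the norm of \<open>G\<close>, the coercivity of \<open>G\<close> gives
  \<open>\<parallel>B\<parallel> \<le> q < 1\<close>, and the square root of \<open>I - B\<close> is \<open>I - Z\<close> for the fixed point \<open>Z\<close> of the
  contraction \<open>Z \<mapsto> (B + Z\<^sup>2) / 2\<close> on the self-adjoint operators of norm at most
  \<open>1 - sqrt (1 - q)\<close>.\<close>

lemma square_root_exists:
  fixes G :: "'a::chilbert_space \<Rightarrow> 'a"
  assumes G: "bounded_op G" "\<And>x y. inner (G x) y = inner x (G y)"
    and c: "c > 0" "\<And>x. inner (G x) x \<ge> c * (norm x)\<^sup>2"
  obtains S where "bounded_op S" "\<And>x y. inner (S x) y = inner x (S y)" "\<And>x. S (S x) = G x"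
    "\<exists>d>0. \<forall>x. inner (S x) x \<ge> d * (norm x)\<^sup>2"
proof -
  obtain M0 where M0: "M0 > 0" "\<And>x. norm (G x) \<le> M0 * norm x"
    using bounded_op_bound[OF G(1)] by blast
  define M where "M = max M0 c"
  have M: "M > 0" "M \<ge> c" "norm (G x) \<le> M * norm x" for x
    using M0(1) M0(2)[of x] mult_right_mono[of M0 M "norm x"] by (auto simp: M_def)
  define q where "q = 1 - c / M"
  have q: "0 \<le> q" "q < 1"
    using M(1,2) c(1) by (auto simp: q_def)
  define B where "B = (\<lambda>x. x - inverse M *\<^sub>R G x)"
  have bB: "bounded_op B"
    unfolding B_def by (rule bounded_op_minus[OF bounded_op_id bounded_op_scaleR_op[OF G(1)]])
  have symB: "inner (B x) y = inner x (B y)" for x y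
    by (simp add: B_def inner_diff_left inner_diff_right G(2))
  have normB: "norm (B x) \<le> q * norm x" for x
  proof (rule symmetric_op_norm_le[OF bB symB])
    fix x
    have form: "inner (B x) x = (norm x)\<^sup>2 - inverse M * inner (G x) x"
      by (simp add: B_def inner_diff_left power2_norm_eq_inner)
    have "inner (G x) x \<le> norm (G x) * norm x"
      by (rule norm_cauchy_schwarz)
    also have "\<dots> \<le> M * norm x * norm x"
      by (intro mult_right_mono M) simp
    finally have "inverse M * inner (G x) x \<le> (norm x)\<^sup>2"
      using M(1) by (simp add: field_simps power2_eq_square)
    then have 1: "inner (B x) x \<ge> 0"
      unfolding form by simp
    have "inverse M * (c * (norm x)\<^sup>2) \<le> inverse M * inner (G x) x"
      using M(1) c(2) by (intro mult_left_mono) auto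
    then have "inner (B x) x \<le> (norm x)\<^sup>2 - inverse M * (c * (norm x)\<^sup>2)"
      unfolding form by linarith
    also have "\<dots> = q * (norm x)\<^sup>2"
      by (simp add: q_def algebra_simps divide_inverse)
    finally show "\<bar>inner (B x) x\<bar> \<le> q * (norm x)\<^sup>2"
      using 1 by simp
  qed
  define r where "r = 1 - sqrt (1 - q)"
  have r: "0 \<le> r" "r < 1" "q + r * r = 2 * r"
  proof -
    have "sqrt (1 - q) * sqrt (1 - q) = 1 - q"
      using q by simp
    then show "q + r * r = 2 * r"
      by (simp add: r_def algebra_simps)
    show "0 \<le> r" "r < 1"
      using q by (auto simp: r_def)
  qed
  define b where "b = Blinfun B"
  have b: "blinfun_apply b = B"
    unfolding b_def by (rule bounded_linear_Blinfun_apply[OF bounded_op_bounded_linear[OF bB]])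
  define D :: "('a \<Rightarrow>\<^sub>L 'a) set" where
    "D = {Z. norm Z \<le> r \<and>
      (\<forall>x y. inner (blinfun_apply Z x) y = inner x (blinfun_apply Z y)) \<and>
      (\<forall>c x. blinfun_apply Z (c *\<^sub>C x) = c *\<^sub>C blinfun_apply Z x)}"
  have "\<exists>!Z\<in>D. (1/2) *\<^sub>R (b + (Z o\<^sub>L Z)) = Z"
  proof (rule Banach_fix)
    have "closed D"
      unfolding D_def
      by (intro closed_Collect_conj closed_Collect_all closed_Collect_le closed_Collect_eq
          continuous_intros bounded_linear.continuous_on[OF bounded_linear_scaleC])
    then show "complete D" by (simp add: complete_eq_closed)
    have "0 \<in> D"
      using r by (simp add: D_def)
    then show "D \<noteq> {}" by blast
    show "(\<lambda>Z. (1/2) *\<^sub>R (b + (Z o\<^sub>L Z))) ` D \<subseteq> D"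
    proof (rule image_subsetI)
      fix Z assume Z: "Z \<in> D"
      have "norm b \<le> q"
        using q normB by (intro norm_blinfun_bound) (auto simp: b)
      moreover have "norm (Z o\<^sub>L Z) \<le> r * r"
        using norm_blinfun_compose[of Z Z] mult_mono[of "norm Z" r "norm Z" r] Z r
        by (simp add: D_def)
      ultimately have "norm (b + (Z o\<^sub>L Z)) \<le> q + r * r"
        using norm_triangle_ineq[of b "Z o\<^sub>L Z"] by linarith
      then have "norm ((1/2) *\<^sub>R (b + (Z o\<^sub>L Z))) \<le> r"
        using r(3) by simp
      moreover have "inner ((1/2) *\<^sub>R (B x + Z (Z x))) y = inner x ((1/2) *\<^sub>R (B y + Z (Z y)))" for x y
        using Z by (simp add: D_def inner_add_left inner_add_right symB)
      moreover have "(1/2) *\<^sub>R (B (k *\<^sub>C x) + Z (Z (k *\<^sub>C x))) = k *\<^sub>C (1/2) *\<^sub>R (B x + Z (Z x))" for k x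
        using Z by (simp add: D_def bounded_op_scaleC[OF bB] scaleR_eq_scaleC scaleC_add_right
            scaleC_scaleC mult.commute)
      ultimately show "(1/2) *\<^sub>R (b + (Z o\<^sub>L Z)) \<in> D"
        by (simp add: D_def b blinfun.scaleR_left blinfun.add_left)
    qed
    fix Z W assume Z: "Z \<in> D" and W: "W \<in> D"
    have "(1/2) *\<^sub>R (b + (Z o\<^sub>L Z)) - (1/2) *\<^sub>R (b + (W o\<^sub>L W))
        = (1/2) *\<^sub>R ((Z o\<^sub>L (Z - W)) + ((Z - W) o\<^sub>L W))"
      by (rule blinfun_eqI)
        (simp add: blinfun.scaleR_left blinfun.add_left blinfun.diff_left blinfun.diff_right
          algebra_simps)
    moreover have "norm (Z o\<^sub>L (Z - W)) \<le> r * norm (Z - W)"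
      using norm_blinfun_compose[of Z "Z - W"] mult_right_mono[of "norm Z" r "norm (Z - W)"] Z
      by (simp add: D_def)
    moreover have "norm ((Z - W) o\<^sub>L W) \<le> r * norm (Z - W)"
      using norm_blinfun_compose[of "Z - W" W] mult_left_mono[of "norm W" r "norm (Z - W)"] W
      by (simp add: D_def mult.commute)
    ultimately show "dist ((1/2) *\<^sub>R (b + (Z o\<^sub>L Z))) ((1/2) *\<^sub>R (b + (W o\<^sub>L W))) \<le> r * dist Z W"
      using norm_triangle_ineq[of "Z o\<^sub>L (Z - W)" "(Z - W) o\<^sub>L W"] by (simp add: dist_norm)
  qed (use r in auto)
  then obtain Z where ZD: "Z \<in> D" and Zfix: "(1/2) *\<^sub>R (b + (Z o\<^sub>L Z)) = Z"
    by blast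
  have ZZ: "Z (Z x) = 2 *\<^sub>R Z x - B x" for x
  proof -
    have "blinfun_apply ((1/2) *\<^sub>R (b + (Z o\<^sub>L Z))) x = Z x"
      by (simp only: Zfix)
    then have "(1/2) *\<^sub>R (B x + Z (Z x)) = Z x"
      by (simp add: b blinfun.scaleR_left blinfun.add_left)
    then have "2 *\<^sub>R (1/2) *\<^sub>R (B x + Z (Z x)) = 2 *\<^sub>R Z x"
      by (rule arg_cong)
    then have "B x + Z (Z x) = 2 *\<^sub>R Z x"
      by simp
    then show ?thesis by (simp add: algebra_simps)
  qed
  have normZ: "norm (Z x) \<le> r * norm x" for x
    using norm_blinfun[of Z x] mult_right_mono[of "norm Z" r "norm x"] ZD by (simp add: D_def)
  have bZ: "bounded_op (blinfun_apply Z)"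
    using ZD by (auto simp: D_def bounded_op_def blinfun.bounded_linear_right)
  define S where "S = (\<lambda>x. sqrt M *\<^sub>R (x - Z x))"
  show ?thesis
  proof (rule that)
    show bS: "bounded_op S"
      unfolding S_def by (rule bounded_op_scaleR_op[OF bounded_op_minus[OF bounded_op_id bZ]])
    show "inner (S x) y = inner x (S y)" for x y
      using ZD by (simp add: S_def D_def inner_diff_left inner_diff_right)
    show "S (S x) = G x" for x
    proof -
      have "S (S x) = sqrt M *\<^sub>R sqrt M *\<^sub>R ((x - Z x) - Z (x - Z x))"
        by (simp add: S_def blinfun.scaleR_right blinfun.diff_right scaleR_diff_right)
      also have "\<dots> = M *\<^sub>R ((x - Z x) - Z (x - Z x))"
        using M(1) by simp
      also have "(x - Z x) - Z (x - Z x) = inverse M *\<^sub>R G x"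
        by (simp add: blinfun.diff_right ZZ B_def scaleR_2)
      also have "M *\<^sub>R inverse M *\<^sub>R G x = G x"
        using M(1) by simp
      finally show ?thesis .
    qed
    have "inner (S x) x \<ge> (sqrt M * (1 - r)) * (norm x)\<^sup>2" for x
    proof -
      have "inner (Z x) x \<le> norm (Z x) * norm x"
        by (rule norm_cauchy_schwarz)
      also have "\<dots> \<le> r * norm x * norm x"
        by (intro mult_right_mono normZ) simp
      finally have "(1 - r) * (norm x)\<^sup>2 \<le> inner (x - Z x) x"
        by (simp add: inner_diff_left power2_norm_eq_inner[symmetric])
          (simp add: algebra_simps power2_eq_square)
      then have "sqrt M * ((1 - r) * (norm x)\<^sup>2) \<le> sqrt M * inner (x - Z x) x"
        using M(1) by (intro mult_left_mono) auto
      then show ?thesis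
        by (simp add: S_def mult.assoc)
    qed
    then show "\<exists>d>0. \<forall>x. inner (S x) x \<ge> d * (norm x)\<^sup>2"
      using M(1) r(2) by (intro exI[of _ "sqrt M * (1 - r)"]) auto
  qed
qed

text \<open>Since \<open>(S - I) (S + I) = S\<^sup>2 - I\<close> and \<open>S + I\<close> is invertible, \<open>S - I\<close> is compact if \<open>S\<^sup>2 - I\<close> is.\<close>

lemma compact_square_root_minus_id:
  fixes S :: "'a::chilbert_space \<Rightarrow> 'a"
  assumes S: "bounded_op S" and d: "d > 0" "\<And>x. inner (S x) x \<ge> d * (norm x)\<^sup>2"
    and K: "compact_op (\<lambda>x. S (S x) - x)"
  shows "compact_op (\<lambda>x. S x - x)"
proof -
  have "invertible_op (\<lambda>x. S x + x)"
  proof (rule coercive_invertible[where c = 1])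
    show "bounded_op (\<lambda>x. S x + x)"
      by (rule bounded_op_plus[OF S bounded_op_id])
    show "1 * (norm x)\<^sup>2 \<le> inner (S x + x) x" for x
    proof -
      have "0 \<le> inner (S x) x"
        using d(1) d(2)[of x] by (smt (verit) mult_nonneg_nonneg zero_le_power2)
      then show ?thesis
        by (simp add: inner_add_left power2_norm_eq_inner)
    qed
  qed simp
  then obtain H where H: "bounded_op H" "\<And>y. S (H y) + H y = y"
    by (rule invertible_opE) blast
  have "S y - y = S (S (H y)) - H y" for y
  proof -
    have "S y = S (S (H y)) + S (H y)"
      using arg_cong[OF H(2)[of y], of S] by (simp add: bounded_op_add[OF S])
    then have "S y - y = (S (S (H y)) + S (H y)) - (S (H y) + H y)"
      using H(2)[of y] by simp
    then show ?thesis by simp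
  qed
  then show ?thesis
    using compact_op_compose_right[OF K H(1)] by simp
qed


section \<open>Unitary plus compact operators\<close>

text \<open>The unitary part of \<open>U = A\<inverse>\<close> is \<open>S \<circ> U\<close>, where \<open>S\<close> is the square root of the Gram operator
  \<open>adj A \<circ> A\<close>. This is the polar decomposition of \<open>A\<close>, inverted.\<close>

lemma UK_if_asymp_isometric:
  fixes A :: "ell2 \<Rightarrow> 'a::chilbert_space"
  assumes A: "bounded_op A" and U: "bounded_op U" "\<And>a. U (A a) = a" "\<And>f. A (U f) = f"
    and asy: "asymp_isometric A"
  shows "U \<in> UK"
proof -
  obtain M where M: "M > 0" "\<And>f. norm (U f) \<le> M * norm f"
    using bounded_op_bound[OF U(1)] by blast
  have low: "norm a \<le> M * norm (A a)" for a
    using M(2)[of "A a"] by (simp add: U)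
  have coer: "inverse (M\<^sup>2) * (norm a)\<^sup>2 \<le> inner (adj A (A a)) a" for a
    by (rule gram_coercive[OF A M(1) low])
  have "inverse (M\<^sup>2) > 0"
    using M(1) by simp
  then obtain S d where S: "bounded_op S" "\<And>a b. inner (S a) b = inner a (S b)"
    "\<And>a. S (S a) = adj A (A a)" and d: "d > 0" "\<And>a. inner (S a) a \<ge> d * (norm a)\<^sup>2"
    using square_root_exists[OF bounded_op_gram[OF A] gram_symmetric[OF A] _ coer] by metis
  have "compact_op (\<lambda>a. S (S a) - a)"
    unfolding S(3) by (rule compact_gram_if_asymp_isometric[OF A asy])
  then have K: "compact_op (\<lambda>a. S a - a)"
    by (rule compact_square_root_minus_id[OF S(1) d])
  obtain T where T: "\<And>a. S (T a) = a"
    using coercive_invertible[OF S(1) d] by (rule invertible_opE) blast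
  have bW: "bounded_op (\<lambda>f. S (U f))"
    by (rule bounded_op_compose[OF S(1) U(1)])
  have "unitary_op (\<lambda>f. S (U f))"
    unfolding unitary_op_def
  proof (intro conjI allI)
    show "bounded_op (\<lambda>f. S (U f))" by (rule bW)
    show "surj (\<lambda>f. S (U f))"
      unfolding surj_def
    proof
      fix b
      have "b = S (U (A (T b)))" by (simp add: U T)
      then show "\<exists>f. b = S (U f)" by blast
    qed
    have "inner (S (U f)) (S (U g)) = inner f g" for f g
    proof -
      have "inner (S (U f)) (S (U g)) = inner (adj A (A (U f))) (U g)"
        by (simp only: S(2)[symmetric] S(3))
      also have "\<dots> = inner f g"
        by (simp add: inner_adj[OF A, symmetric] U)
      finally show ?thesis .
    qed
    then show "cinner (S (U f)) (S (U g)) = cinner f g" for f g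
      by (rule cinner_preserving_if_inner[OF bW])
  qed
  moreover have "compact_op (\<lambda>f. - (S (U f) - U f))"
    by (rule compact_op_uminus[OF compact_op_compose_right[OF K U(1)]])
  moreover have "U = (\<lambda>f. S (U f) + - (S (U f) - U f))"
    by simp
  moreover have "invertible_op U"
    by (rule invertible_opI_inverse[OF U(1) A U(3) U(2)])
  ultimately show ?thesis
    unfolding UK_def by blast
qed

text \<open>If \<open>U = V + K\<close> and \<open>W\<close> is the inverse of the unitary operator \<open>V\<close>, then \<open>A = W - W \<circ> K \<circ> A\<close>.\<close>

lemma asymp_isometric_if_UK:
  fixes A :: "ell2 \<Rightarrow> 'a::chilbert_space"
  assumes A: "bounded_op A" "\<And>a. U (A a) = a" "\<And>f. A (U f) = f" and U: "U \<in> UK"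
  shows "asymp_isometric A"
proof -
  obtain V K where V: "unitary_op V" and K: "compact_op K" and UVK: "U = (\<lambda>f. V f + K f)"
    using U unfolding UK_def by blast
  have bV: "bounded_op V" "surj V" and Vc: "\<And>f g. cinner (V f) (V g) = cinner f g"
    using V by (auto simp: unitary_op_def)
  have nV: "norm (V f) = norm f" for f
    using Vc[of f f] by (simp add: norm_eq_sqrt_inner inner_eq_Re_cinner)
  have "invertible_op V"
    by (rule invertible_opI[OF bV, of 1]) (simp add: nV)
  then obtain W where W: "bounded_op W" "\<And>f. W (V f) = f" "\<And>a. V (W a) = a"
    by (rule invertible_opE) blast
  have nW: "norm (W a) = norm a" for a
    using nV[of "W a"] by (simp add: W)
  have "compact_op (\<lambda>a. - W (K (A a)))"
    by (rule compact_op_uminus[OF compact_op_compose_left[OF W(1) compact_op_compose_right[OF K A(1)]]])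
  then have "asymp_isometric (\<lambda>a. W a + - W (K (A a)))"
    by (rule asymp_isometric_isometry_plus_compact[OF nW])
  moreover have "W a + - W (K (A a)) = A a" for a
  proof -
    have "K (A a) = a - V (A a)"
      using A(2)[of a] by (simp add: UVK algebra_simps)
    then show ?thesis
      by (simp add: bounded_op_diff[OF W(1)] W(2))
  qed
  ultimately show ?thesis by simp
qed


section \<open>Sequences equivalent to the unit vector basis\<close>

text \<open>The common form of all the conditions: \<open>x\<close> is the image of the unit vector basis under an
  asymptotically isometric isomorphism.\<close>

definition AO_basis :: "(nat \<Rightarrow> 'a::complex_inner) \<Rightarrow> bool" where
  "AO_basis x \<longleftrightarrow> (\<exists>A. invertible_op A \<and> (\<forall>n. A (ell2_basis n) = x n) \<and> asymp_isometric A)"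

lemma AO_basisI: "invertible_op A \<Longrightarrow> (\<And>n. A (ell2_basis n) = x n) \<Longrightarrow> asymp_isometric A \<Longrightarrow> AO_basis x"
  unfolding AO_basis_def by blast

text \<open>An isomorphism \<open>A\<close> maps the sequences supported on \<open>{N..}\<close> onto the closed span of its images of
  the unit vectors from index \<open>N\<close> on.\<close>

lemma closed_span_tail:
  fixes A :: "ell2 \<Rightarrow> 'a::complex_inner"
  assumes A: "invertible_op A" and Ax: "\<And>n. A (ell2_basis n) = x n"
  shows "closed_span (x ` {N..}) = A ` tail_space N"
proof
  obtain U where bA: "bounded_op A" and U: "bounded_op U" "\<And>a. U (A a) = a" "\<And>f. A (U f) = f"
    by (rule invertible_opE[OF A]) blast
  have eq: "A ` tail_space N = {f. \<forall>n<N. coord (U f) n = 0}"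
    using U by (force simp: tail_space_def image_iff)
  show "closed_span (x ` {N..}) \<subseteq> A ` tail_space N"
  proof (rule closed_span_minimal)
    show "x ` {N..} \<subseteq> A ` tail_space N"
      using basis_in_tail_space by (auto simp: Ax[symmetric])
    show "complex_vector.subspace (A ` tail_space N)"
      unfolding eq by (rule complex_vector.subspaceI)
        (simp_all add: bounded_op_zero[OF U(1)] bounded_op_add[OF U(1)] bounded_op_scaleC[OF U(1)])
    have "continuous_on UNIV (\<lambda>f. coord (U f) n)" for n
      unfolding cinner_basis[symmetric]
      by (intro linear_continuous_on
          bounded_linear_compose[OF bounded_linear_cinner_left bounded_op_bounded_linear[OF U(1)]])
    then show "closed (A ` tail_space N)"
      unfolding eq
      by (intro closed_Collect_all closed_Collect_imp closed_Collect_eq open_Collect_const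
          continuous_on_const)
  qed
  show "A ` tail_space N \<subseteq> closed_span (x ` {N..})"
  proof (rule image_subsetI)
    fix a assume a: "a \<in> tail_space N"
    have "A (head m a) \<in> complex_vector.span (x ` {N..})" for m
      unfolding op_head[OF bA] Ax
    proof (rule complex_vector.span_sum)
      fix k show "coord a k *\<^sub>C x k \<in> complex_vector.span (x ` {N..})"
      proof (cases "k < N")
        case True
        then show ?thesis
          using a by (simp add: tail_space_def complex_vector.span_zero)
      next
        case False
        then show ?thesis
          by (intro complex_vector.span_scale complex_vector.span_base) auto
      qed
    qed
    moreover have "(\<lambda>m. A (head m a)) \<longlonglongrightarrow> A a"
      by (rule bounded_op_tendsto[OF bA head_tendsto])
    ultimately show "A a \<in> closed_span (x ` {N..})"
      unfolding closed_span_def closure_sequential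
      by (intro exI[of _ "\<lambda>m. A (head m a)"] conjI allI)
  qed
qed

lemma complete_seq_invertible_image:
  fixes A :: "ell2 \<Rightarrow> 'a::complex_inner"
  assumes "invertible_op A" "\<And>n. A (ell2_basis n) = x n"
  shows "complete_seq x"
proof -
  have "surj A"
    using invertible_opE[OF assms(1)] by (metis surjI)
  moreover have "tail_space 0 = UNIV"
    by (simp add: tail_space_def)
  ultimately show ?thesis
    using closed_span_tail[OF assms, of 0] by (simp add: complete_seq_def atLeast_0)
qed

lemma AO_basis_complete: "AO_basis x \<Longrightarrow> complete_seq x"
  unfolding AO_basis_def by (elim exE conjE) (rule complete_seq_invertible_image, auto)

text \<open>An asymptotic statement together with a bound valid from the start yields a sequence of
  constants tending to 1: take the infimum of the admissible constants that are at least 1, and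
  add \<open>1 / (N + 1)\<close> because the infimum itself need not be admissible.\<close>

lemma constants_tending_to_one:
  fixes P :: "nat \<Rightarrow> real \<Rightarrow> bool"
  assumes mono: "\<And>N M c d. P N c \<Longrightarrow> N \<le> M \<Longrightarrow> c \<le> d \<Longrightarrow> P M d"
    and init: "P 0 C0" and lim: "\<And>e. e > 0 \<Longrightarrow> \<exists>N. P N (1 + e)"
  shows "\<exists>C. (\<forall>N. C N > 0 \<and> P N (C N)) \<and> C \<longlonglongrightarrow> 1"
proof -
  define S where "S N = {d. d \<ge> 1 \<and> P N d}" for N
  define C where "C N = Inf (S N) + 1 / real (Suc N)" for N
  have ne: "S N \<noteq> {}" for N
    using mono[OF init, of N "max C0 1"] by (auto simp: S_def intro!: exI[of _ "max C0 1"])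
  have bdd: "bdd_below (S N)" for N
    by (rule bdd_belowI[of _ 1]) (auto simp: S_def)
  have inf1: "Inf (S N) \<ge> 1" for N
    by (rule cInf_greatest[OF ne]) (auto simp: S_def)
  have P: "P N (C N)" for N
  proof -
    have "Inf (S N) < C N" by (simp add: C_def)
    then obtain d where "d \<in> S N" "d < C N"
      using cInf_less_iff[OF ne bdd] by blast
    then show ?thesis
      using mono[of N d N "C N"] by (simp add: S_def)
  qed
  have "(\<lambda>N. Inf (S N)) \<longlonglongrightarrow> 1"
  proof (rule metric_LIMSEQ_I)
    fix e :: real assume "e > 0"
    then have "e / 2 > 0" by simp
    then obtain M where M: "P M (1 + e / 2)"
      using lim by blast
    have "dist (Inf (S N)) 1 < e" if "N \<ge> M" for N
    proof -
      have "1 + e / 2 \<in> S N"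
        using mono[OF M that order_refl] \<open>e > 0\<close> by (simp add: S_def)
      then have "Inf (S N) \<le> 1 + e / 2"
        by (rule cInf_lower[OF _ bdd])
      then show ?thesis
        using inf1[of N] \<open>e > 0\<close> by (simp add: dist_real_def)
    qed
    then show "\<exists>M. \<forall>N\<ge>M. dist (Inf (S N)) 1 < e" by blast
  qed
  moreover have "(\<lambda>N. 1 / real (Suc N)) \<longlonglongrightarrow> 0"
    by (rule LIMSEQ_Suc[OF lim_1_over_n])
  ultimately have "C \<longlonglongrightarrow> 1 + 0"
    unfolding C_def by (rule tendsto_add)
  moreover have "C N > 0" for N
    using inf1[of N] by (simp add: C_def add_pos_pos)
  ultimately show ?thesis
    using P by auto
qed

lemma asymp_isometric_constants:
  fixes A :: "ell2 \<Rightarrow> 'a::complex_inner"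
  assumes A: "invertible_op A" and asy: "asymp_isometric A"
  obtains C C' where "\<And>N. C N > 0" "\<And>N. C' N > 0"
    "\<And>N a. a \<in> tail_space N \<Longrightarrow> (norm (A a))\<^sup>2 \<le> C N * (norm a)\<^sup>2"
    "\<And>N a. a \<in> tail_space N \<Longrightarrow> (norm a)\<^sup>2 \<le> C' N * (norm (A a))\<^sup>2"
    "C \<longlonglongrightarrow> 1" "C' \<longlonglongrightarrow> 1"
proof -
  obtain U where bA: "bounded_op A" and U: "bounded_op U" "\<And>a. U (A a) = a"
    by (rule invertible_opE[OF A]) blast
  obtain M where M: "M > 0" "\<And>a. norm (A a) \<le> M * norm a"
    using bounded_op_bound[OF bA] by blast
  obtain M' where M': "M' > 0" "\<And>f. norm (U f) \<le> M' * norm f"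
    using bounded_op_bound[OF U(1)] by blast
  have up: "(norm (A a))\<^sup>2 \<le> M\<^sup>2 * (norm a)\<^sup>2" for a
    using power_mono[OF M(2)[of a], of 2] by (simp add: power_mult_distrib)
  have low: "(norm a)\<^sup>2 \<le> M'\<^sup>2 * (norm (A a))\<^sup>2" for a
    using power_mono[OF M'(2)[of "A a"], of 2] by (simp add: power_mult_distrib U)
  have "\<exists>C. (\<forall>N. C N > 0 \<and> (\<forall>a\<in>tail_space N. (norm (A a))\<^sup>2 \<le> C N * (norm a)\<^sup>2)) \<and> C \<longlonglongrightarrow> 1"
  proof (rule constants_tending_to_one[where P = "\<lambda>N c. \<forall>a\<in>tail_space N. (norm (A a))\<^sup>2 \<le> c * (norm a)\<^sup>2"])
    show "\<forall>a\<in>tail_space L. (norm (A a))\<^sup>2 \<le> d * (norm a)\<^sup>2"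
      if "\<forall>a\<in>tail_space N. (norm (A a))\<^sup>2 \<le> c * (norm a)\<^sup>2" "N \<le> L" "c \<le> d" for N L c d
    proof
      fix a assume "a \<in> tail_space L"
      then have "(norm (A a))\<^sup>2 \<le> c * (norm a)\<^sup>2"
        using that(1) tail_space_mono[OF that(2)] by blast
      also have "\<dots> \<le> d * (norm a)\<^sup>2"
        using that(3) by (rule mult_right_mono) simp
      finally show "(norm (A a))\<^sup>2 \<le> d * (norm a)\<^sup>2" .
    qed
    show "\<forall>a\<in>tail_space 0. (norm (A a))\<^sup>2 \<le> M\<^sup>2 * (norm a)\<^sup>2" using up by blast
    show "\<exists>N. \<forall>a\<in>tail_space N. (norm (A a))\<^sup>2 \<le> (1 + e) * (norm a)\<^sup>2" if "e > 0" for e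
      using asy that unfolding asymp_isometric_def by blast
  qed
  then obtain C where C: "\<And>N. C N > 0"
    "\<And>N. \<forall>a\<in>tail_space N. (norm (A a))\<^sup>2 \<le> C N * (norm a)\<^sup>2" "C \<longlonglongrightarrow> 1"
    by blast
  have "\<exists>C. (\<forall>N. C N > 0 \<and> (\<forall>a\<in>tail_space N. (norm a)\<^sup>2 \<le> C N * (norm (A a))\<^sup>2)) \<and> C \<longlonglongrightarrow> 1"
  proof (rule constants_tending_to_one[where P = "\<lambda>N c. \<forall>a\<in>tail_space N. (norm a)\<^sup>2 \<le> c * (norm (A a))\<^sup>2"])
    show "\<forall>a\<in>tail_space L. (norm a)\<^sup>2 \<le> d * (norm (A a))\<^sup>2"
      if "\<forall>a\<in>tail_space N. (norm a)\<^sup>2 \<le> c * (norm (A a))\<^sup>2" "N \<le> L" "c \<le> d" for N L c d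
    proof
      fix a assume "a \<in> tail_space L"
      then have "(norm a)\<^sup>2 \<le> c * (norm (A a))\<^sup>2"
        using that(1) tail_space_mono[OF that(2)] by blast
      also have "\<dots> \<le> d * (norm (A a))\<^sup>2"
        using that(3) by (rule mult_right_mono) simp
      finally show "(norm a)\<^sup>2 \<le> d * (norm (A a))\<^sup>2" .
    qed
    show "\<forall>a\<in>tail_space 0. (norm a)\<^sup>2 \<le> M'\<^sup>2 * (norm (A a))\<^sup>2" using low by blast
    show "\<exists>N. \<forall>a\<in>tail_space N. (norm a)\<^sup>2 \<le> (1 + e) * (norm (A a))\<^sup>2" if "e > 0" for e
      using asy that unfolding asymp_isometric_def by blast
  qed
  then obtain C' where C': "\<And>N. C' N > 0"
    "\<And>N. \<forall>a\<in>tail_space N. (norm a)\<^sup>2 \<le> C' N * (norm (A a))\<^sup>2" "C' \<longlonglongrightarrow> 1"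
    by blast
  show ?thesis
    by (rule that[of C C']) (use C C' in auto)
qed

lemma asymp_isometricI_constants:
  fixes A :: "ell2 \<Rightarrow> 'a::complex_inner" and C C' :: "nat \<Rightarrow> real"
  assumes "\<And>N a. a \<in> tail_space N \<Longrightarrow> (norm (A a))\<^sup>2 \<le> C N * (norm a)\<^sup>2"
    "\<And>N a. a \<in> tail_space N \<Longrightarrow> (norm a)\<^sup>2 \<le> C' N * (norm (A a))\<^sup>2"
    "C \<longlonglongrightarrow> 1" "C' \<longlonglongrightarrow> 1"
  shows "asymp_isometric A"
  unfolding asymp_isometric_def
proof (intro allI impI)
  fix e :: real assume "e > 0"
  then have "\<forall>\<^sub>F N in sequentially. C N < 1 + e \<and> C' N < 1 + e"
    using order_tendstoD(2)[OF assms(3), of "1 + e"] order_tendstoD(2)[OF assms(4), of "1 + e"]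
    by (simp add: eventually_conj_iff)
  then obtain N where N: "C N < 1 + e" "C' N < 1 + e"
    unfolding eventually_sequentially by blast
  have "(norm (A a))\<^sup>2 \<le> (1 + e) * (norm a)\<^sup>2 \<and> (norm a)\<^sup>2 \<le> (1 + e) * (norm (A a))\<^sup>2"
    if a: "a \<in> tail_space N" for a
  proof
    have "C N * (norm a)\<^sup>2 \<le> (1 + e) * (norm a)\<^sup>2"
      using N by (intro mult_right_mono) auto
    then show "(norm (A a))\<^sup>2 \<le> (1 + e) * (norm a)\<^sup>2"
      using assms(1)[OF a] by linarith
    have "C' N * (norm (A a))\<^sup>2 \<le> (1 + e) * (norm (A a))\<^sup>2"
      using N by (intro mult_right_mono) auto
    then show "(norm a)\<^sup>2 \<le> (1 + e) * (norm (A a))\<^sup>2"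
      using assms(2)[OF a] by linarith
  qed
  then show "\<exists>N. \<forall>a\<in>tail_space N. (norm (A a))\<^sup>2 \<le> (1 + e) * (norm a)\<^sup>2 \<and>
      (norm a)\<^sup>2 \<le> (1 + e) * (norm (A a))\<^sup>2"
    by blast
qed


subsection \<open>Duality\<close>

text \<open>The dual operator of an isomorphism \<open>A\<close> is the inverse of its adjoint; its images of the
  unit vectors are biorthogonal to those of \<open>A\<close>.\<close>

lemma dual_op_exists:
  fixes A :: "ell2 \<Rightarrow> 'a::complex_inner"
  assumes A: "invertible_op A"
  obtains B where "invertible_op B" "\<And>b. adj A (B b) = b" "\<And>f. B (adj A f) = f"
    "\<And>a. adj B (A a) = a" "\<And>f. A (adj B f) = f"
proof -
  obtain U where bA: "bounded_op A" and U: "bounded_op U" "\<And>a. U (A a) = a" "\<And>f. A (U f) = f"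
    by (rule invertible_opE[OF A]) blast
  obtain M where M: "M > 0" "\<And>f. norm (U f) \<le> M * norm f"
    using bounded_op_bound[OF U(1)] by blast
  have low: "norm a \<le> M * norm (A a)" for a
    using M(2)[of "A a"] by (simp add: U)
  have "invertible_op (\<lambda>a. adj A (A a))"
  proof (rule coercive_invertible[OF bounded_op_gram[OF bA]])
    show "inverse (M\<^sup>2) > 0" using M by simp
    show "inverse (M\<^sup>2) * (norm a)\<^sup>2 \<le> inner (adj A (A a)) a" for a
      by (rule gram_coercive[OF bA M(1) low])
  qed
  then obtain H where H: "bounded_op H" "\<And>a. H (adj A (A a)) = a" "\<And>b. adj A (A (H b)) = b"
    by (rule invertible_opE) blast
  define B where "B = (\<lambda>b. A (H b))"
  have bB: "bounded_op B"
    unfolding B_def by (rule bounded_op_compose[OF bA H(1)])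
  have AB: "adj A (B b) = b" for b
    by (simp add: B_def H)
  have BA: "B (adj A f) = f" for f
    using H(2)[of "U f"] by (simp add: B_def U)
  have adjB: "adj B (A a) = a" for a
  proof (rule ell2_eqI)
    fix n
    have "cinner (B (ell2_basis n)) (A a) = cinner (ell2_basis n) a"
      by (simp add: cinner_adj[OF bA] AB)
    then have "cinner (A a) (B (ell2_basis n)) = cinner a (ell2_basis n)"
      using cinner_commute by metis
    then show "coord (adj B (A a)) n = coord a n"
      by (simp add: coord_adj[OF bB] cinner_basis)
  qed
  have "A (adj B f) = f" for f
    using adjB[of "U f"] by (simp add: U)
  moreover have "invertible_op B"
    by (rule invertible_opI_inverse[OF bB bounded_op_adj[OF bA] AB BA])
  ultimately show ?thesis
    by (intro that[of B] AB BA adjB)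
qed

text \<open>The Gram operator of the dual is the inverse of the Gram operator, so both are compact
  perturbations of the identity at the same time.\<close>

lemma asymp_isometric_dual:
  fixes A B :: "ell2 \<Rightarrow> 'a::complex_inner"
  assumes A: "bounded_op A" and B: "bounded_op B"
    and AB: "\<And>b. adj A (B b) = b" and BA: "\<And>f. A (adj B f) = f"
    and asy: "asymp_isometric A"
  shows "asymp_isometric B"
proof (rule asymp_isometric_if_compact_gram[OF B])
  have "compact_op (\<lambda>b. - (adj A (A (adj B (B b))) - adj B (B b)))"
    by (rule compact_op_uminus[OF compact_op_compose_right[OF
          compact_gram_if_asymp_isometric[OF A asy] bounded_op_gram[OF B]]])
  then show "compact_op (\<lambda>b. adj B (B b) - b)"
    by (simp add: BA AB)
qed

lemma AO_basis_dual_pair: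
  fixes x y :: "nat \<Rightarrow> 'a::complex_inner"
  assumes x: "AO_basis x" and xy: "\<And>l n. cinner (x l) (y n) = (if l = n then 1 else 0)"
  obtains A B where "invertible_op A" "invertible_op B"
    "\<And>n. A (ell2_basis n) = x n" "\<And>n. B (ell2_basis n) = y n"
    "asymp_isometric A" "asymp_isometric B"
    "\<And>b. adj A (B b) = b" "\<And>f. B (adj A f) = f" "\<And>a. adj B (A a) = a" "\<And>f. A (adj B f) = f"
proof -
  obtain A where A: "invertible_op A" "\<And>n. A (ell2_basis n) = x n" "asymp_isometric A"
    using x unfolding AO_basis_def by blast
  obtain B where B: "invertible_op B" "\<And>b. adj A (B b) = b" "\<And>f. B (adj A f) = f"
    "\<And>a. adj B (A a) = a" "\<And>f. A (adj B f) = f"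
    using dual_op_exists[OF A(1)] by blast
  have bAB: "bounded_op A" "bounded_op B"
    using A(1) B(1) by (simp_all add: invertible_op_def)
  have "cinner (x l) (B (ell2_basis n)) = (if l = n then 1 else 0)" for l n
    using cinner_adj[OF bAB(2), of "x l" "ell2_basis n"] B(4)[of "ell2_basis l"]
    by (simp add: A(2) cinner_basis_basis)
  then have "biorthogonal x = (\<lambda>n. B (ell2_basis n))"
    by (intro biorthogonal_eqI AO_basis_complete[OF x])
  moreover have "biorthogonal x = y"
    by (rule biorthogonal_eqI[OF AO_basis_complete[OF x] xy])
  ultimately have By: "B (ell2_basis n) = y n" for n
    by metis
  have "asymp_isometric B"
    by (rule asymp_isometric_dual[OF bAB B(2) B(5) A(3)])
  then show ?thesis
    by (intro that[of A B] A B By)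
qed

lemma AO_basis_dual:
  fixes x y :: "nat \<Rightarrow> 'a::complex_inner"
  assumes "AO_basis x" "\<And>l n. cinner (x l) (y n) = (if l = n then 1 else 0)"
  shows "AO_basis y"
proof -
  obtain B where "invertible_op B" "\<And>n. B (ell2_basis n) = y n" "asymp_isometric B"
    by (rule AO_basis_dual_pair[OF assms]) blast
  then show ?thesis by (rule AO_basisI)
qed


subsection \<open>Asymptotically orthonormal basic sequences\<close>

lemma AOB_finite_sums:
  fixes x :: "nat \<Rightarrow> 'a::complex_inner"
  assumes "AOB x"
  obtains c C :: "nat \<Rightarrow> real" where "\<And>N. c N > 0" "\<And>N. C N > 0"
    "\<And>N F a. finite F \<Longrightarrow> F \<subseteq> {N..} \<Longrightarrow>
      c N * (\<Sum>n\<in>F. (cmod (a n))\<^sup>2) \<le> (norm (\<Sum>n\<in>F. a n *\<^sub>C x n))\<^sup>2"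
    "\<And>N F a. finite F \<Longrightarrow> F \<subseteq> {N..} \<Longrightarrow>
      (norm (\<Sum>n\<in>F. a n *\<^sub>C x n))\<^sup>2 \<le> C N * (\<Sum>n\<in>F. (cmod (a n))\<^sup>2)"
    "c \<longlonglongrightarrow> 1" "C \<longlonglongrightarrow> 1"
proof -
  obtain c C :: "nat \<Rightarrow> real" where cC: "\<forall>N. c N > 0 \<and> C N > 0 \<and>
       (\<forall>a :: nat \<Rightarrow> complex. finite {n. a n \<noteq> 0} \<longrightarrow>
          c N * (\<Sum>n | n \<ge> N \<and> a n \<noteq> 0. (cmod (a n))\<^sup>2)
            \<le> (norm (\<Sum>n | n \<ge> N \<and> a n \<noteq> 0. a n *\<^sub>C x n))\<^sup>2 \<and>
          (norm (\<Sum>n | n \<ge> N \<and> a n \<noteq> 0. a n *\<^sub>C x n))\<^sup>2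
            \<le> C N * (\<Sum>n | n \<ge> N \<and> a n \<noteq> 0. (cmod (a n))\<^sup>2))" and lim: "c \<longlonglongrightarrow> 1" "C \<longlonglongrightarrow> 1"
    using assms unfolding AOB_def by blast
  have "c N * (\<Sum>n\<in>F. (cmod (a n))\<^sup>2) \<le> (norm (\<Sum>n\<in>F. a n *\<^sub>C x n))\<^sup>2 \<and>
      (norm (\<Sum>n\<in>F. a n *\<^sub>C x n))\<^sup>2 \<le> C N * (\<Sum>n\<in>F. (cmod (a n))\<^sup>2)"
    if F: "finite F" "F \<subseteq> {N..}" for N F and a :: "nat \<Rightarrow> complex"
  proof -
    \<comment> \<open>Cutting off \<open>a\<close> outside \<open>F\<close> yields a finitely supported sequence.\<close>
    define b where "b n = (if n \<in> F then a n else 0)" for n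
    have fin: "finite {n. b n \<noteq> 0}"
      by (rule finite_subset[OF _ F(1)]) (auto simp: b_def)
    have s1: "(\<Sum>n | n \<ge> N \<and> b n \<noteq> 0. (cmod (b n))\<^sup>2) = (\<Sum>n\<in>F. (cmod (a n))\<^sup>2)"
      by (rule sum.mono_neutral_cong_left) (use F in \<open>auto simp: b_def split: if_splits\<close>)
    have s2: "(\<Sum>n | n \<ge> N \<and> b n \<noteq> 0. b n *\<^sub>C x n) = (\<Sum>n\<in>F. a n *\<^sub>C x n)"
      by (rule sum.mono_neutral_cong_left) (use F in \<open>auto simp: b_def split: if_splits\<close>)
    show ?thesis
      using cC[THEN spec, of N, THEN conjunct2, THEN conjunct2, THEN spec, THEN mp, OF fin]
      unfolding s1 s2 .
  qed
  then show ?thesis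
    by (intro that[of c C]) (use cC lim in auto)
qed

lemma norm_sq_finite_combination:
  assumes "finite F"
  shows "(norm (\<Sum>n\<in>F. a n *\<^sub>C ell2_basis n))\<^sup>2 = (\<Sum>n\<in>F. (cmod (a n))\<^sup>2)"
    and "coord (\<Sum>n\<in>F. a n *\<^sub>C ell2_basis n) k = (if k \<in> F then a k else 0)"
proof -
  have coord: "coord (\<Sum>n\<in>F. a n *\<^sub>C ell2_basis n) k = (if k \<in> F then a k else 0)" for k
  proof -
    have "coord (\<Sum>n\<in>F. a n *\<^sub>C ell2_basis n) k = (\<Sum>n\<in>F. if n = k then a n else 0)"
      unfolding coord_sum by (intro sum.cong) (auto simp: coord_basis)
    then show ?thesis using assms by (simp add: sum.delta)
  qed
  then show "coord (\<Sum>n\<in>F. a n *\<^sub>C ell2_basis n) k = (if k \<in> F then a k else 0)" .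
  have "(\<lambda>k. (cmod (coord (\<Sum>n\<in>F. a n *\<^sub>C ell2_basis n) k))\<^sup>2)
      = (\<lambda>k. if k \<in> F then (cmod (a k))\<^sup>2 else 0)"
    by (auto simp: coord)
  then show "(norm (\<Sum>n\<in>F. a n *\<^sub>C ell2_basis n))\<^sup>2 = (\<Sum>n\<in>F. (cmod (a n))\<^sup>2)"
    using sums_norm_ell2[of "\<Sum>n\<in>F. a n *\<^sub>C ell2_basis n"]
      sums_If_finite_set[OF assms, of "\<lambda>k. (cmod (a k))\<^sup>2"] by (simp add: sums_unique2)
qed

text \<open>The bounds of the definition pass from finitely supported sequences to all of \<open>ell2\<close> by density.
  Completeness is needed for the synthesis operator to be onto.\<close>

lemma AO_basis_if_AOB:
  fixes x :: "nat \<Rightarrow> 'a::chilbert_space"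
  assumes "complete_seq x" "AOB x"
  shows "AO_basis x"
proof -
  obtain c C :: "nat \<Rightarrow> real" where pos: "\<And>N. c N > 0" "\<And>N. C N > 0"
    and low: "\<And>N F a. finite F \<Longrightarrow> F \<subseteq> {N..} \<Longrightarrow>
      c N * (\<Sum>n\<in>F. (cmod (a n))\<^sup>2) \<le> (norm (\<Sum>n\<in>F. a n *\<^sub>C x n))\<^sup>2"
    and up: "\<And>N F a. finite F \<Longrightarrow> F \<subseteq> {N..} \<Longrightarrow>
      (norm (\<Sum>n\<in>F. a n *\<^sub>C x n))\<^sup>2 \<le> C N * (\<Sum>n\<in>F. (cmod (a n))\<^sup>2)"
    and lim: "c \<longlonglongrightarrow> 1" "C \<longlonglongrightarrow> 1"
    by (rule AOB_finite_sums[OF assms(2)]) blast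
  have "\<exists>A. bounded_op A \<and> (\<forall>n. A (ell2_basis n) = x n)"
    by (rule synthesis_op_exists[OF less_imp_le[OF pos(2)[of 0]]]) (rule up, auto)
  then obtain A where A: "bounded_op A" "\<And>n. A (ell2_basis n) = x n" by blast
  have bounds: "c N * (norm a)\<^sup>2 \<le> (norm (A a))\<^sup>2 \<and> (norm (A a))\<^sup>2 \<le> C N * (norm a)\<^sup>2"
    if a: "a \<in> tail_space N" for N a
  proof -
    define s where "s m = (\<Sum>n<m. (cmod (coord a n))\<^sup>2)" for m
    have s: "s \<longlonglongrightarrow> (norm a)\<^sup>2"
      using sums_norm_ell2[of a] unfolding sums_def s_def .
    have A_lim: "(\<lambda>m. (norm (A (head m a)))\<^sup>2) \<longlonglongrightarrow> (norm (A a))\<^sup>2"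
      by (intro tendsto_intros bounded_op_tendsto[OF A(1)] head_tendsto)
    have 1: "s m = (\<Sum>n\<in>{N..<m}. (cmod (coord a n))\<^sup>2)" for m
      unfolding s_def
      by (rule sum.mono_neutral_right) (use a in \<open>auto simp: tail_space_def\<close>)
    have 2: "A (head m a) = (\<Sum>n\<in>{N..<m}. coord a n *\<^sub>C x n)" for m
      unfolding op_head[OF A(1)] A(2)
      by (rule sum.mono_neutral_right) (use a in \<open>auto simp: tail_space_def\<close>)
    have "c N * s m \<le> (norm (A (head m a)))\<^sup>2" for m
      unfolding 1 2 by (rule low) auto
    moreover have "(norm (A (head m a)))\<^sup>2 \<le> C N * s m" for m
      unfolding 1 2 by (rule up) auto
    ultimately show ?thesis
      using LIMSEQ_le[OF tendsto_mult[OF tendsto_const s] A_lim, of "c N"]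
        LIMSEQ_le[OF A_lim tendsto_mult[OF tendsto_const s], of "C N"] by blast
  qed
  have inv_bound: "(norm a)\<^sup>2 \<le> inverse (c N) * (norm (A a))\<^sup>2" if "a \<in> tail_space N" for N a
    using bounds[OF that] pos(1)[of N] by (simp add: field_simps)
  have "invertible_op A"
  proof (rule invertible_op_if_bounded_below[OF A(1)])
    show "sqrt (inverse (c 0)) > 0" using pos by simp
    show "norm a \<le> sqrt (inverse (c 0)) * norm (A a)" for a
    proof (rule power2_le_imp_le)
      have "a \<in> tail_space 0" by (simp add: tail_space_def)
      then show "(norm a)\<^sup>2 \<le> (sqrt (inverse (c 0)) * norm (A a))\<^sup>2"
        using inv_bound[of a 0] less_imp_le[OF pos(1)[of 0]] by (simp add: power_mult_distrib)
    qed (use less_imp_le[OF pos(1)[of 0]] in simp)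
    show "f = 0" if "\<And>n. cinner f (A (ell2_basis n)) = 0" for f
      using complete_seq_orth_zero[OF assms(1)] that by (simp add: A(2))
  qed
  moreover have "asymp_isometric A"
  proof (rule asymp_isometricI_constants[OF _ inv_bound lim(2)])
    show "(\<lambda>N. inverse (c N)) \<longlonglongrightarrow> 1"
      using tendsto_inverse[OF lim(1)] by simp
  qed (use bounds in auto)
  ultimately show ?thesis
    by (intro AO_basisI[of A] A(2))
qed

lemma AOB_if_AO_basis:
  fixes x :: "nat \<Rightarrow> 'a::complex_inner"
  assumes "AO_basis x"
  shows "AOB x"
proof -
  obtain A where A: "invertible_op A" "\<And>n. A (ell2_basis n) = x n" "asymp_isometric A"
    using assms unfolding AO_basis_def by blast
  then have bA: "bounded_op A" by (simp add: invertible_op_def)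
  obtain C C' where C: "\<And>N. C N > 0" "\<And>N. C' N > 0"
    "\<And>N a. a \<in> tail_space N \<Longrightarrow> (norm (A a))\<^sup>2 \<le> C N * (norm a)\<^sup>2"
    "\<And>N a. a \<in> tail_space N \<Longrightarrow> (norm a)\<^sup>2 \<le> C' N * (norm (A a))\<^sup>2"
    "C \<longlonglongrightarrow> 1" "C' \<longlonglongrightarrow> 1"
    using asymp_isometric_constants[OF A(1,3)] by blast
  have "inverse (C' N) * (\<Sum>n | n \<ge> N \<and> a n \<noteq> 0. (cmod (a n))\<^sup>2)
        \<le> (norm (\<Sum>n | n \<ge> N \<and> a n \<noteq> 0. a n *\<^sub>C x n))\<^sup>2 \<and>
      (norm (\<Sum>n | n \<ge> N \<and> a n \<noteq> 0. a n *\<^sub>C x n))\<^sup>2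
        \<le> C N * (\<Sum>n | n \<ge> N \<and> a n \<noteq> 0. (cmod (a n))\<^sup>2)"
    if "finite {n. a n \<noteq> 0}" for N and a :: "nat \<Rightarrow> complex"
  proof -
    define F where "F = {n. n \<ge> N \<and> a n \<noteq> 0}"
    have F: "finite F"
      by (rule finite_subset[OF _ that]) (auto simp: F_def)
    define v where "v = (\<Sum>n\<in>F. a n *\<^sub>C ell2_basis n)"
    have v: "v \<in> tail_space N"
      by (simp add: tail_space_def v_def norm_sq_finite_combination(2)[OF F]) (simp add: F_def)
    have "A v = (\<Sum>n\<in>F. a n *\<^sub>C x n)"
      by (simp add: v_def bounded_op_sum[OF bA] bounded_op_scaleC[OF bA] A(2))
    moreover have "(norm v)\<^sup>2 = (\<Sum>n\<in>F. (cmod (a n))\<^sup>2)"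
      unfolding v_def by (rule norm_sq_finite_combination(1)[OF F])
    ultimately show ?thesis
      using C(3)[OF v] C(4)[OF v] C(2)[of N] unfolding F_def[symmetric]
      by (simp add: field_simps)
  qed
  moreover have "(\<lambda>N. inverse (C' N)) \<longlonglongrightarrow> 1"
    using tendsto_inverse[OF C(6)] by simp
  ultimately show ?thesis
    unfolding AOB_def using C(1,2,5)
    by (intro exI[of _ "\<lambda>N. inverse (C' N)"] exI[of _ C]) auto
qed


subsection \<open>Coordinate and interpolation operators\<close>

lemma AO_basis_iff_UK:
  fixes x :: "nat \<Rightarrow> 'a::chilbert_space"
  shows "AO_basis x \<longleftrightarrow> (\<exists>U\<in>UK. \<forall>n. U (x n) = ell2_basis n)"
proof
  assume "AO_basis x"
  then obtain A where A: "invertible_op A" "\<And>n. A (ell2_basis n) = x n" "asymp_isometric A"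
    unfolding AO_basis_def by blast
  obtain U where bA: "bounded_op A" and U: "bounded_op U" "\<And>a. U (A a) = a" "\<And>f. A (U f) = f"
    by (rule invertible_opE[OF A(1)]) blast
  have "U (x n) = ell2_basis n" for n
    using U(2)[of "ell2_basis n"] by (simp add: A(2))
  with UK_if_asymp_isometric[OF bA U A(3)]
  show "\<exists>U\<in>UK. \<forall>n. U (x n) = ell2_basis n" by blast
next
  assume "\<exists>U\<in>UK. \<forall>n. U (x n) = ell2_basis n"
  then obtain U where U: "U \<in> UK" "\<And>n. U (x n) = ell2_basis n" by blast
  then have "invertible_op U" by (simp add: UK_def)
  then obtain A where A: "bounded_op A" "\<And>f. A (U f) = f" "\<And>a. U (A a) = a" and bU: "bounded_op U"
    by (rule invertible_opE) blast
  have "A (ell2_basis n) = x n" for n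
    using A(2)[of "x n"] by (simp add: U(2))
  then show "AO_basis x"
    by (rule AO_basisI[OF invertible_opI_inverse[OF A(1) bU A(3,2)]])
      (rule asymp_isometric_if_UK[OF A(1,3,2) U(1)])
qed

text \<open>The interpolation operator sends \<open>y n\<close> to the \<open>n\<close>-th unit vector, so it is the coordinate
  operator of \<open>AO_basis_iff_UK\<close> for the sequence \<open>y\<close>.\<close>

lemma interpolation_UK_iff:
  fixes x y :: "nat \<Rightarrow> 'a::chilbert_space"
  assumes xy: "\<And>l n. cinner (x l) (y n) = (if l = n then 1 else 0)"
  shows "(\<exists>J\<in>UK. \<forall>f. coord (J f) = interpolation_map x f) \<longleftrightarrow> AO_basis y"
proof
  have yx: "cinner (y l) (x n) = (if l = n then 1 else 0)" for l n
    using cinner_commute[of "y l" "x n"] xy[of n l] by simp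
  show "AO_basis y" if "\<exists>J\<in>UK. \<forall>f. coord (J f) = interpolation_map x f"
  proof -
    obtain J where J: "J \<in> UK" "\<And>f. coord (J f) = interpolation_map x f"
      using \<open>\<exists>J\<in>UK. \<forall>f. coord (J f) = interpolation_map x f\<close> by blast
    have "J (y n) = ell2_basis n" for n
      by (rule ell2_eqI) (simp add: J(2) interpolation_map_def yx coord_basis)
    then show ?thesis
      unfolding AO_basis_iff_UK using J(1) by blast
  qed
  show "\<exists>J\<in>UK. \<forall>f. coord (J f) = interpolation_map x f" if y: "AO_basis y"
  proof -
    obtain B A where BA: "invertible_op B" "invertible_op A" "\<And>n. A (ell2_basis n) = x n"
      "asymp_isometric B" "\<And>b. adj A (B b) = b" "\<And>f. B (adj A f) = f"
      using AO_basis_dual_pair[OF y yx] by metis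
    have b: "bounded_op A" "bounded_op B"
      using BA(1,2) by (simp_all add: invertible_op_def)
    have "adj A \<in> UK"
      by (rule UK_if_asymp_isometric[OF b(2) bounded_op_adj[OF b(1)] BA(5,6,4)])
    moreover have "coord (adj A f) = interpolation_map x f" for f
      by (simp add: fun_eq_iff coord_adj[OF b(1)] BA(3) interpolation_map_def)
    ultimately show ?thesis by blast
  qed
qed


subsection \<open>Restrictions to tails\<close>

lemma onorm_on_bound:
  assumes "\<And>f. f \<in> S \<Longrightarrow> norm (T f) \<le> M * norm f" "f \<in> S"
  shows "norm (T f) \<le> onorm_on S T * norm f"
proof (cases "f = 0")
  case True
  then show ?thesis using assms(1)[OF assms(2)] by simp
next
  case False
  have "norm (T g) / norm g \<le> max M 0" if "g \<in> S" for g
  proof (cases "g = 0")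
    case False
    then show ?thesis using assms(1)[OF that] by (simp add: pos_divide_le_eq le_max_iff_disj)
  qed simp
  then have "bdd_above ((\<lambda>g. norm (T g) / norm g) ` S)"
    by (intro bdd_aboveI[of _ "max M 0"]) auto
  then have "norm (T f) / norm f \<le> onorm_on S T"
    unfolding onorm_on_def by (rule cSUP_upper[OF assms(2)])
  then show ?thesis
    using False by (simp add: pos_divide_le_eq)
qed

lemma onorm_on_le:
  assumes "\<And>f. f \<in> S \<Longrightarrow> norm (T f) \<le> M * norm f" "S \<noteq> {}" "M \<ge> 0"
  shows "onorm_on S T \<le> M"
  unfolding onorm_on_def
proof (rule cSUP_least[OF assms(2)])
  fix f assume "f \<in> S"
  then show "norm (T f) / norm f \<le> M"
    using assms(1)[of f] assms(3) by (cases "f = 0") (simp_all add: pos_divide_le_eq)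
qed

text \<open>Besides the upper bound, one nonzero vector in \<open>S N\<close> that is hardly shortened keeps the norm of
  the restriction from falling much below 1.\<close>

lemma onorm_on_tendsto_one:
  assumes "\<And>e. e > 0 \<Longrightarrow> \<exists>M. \<forall>N\<ge>M. (\<forall>f\<in>S N. norm (T N f) \<le> (1 + e) * norm f) \<and>
    (\<exists>f\<in>S N. f \<noteq> 0 \<and> norm f \<le> (1 + e) * norm (T N f))"
  shows "(\<lambda>N. onorm_on (S N) (T N)) \<longlonglongrightarrow> 1"
proof (rule metric_LIMSEQ_I)
  fix e :: real assume "e > 0"
  define d where "d = e / 2"
  have d: "d > 0" "d < e" using \<open>e > 0\<close> by (simp_all add: d_def)
  obtain M where M: "\<And>N. N \<ge> M \<Longrightarrow> (\<forall>f\<in>S N. norm (T N f) \<le> (1 + d) * norm f) \<and>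
      (\<exists>f\<in>S N. f \<noteq> 0 \<and> norm f \<le> (1 + d) * norm (T N f))"
    using assms[OF d(1)] by blast
  have "dist (onorm_on (S N) (T N)) 1 < e" if N: "N \<ge> M" for N
  proof -
    have up: "\<And>f. f \<in> S N \<Longrightarrow> norm (T N f) \<le> (1 + d) * norm f"
      using M[OF N] by blast
    obtain f where f: "f \<in> S N" "f \<noteq> 0" "norm f \<le> (1 + d) * norm (T N f)"
      using M[OF N] by blast
    have 1: "onorm_on (S N) (T N) \<le> 1 + d"
      by (rule onorm_on_le[OF up]) (use f(1) d in auto)
    have "norm f \<le> (1 + d) * (onorm_on (S N) (T N) * norm f)"
      using f(3) mult_left_mono[OF onorm_on_bound[OF up f(1)], of "1 + d"] d(1) by linarith
    then have "1 * norm f \<le> ((1 + d) * onorm_on (S N) (T N)) * norm f"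
      by (simp add: mult.assoc)
    then have 2: "1 \<le> (1 + d) * onorm_on (S N) (T N)"
      using f(2) by (simp only: mult_le_cancel_right) auto
    have "1 - d < onorm_on (S N) (T N) \<or> 1 - d = onorm_on (S N) (T N)"
    proof (rule ccontr)
      assume "\<not> ?thesis"
      then have "onorm_on (S N) (T N) < 1 - d" by linarith
      then have "(1 + d) * onorm_on (S N) (T N) < (1 + d) * (1 - d)"
        using d(1) by (intro mult_strict_left_mono) auto
      also have "\<dots> = 1 - d * d" by (simp add: algebra_simps)
      also have "\<dots> \<le> 1" by simp
      finally show False using 2 by linarith
    qed
    with 1 d show ?thesis by (auto simp: dist_real_def)
  qed
  then show "\<exists>M. \<forall>N\<ge>M. dist (onorm_on (S N) (T N)) 1 < e" by blast
qed

lemma closed_span_basis_tail: "closed_span (ell2_basis ` {N..}) = tail_space N"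
proof -
  have "invertible_op (\<lambda>a::ell2. a)"
    by (rule invertible_opI_inverse[OF bounded_op_id bounded_op_id refl refl])
  from closed_span_tail[OF this refl] show ?thesis by simp
qed

text \<open>With \<open>A = U\<inverse>\<close>, the closed spans of the tails are the images under \<open>A\<close> of the spaces
  \<open>tail_space N\<close>, and the inverse of the restriction of \<open>U\<close> is the restriction of \<open>A\<close>. Thus the two
  norms are the optimal constants, up to squares, in the definition of \<open>asymp_isometric A\<close>.\<close>

lemma AO_basis_iff_restriction_norms:
  fixes x :: "nat \<Rightarrow> 'a::complex_inner"
  shows "AO_basis x \<longleftrightarrow> (\<exists>U :: 'a \<Rightarrow> ell2. invertible_op U \<and> (\<forall>n. U (x n) = ell2_basis n) \<and>
       (\<lambda>N. onorm_on (closed_span (x ` {N..})) U) \<longlonglongrightarrow> 1 \<and>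
       (\<lambda>N. onorm_on (closed_span (ell2_basis ` {N..}))
              (inv_into (closed_span (x ` {N..})) U)) \<longlonglongrightarrow> 1)"
    (is "_ \<longleftrightarrow> (\<exists>U. ?P U)")
proof -
  have inverse_restriction:
    "onorm_on (closed_span (ell2_basis ` {N..})) (inv_into (closed_span (x ` {N..})) U)
      = onorm_on (tail_space N) A"
    if A: "invertible_op A" "\<And>n. A (ell2_basis n) = x n" and U: "\<And>a. U (A a) = a" for A U N
    unfolding closed_span_basis_tail closed_span_tail[OF A] onorm_on_def
  proof (rule SUP_cong)
    fix a assume a: "a \<in> tail_space N"
    have "inj_on U (A ` tail_space N)"
      by (rule inj_onI) (auto simp: U)
    then have "inv_into (A ` tail_space N) U (U (A a)) = A a"
      by (rule inv_into_f_f) (use a in blast)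
    then show "norm (inv_into (A ` tail_space N) U a) / norm a = norm (A a) / norm a"
      by (simp add: U)
  qed simp
  show ?thesis
  proof
    assume "AO_basis x"
    then obtain A where A: "invertible_op A" "\<And>n. A (ell2_basis n) = x n" "asymp_isometric A"
      unfolding AO_basis_def by blast
    obtain U where bA: "bounded_op A" and U: "bounded_op U" "\<And>a. U (A a) = a" "\<And>f. A (U f) = f"
      by (rule invertible_opE[OF A(1)]) blast
    have asy: "\<exists>M. \<forall>N\<ge>M. \<forall>a\<in>tail_space N. norm (A a) \<le> (1 + e) * norm a \<and> norm a \<le> (1 + e) * norm (A a)"
      if e: "e > 0" for e
    proof -
      obtain M where M: "\<And>a. a \<in> tail_space M \<Longrightarrow>
          (norm (A a))\<^sup>2 \<le> (1 + e) * (norm a)\<^sup>2 \<and> (norm a)\<^sup>2 \<le> (1 + e) * (norm (A a))\<^sup>2"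
        using A(3) e unfolding asymp_isometric_def by blast
      have root: "s \<le> (1 + e) * t" if "s\<^sup>2 \<le> (1 + e) * t\<^sup>2" "t \<ge> 0" for s t :: real
      proof (rule power2_le_imp_le)
        have "(1 + e) * 1 \<le> (1 + e) * (1 + e)"
          using e by (intro mult_left_mono) auto
        then have "(1 + e) * t\<^sup>2 \<le> ((1 + e) * (1 + e)) * t\<^sup>2"
          by (intro mult_right_mono) auto
        with that(1) show "s\<^sup>2 \<le> ((1 + e) * t)\<^sup>2"
          by (simp add: power_mult_distrib power2_eq_square[of "1 + e"])
      qed (use that e in simp)
      have "norm (A a) \<le> (1 + e) * norm a \<and> norm a \<le> (1 + e) * norm (A a)"
        if "N \<ge> M" "a \<in> tail_space N" for N a
        using M[of a] tail_space_mono[OF that(1)] that(2) root by auto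
      then show ?thesis by blast
    qed
    have Ae: "A (ell2_basis N) \<noteq> 0" for N
      using U(2)[of "ell2_basis N"] bounded_op_zero[OF U(1)] norm_basis[of N] by force
    have e0: "ell2_basis N \<noteq> 0" for N
      using norm_basis[of N] by force
    have "(\<lambda>N. onorm_on (A ` tail_space N) U) \<longlonglongrightarrow> 1"
    proof (rule onorm_on_tendsto_one)
      fix e :: real assume "e > 0"
      obtain M where M: "\<And>N a. N \<ge> M \<Longrightarrow> a \<in> tail_space N \<Longrightarrow>
          norm (A a) \<le> (1 + e) * norm a \<and> norm a \<le> (1 + e) * norm (A a)"
        using asy[OF \<open>e > 0\<close>] by blast
      show "\<exists>M. \<forall>N\<ge>M. (\<forall>f\<in>A ` tail_space N. norm (U f) \<le> (1 + e) * norm f) \<and>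
          (\<exists>f\<in>A ` tail_space N. f \<noteq> 0 \<and> norm f \<le> (1 + e) * norm (U f))"
      proof (intro exI[of _ M] allI impI conjI)
        fix N assume N: "N \<ge> M"
        show "\<forall>f\<in>A ` tail_space N. norm (U f) \<le> (1 + e) * norm f"
          using M[OF N] by (auto simp: U)
        show "\<exists>f\<in>A ` tail_space N. f \<noteq> 0 \<and> norm f \<le> (1 + e) * norm (U f)"
          using M[OF N basis_in_tail_space[OF order_refl]] Ae basis_in_tail_space[of N N]
          by (intro bexI[of _ "A (ell2_basis N)"]) (auto simp: U)
      qed
    qed
    moreover have "(\<lambda>N. onorm_on (tail_space N) A) \<longlonglongrightarrow> 1"
    proof (rule onorm_on_tendsto_one)
      fix e :: real assume "e > 0"
      obtain M where M: "\<And>N a. N \<ge> M \<Longrightarrow> a \<in> tail_space N \<Longrightarrow>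
          norm (A a) \<le> (1 + e) * norm a \<and> norm a \<le> (1 + e) * norm (A a)"
        using asy[OF \<open>e > 0\<close>] by blast
      show "\<exists>M. \<forall>N\<ge>M. (\<forall>f\<in>tail_space N. norm (A f) \<le> (1 + e) * norm f) \<and>
          (\<exists>f\<in>tail_space N. f \<noteq> 0 \<and> norm f \<le> (1 + e) * norm (A f))"
      proof (intro exI[of _ M] allI impI conjI)
        fix N assume N: "N \<ge> M"
        show "\<forall>f\<in>tail_space N. norm (A f) \<le> (1 + e) * norm f"
          using M[OF N] by auto
        show "\<exists>f\<in>tail_space N. f \<noteq> 0 \<and> norm f \<le> (1 + e) * norm (A f)"
          using M[OF N basis_in_tail_space[OF order_refl]] e0 basis_in_tail_space[of N N]
          by (intro bexI[of _ "ell2_basis N"]) auto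
      qed
    qed
    moreover have "invertible_op U"
      by (rule invertible_opI_inverse[OF U(1) bA U(3) U(2)])
    moreover have "U (x n) = ell2_basis n" for n
      using U(2)[of "ell2_basis n"] by (simp add: A(2))
    ultimately have "?P U"
      unfolding inverse_restriction[OF A(1,2) U(2)] unfolding closed_span_tail[OF A(1,2)] by blast
    then show "\<exists>U. ?P U" by blast
  next
    assume "\<exists>U. ?P U"
    then obtain U where PU: "?P U" by blast
    then have U: "invertible_op U" "\<And>n. U (x n) = ell2_basis n" by auto
    obtain A where bU: "bounded_op U" and bA: "bounded_op A" "\<And>f. A (U f) = f" "\<And>a. U (A a) = a"
      by (rule invertible_opE[OF U(1)]) blast
    have A: "invertible_op A" "\<And>n. A (ell2_basis n) = x n"
      using invertible_opI_inverse[OF bA(1) bU bA(3,2)] bA(2)[of "x _"] by (auto simp: U(2))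
    define r s where "r N = onorm_on (A ` tail_space N) U" and "s N = onorm_on (tail_space N) A" for N
    have "r \<longlonglongrightarrow> 1" "s \<longlonglongrightarrow> 1"
      using PU unfolding inverse_restriction[OF A bA(3)] unfolding closed_span_tail[OF A] r_def s_def
      by blast+
    then have lim: "(\<lambda>N. (r N)\<^sup>2) \<longlonglongrightarrow> 1" "(\<lambda>N. (s N)\<^sup>2) \<longlonglongrightarrow> 1"
      using tendsto_power[of r 1 sequentially 2] tendsto_power[of s 1 sequentially 2] by simp_all
    obtain M where M: "\<And>a. norm (A a) \<le> M * norm a"
      using bounded_op_bound[OF bA(1)] by blast
    obtain M' where M': "\<And>f. norm (U f) \<le> M' * norm f"
      using bounded_op_bound[OF bU] by blast
    have "asymp_isometric A"
    proof (rule asymp_isometricI_constants[OF _ _ lim(2,1)])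
      fix N a assume a: "a \<in> tail_space N"
      have "norm (A a) \<le> s N * norm a"
        unfolding s_def by (rule onorm_on_bound[OF M a])
      then show "(norm (A a))\<^sup>2 \<le> (s N)\<^sup>2 * (norm a)\<^sup>2"
        by (metis norm_ge_zero power_mono power_mult_distrib)
      have "norm (U (A a)) \<le> r N * norm (A a)"
        unfolding r_def by (rule onorm_on_bound[OF M']) (use a in blast)
      then have "norm a \<le> r N * norm (A a)"
        by (simp add: bA)
      then show "(norm a)\<^sup>2 \<le> (r N)\<^sup>2 * (norm (A a))\<^sup>2"
        by (metis norm_ge_zero power_mono power_mult_distrib)
    qed
    with A show "AO_basis x"
      by (intro AO_basisI)
  qed
qed


subsection \<open>Frame and Bessel inequalities\<close>

lemma sums_of_squares_tail:
  shows "(\<lambda>n. (cmod (coord a n))\<^sup>2) summable_on {N..}"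
    and "(\<Sum>\<^sub>\<infinity>n\<in>{N..}. (cmod (coord a n))\<^sup>2) = (norm (tail N a))\<^sup>2"
proof -
  have "((\<lambda>n. (cmod (coord (tail N a) n))\<^sup>2) has_sum (norm (tail N a))\<^sup>2) UNIV"
    using summable_coord[of "tail N a"] sums_norm_ell2[of "tail N a"]
    by (intro norm_summable_imp_has_sum) simp_all
  also have "?this \<longleftrightarrow> ((\<lambda>n. (cmod (coord a n))\<^sup>2) has_sum (norm (tail N a))\<^sup>2) {N..}"
    by (rule has_sum_cong_neutral) (auto simp: coord_tail)
  finally have hs: "((\<lambda>n. (cmod (coord a n))\<^sup>2) has_sum (norm (tail N a))\<^sup>2) {N..}" .
  show "(\<lambda>n. (cmod (coord a n))\<^sup>2) summable_on {N..}"
    using hs by (rule has_sum_imp_summable)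
  show "(\<Sum>\<^sub>\<infinity>n\<in>{N..}. (cmod (coord a n))\<^sup>2) = (norm (tail N a))\<^sup>2"
    using hs by (rule infsumI)
qed

text \<open>The Bessel inequality bounds the analysis operator, and this one bounds its adjoint.\<close>

lemma synthesis_bound_if_bessel:
  fixes x :: "nat \<Rightarrow> 'a::complex_inner"
  assumes F: "finite F" and C: "C \<ge> 0"
    and bessel: "\<And>f. (\<Sum>n\<in>F. (cmod (cinner f (x n)))\<^sup>2) \<le> C * (norm f)\<^sup>2"
  shows "(norm (\<Sum>n\<in>F. a n *\<^sub>C x n))\<^sup>2 \<le> C * (\<Sum>n\<in>F. (cmod (a n))\<^sup>2)"
proof (cases "(\<Sum>n\<in>F. a n *\<^sub>C x n) = 0")
  case False
  define f where "f = (\<Sum>n\<in>F. a n *\<^sub>C x n)"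
  have "(norm f)\<^sup>2 = cmod (cinner f f)"
    by (simp add: cinner_self norm_power)
  also have "cinner f f = (\<Sum>n\<in>F. cnj (a n) * cinner f (x n))"
    by (subst (2) f_def) (simp add: cinner_sum_right cinner_scaleC_right)
  also have "cmod \<dots> \<le> (\<Sum>n\<in>F. cmod (a n) * cmod (cinner f (x n)))"
    by (rule sum_norm_le) (simp add: norm_mult)
  finally have "((norm f)\<^sup>2)\<^sup>2 \<le> (\<Sum>n\<in>F. cmod (a n) * cmod (cinner f (x n)))\<^sup>2"
    by (rule power_mono) simp
  also have "\<dots> \<le> (\<Sum>n\<in>F. (cmod (a n))\<^sup>2) * (\<Sum>n\<in>F. (cmod (cinner f (x n)))\<^sup>2)"
    by (rule Cauchy_Schwarz_ineq_sum)
  also have "\<dots> \<le> (\<Sum>n\<in>F. (cmod (a n))\<^sup>2) * (C * (norm f)\<^sup>2)"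
    by (intro mult_left_mono bessel sum_nonneg) simp
  finally have "(norm f)\<^sup>2 * (norm f)\<^sup>2 \<le> (C * (\<Sum>n\<in>F. (cmod (a n))\<^sup>2)) * (norm f)\<^sup>2"
    by (simp only: power2_eq_square[of "(norm f)\<^sup>2"] ac_simps)
  moreover have "(norm f)\<^sup>2 > 0"
    using False by (simp add: f_def)
  ultimately have "(norm f)\<^sup>2 \<le> C * (\<Sum>n\<in>F. (cmod (a n))\<^sup>2)"
    by (rule mult_right_le_imp_le)
  then show ?thesis by (simp only: f_def)
qed (simp add: C sum_nonneg)

lemma bessel_synthesis_op:
  fixes x :: "nat \<Rightarrow> 'a::chilbert_space"
  assumes C: "C \<ge> 0" and sm: "\<And>f. (\<lambda>n. (cmod (cinner f (x n)))\<^sup>2) summable_on {0..}"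
    and bd: "\<And>f. (\<Sum>\<^sub>\<infinity>n\<in>{0..}. (cmod (cinner f (x n)))\<^sup>2) \<le> C * (norm f)\<^sup>2"
  shows "\<exists>A. bounded_op A \<and> (\<forall>n. A (ell2_basis n) = x n)"
proof (rule synthesis_op_exists[OF C])
  fix F :: "nat set" and a :: "nat \<Rightarrow> complex"
  assume F: "finite F"
  show "(norm (\<Sum>n\<in>F. a n *\<^sub>C x n))\<^sup>2 \<le> C * (\<Sum>n\<in>F. (cmod (a n))\<^sup>2)"
  proof (rule synthesis_bound_if_bessel[OF F C])
    show "(\<Sum>n\<in>F. (cmod (cinner f (x n)))\<^sup>2) \<le> C * (norm f)\<^sup>2" for f
      using finite_sum_le_infsum[OF sm F, of f] bd[of f] by simp
  qed
qed

text \<open>For the synthesis operator \<open>A\<close> of a frame, \<open>A \<circ> adj A\<close> is coercive, so \<open>A\<close> is onto;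
  biorthogonality makes \<open>A\<close> injective. Hence the analysis operator \<open>adj A\<close> is invertible, and its
  inverse is the synthesis operator of the biorthogonal sequence, for which the two-sided
  inequality on the orthogonal complements is the two-sided bound on the tails.\<close>

lemma AO_basis_biorthogonal_iff_frame_bounds:
  fixes x y :: "nat \<Rightarrow> 'a::chilbert_space"
  assumes xy: "\<And>l n. cinner (x l) (y n) = (if l = n then 1 else 0)"
  shows "AO_basis y \<longleftrightarrow> (\<exists>C C' :: nat \<Rightarrow> real.
       (\<forall>N. C N > 0 \<and> C' N > 0 \<and>
         (\<forall>f \<in> orth_complement (closed_span (x ` {..<N})).
            (\<lambda>n. (cmod (cinner f (x n)))\<^sup>2) summable_on {N..} \<and>
            inverse (C' N) * (norm f)\<^sup>2 \<le> (\<Sum>\<^sub>\<infinity>n\<in>{N..}. (cmod (cinner f (x n)))\<^sup>2) \<and>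
            (\<Sum>\<^sub>\<infinity>n\<in>{N..}. (cmod (cinner f (x n)))\<^sup>2) \<le> C N * (norm f)\<^sup>2)) \<and>
       C \<longlonglongrightarrow> 1 \<and> C' \<longlonglongrightarrow> 1)"
    (is "_ \<longleftrightarrow> ?frame")
proof
  have yx: "cinner (y l) (x n) = (if l = n then 1 else 0)" for l n
    using cinner_commute[of "y l" "x n"] xy[of n l] by simp
  show ?frame if y: "AO_basis y"
  proof -
    obtain A B where A: "invertible_op A" "\<And>n. A (ell2_basis n) = x n"
      and B: "invertible_op B" "asymp_isometric B" and BA: "\<And>f. B (adj A f) = f"
      by (rule AO_basis_dual_pair[OF y yx]) blast
    have bA: "bounded_op A"
      using A(1) by (simp add: invertible_op_def)
    obtain C C' where C: "\<And>N. C N > 0" "\<And>N. C' N > 0"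
      "\<And>N a. a \<in> tail_space N \<Longrightarrow> (norm (B a))\<^sup>2 \<le> C N * (norm a)\<^sup>2"
      "\<And>N a. a \<in> tail_space N \<Longrightarrow> (norm a)\<^sup>2 \<le> C' N * (norm (B a))\<^sup>2"
      "C \<longlonglongrightarrow> 1" "C' \<longlonglongrightarrow> 1"
      by (rule asymp_isometric_constants[OF B]) blast
    have "(\<lambda>n. (cmod (cinner f (x n)))\<^sup>2) summable_on {N..} \<and>
            inverse (C N) * (norm f)\<^sup>2 \<le> (\<Sum>\<^sub>\<infinity>n\<in>{N..}. (cmod (cinner f (x n)))\<^sup>2) \<and>
            (\<Sum>\<^sub>\<infinity>n\<in>{N..}. (cmod (cinner f (x n)))\<^sup>2) \<le> C' N * (norm f)\<^sup>2"
      if f: "f \<in> orth_complement (closed_span (x ` {..<N}))" for N f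
    proof -
      have coord: "cinner f (x n) = coord (adj A f) n" for n
        by (simp add: coord_adj[OF bA] A(2))
      have tl: "adj A f \<in> tail_space N"
        using f unfolding orth_complement_closed_span by (auto simp: tail_space_def coord[symmetric])
      show ?thesis
        unfolding coord sums_of_squares_tail(2) tail_eq_self[OF tl]
        using sums_of_squares_tail(1) C(1)[of N] C(3)[OF tl] C(4)[OF tl]
        by (simp add: BA field_simps)
    qed
    with C show ?thesis
      by (intro exI[of _ C'] exI[of _ C]) blast
  qed
  show "AO_basis y" if ?frame
  proof -
    obtain C C' :: "nat \<Rightarrow> real" where C: "\<forall>N. C N > 0 \<and> C' N > 0 \<and>
         (\<forall>f \<in> orth_complement (closed_span (x ` {..<N})).
            (\<lambda>n. (cmod (cinner f (x n)))\<^sup>2) summable_on {N..} \<and>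
            inverse (C' N) * (norm f)\<^sup>2 \<le> (\<Sum>\<^sub>\<infinity>n\<in>{N..}. (cmod (cinner f (x n)))\<^sup>2) \<and>
            (\<Sum>\<^sub>\<infinity>n\<in>{N..}. (cmod (cinner f (x n)))\<^sup>2) \<le> C N * (norm f)\<^sup>2)"
      and lim: "C \<longlonglongrightarrow> 1" "C' \<longlonglongrightarrow> 1"
      using \<open>?frame\<close> by (elim exE conjE)
    have pos: "C N > 0" "C' N > 0" for N
      using C by simp_all
    have all: "f \<in> orth_complement (closed_span (x ` {..<0}))" for f
      unfolding orth_complement_closed_span by simp
    note C0 = C[THEN spec, of 0, THEN conjunct2, THEN conjunct2, THEN bspec, OF all]
    have "\<exists>A. bounded_op A \<and> (\<forall>n. A (ell2_basis n) = x n)"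
      by (rule bessel_synthesis_op[of "C 0"]) (use C0 less_imp_le[OF pos(1)] in blast)+
    then obtain A where A: "bounded_op A" "\<And>n. A (ell2_basis n) = x n" by blast
    have coord: "cinner f (x n) = coord (adj A f) n" for f n
      by (simp add: coord_adj[OF A(1)] A(2))
    have bJ: "bounded_op (adj A)" by (rule bounded_op_adj[OF A(1)])
    have sq0: "(\<Sum>\<^sub>\<infinity>n\<in>{0..}. (cmod (cinner f (x n)))\<^sup>2) = (norm (adj A f))\<^sup>2" for f
      unfolding coord sums_of_squares_tail(2) by (simp add: tail_eq_self tail_space_def)
    have low: "inverse (C' 0) * (norm f)\<^sup>2 \<le> (norm (adj A f))\<^sup>2" for f
      using C0[of f] unfolding sq0 by blast
    have "invertible_op (\<lambda>f. A (adj A f))"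
    proof (rule coercive_invertible)
      show "bounded_op (\<lambda>f. A (adj A f))" by (rule bounded_op_compose[OF A(1) bJ])
      show "inverse (C' 0) > 0" using pos by simp
      show "inverse (C' 0) * (norm f)\<^sup>2 \<le> inner (A (adj A f)) f" for f
        using low[of f] by (simp add: inner_adj'[OF A(1)] power2_norm_eq_inner)
    qed
    then obtain R where R: "\<And>f. A (adj A (R f)) = f"
      by (rule invertible_opE) blast
    have Jy: "adj A (y n) = ell2_basis n" for n
      by (rule ell2_eqI) (simp add: coord[symmetric] yx coord_basis)
    have inj: "a = 0" if "A a = 0" for a
    proof (rule ell2_eqI)
      fix n
      have "cinner (ell2_basis n) a = 0"
        using cinner_adj[OF A(1), of "y n" a] that by (simp add: Jy)
      then show "coord a n = coord 0 n"
        using cinner_commute[of a "ell2_basis n"] by (simp add: cinner_basis)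
    qed
    have JR: "adj A (R (A a)) = a" for a
      using inj[of "adj A (R (A a)) - a"] by (simp add: bounded_op_diff[OF A(1)] R)
    have "invertible_op (adj A)"
    proof (rule invertible_opI[OF bJ])
      show "surj (adj A)" by (rule surjI[where f = "\<lambda>a. R (A a)"]) (rule JR)
      show "norm f \<le> sqrt (C' 0) * norm (adj A f)" for f
      proof (rule power2_le_imp_le)
        show "(norm f)\<^sup>2 \<le> (sqrt (C' 0) * norm (adj A f))\<^sup>2"
          using low[of f] pos(2)[of 0] by (simp add: power_mult_distrib field_simps)
      qed (use less_imp_le[OF pos(2)[of 0]] in simp)
    qed
    then obtain B where B: "bounded_op B" "\<And>f. B (adj A f) = f" "\<And>a. adj A (B a) = a"
      by (rule invertible_opE) blast
    have "B (ell2_basis n) = y n" for n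
      using B(2)[of "y n"] by (simp add: Jy)
    moreover have "asymp_isometric B"
    proof (rule asymp_isometricI_constants[OF _ _ lim(2,1)])
      fix N a assume a: "a \<in> tail_space N"
      have "B a \<in> orth_complement (closed_span (x ` {..<N}))"
        unfolding orth_complement_closed_span using a by (auto simp: coord B(3) tail_space_def)
      note CN = C[THEN spec, of N, THEN conjunct2, THEN conjunct2, THEN bspec, OF this]
      have sq: "(\<Sum>\<^sub>\<infinity>n\<in>{N..}. (cmod (cinner (B a) (x n)))\<^sup>2) = (norm a)\<^sup>2"
        unfolding coord sums_of_squares_tail(2) B(3) tail_eq_self[OF a] ..
      show "(norm (B a))\<^sup>2 \<le> C' N * (norm a)\<^sup>2"
        using CN pos(2)[of N] unfolding sq by (simp add: field_simps)
      show "(norm a)\<^sup>2 \<le> C N * (norm (B a))\<^sup>2"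
        using CN unfolding sq by blast
    qed
    moreover have "invertible_op B"
      by (rule invertible_opI_inverse[OF B(1) bJ B(3,2)])
    ultimately show ?thesis
      by (intro AO_basisI[of B])
  qed
qed

text \<open>A bound for \<open>A\<close> on a tail is the same as a bound for the tail of its adjoint.\<close>

lemma tail_adj_bound:
  assumes A: "bounded_op A" and C: "C \<ge> 0"
    and bd: "\<And>a. a \<in> tail_space N \<Longrightarrow> (norm (A a))\<^sup>2 \<le> C * (norm a)\<^sup>2"
  shows "(norm (tail N (adj A f)))\<^sup>2 \<le> C * (norm f)\<^sup>2"
proof -
  define t where "t = tail N (adj A f)"
  have t: "t \<in> tail_space N" "tail N t = t"
    using tail_in_tail_space tail_eq_self by (simp_all add: t_def)
  have "(norm t)\<^sup>2 = inner t (tail N (adj A f))"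
    by (simp add: power2_norm_eq_inner t_def)
  also have "\<dots> = inner (A t) f"
    by (simp add: inner_tail[symmetric] t inner_adj'[OF A])
  also have "\<dots> \<le> norm (A t) * norm f"
    by (rule norm_cauchy_schwarz)
  also have "norm (A t) \<le> sqrt C * norm t"
    by (rule power2_le_imp_le) (use bd[OF t(1)] C in \<open>simp_all add: power_mult_distrib\<close>)
  finally have "(norm t)\<^sup>2 \<le> (sqrt C * norm f) * norm t"
    by (simp add: ac_simps mult_right_mono)
  then have "norm t \<le> sqrt C * norm f"
    by (rule norm_cancel) (use C in simp)
  then have "(norm t)\<^sup>2 \<le> (sqrt C * norm f)\<^sup>2"
    by (rule power_mono) simp
  then show ?thesis
    using C by (simp add: t_def power_mult_distrib)
qed

lemma op_bound_if_tail_adj_bound: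
  assumes A: "bounded_op A" and C: "C \<ge> 0"
    and bd: "\<And>f. (norm (tail N (adj A f)))\<^sup>2 \<le> C * (norm f)\<^sup>2" and a: "a \<in> tail_space N"
  shows "(norm (A a))\<^sup>2 \<le> C * (norm a)\<^sup>2"
proof -
  have "(norm (A a))\<^sup>2 = inner (tail N a) (adj A (A a))"
    by (simp add: power2_norm_eq_inner inner_adj'[OF A] tail_eq_self[OF a])
  also have "\<dots> = inner a (tail N (adj A (A a)))"
    by (rule inner_tail)
  also have "\<dots> \<le> norm a * norm (tail N (adj A (A a)))"
    by (rule norm_cauchy_schwarz)
  also have "\<dots> \<le> norm a * (sqrt C * norm (A a))"
  proof (intro mult_left_mono)
    show "norm (tail N (adj A (A a))) \<le> sqrt C * norm (A a)"
      by (rule power2_le_imp_le) (use bd[of "A a"] C in \<open>simp_all add: power_mult_distrib\<close>)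
  qed simp
  finally have "(norm (A a))\<^sup>2 \<le> (sqrt C * norm a) * norm (A a)"
    by (simp add: ac_simps)
  then have "norm (A a) \<le> sqrt C * norm a"
    by (rule norm_cancel) (use C in simp)
  then have "(norm (A a))\<^sup>2 \<le> (sqrt C * norm a)\<^sup>2"
    by (rule power_mono) simp
  then show ?thesis
    using C by (simp add: power_mult_distrib)
qed

text \<open>Biorthogonality of the images of the unit vectors extends to \<open>adj B \<circ> A = I\<close> by boundedness.\<close>

lemma adj_dual_synthesis:
  assumes A: "bounded_op A" and B: "bounded_op B"
    and AB: "\<And>l n. cinner (A (ell2_basis l)) (B (ell2_basis n)) = (if l = n then 1 else 0)"
  shows "adj B (A a) = a"
proof (rule ell2_eqI)
  fix n
  have "adj A (B (ell2_basis n)) = ell2_basis n"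
  proof (rule ell2_eqI)
    fix k
    have "cinner (B (ell2_basis n)) (A (ell2_basis k)) = cnj (if k = n then 1 else 0)"
      unfolding AB[symmetric] by (rule cinner_commute)
    then show "coord (adj A (B (ell2_basis n))) k = coord (ell2_basis n) k"
      by (simp add: coord_adj[OF A] coord_basis)
  qed
  then have "cinner (B (ell2_basis n)) (A a) = cinner (ell2_basis n) a"
    by (simp add: cinner_adj[OF A])
  then have "cinner (A a) (B (ell2_basis n)) = cinner a (ell2_basis n)"
    using cinner_commute[of "A a"] cinner_commute[of a] by simp
  then show "coord (adj B (A a)) n = coord a n"
    by (simp add: coord_adj[OF B] cinner_basis)
qed

text \<open>Since \<open>adj B \<circ> A = I\<close> for the synthesis operators \<open>A\<close> of \<open>x\<close> and \<open>B\<close> of \<open>y\<close>, an upper bound for the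
  tails of \<open>adj B\<close> is a lower bound for \<open>A\<close> on tails.\<close>

lemma AO_basis_iff_bessel_bounds:
  fixes x y :: "nat \<Rightarrow> 'a::chilbert_space"
  assumes cx: "complete_seq x" and xy: "\<And>l n. cinner (x l) (y n) = (if l = n then 1 else 0)"
  shows "AO_basis x \<longleftrightarrow> complete_seq y \<and> (\<exists>C C' :: nat \<Rightarrow> real.
       (\<forall>N. C N > 0 \<and> C' N > 0 \<and>
         (\<forall>f.
            (\<lambda>n. (cmod (cinner f (x n)))\<^sup>2) summable_on {N..} \<and>
            (\<Sum>\<^sub>\<infinity>n\<in>{N..}. (cmod (cinner f (x n)))\<^sup>2) \<le> C N * (norm f)\<^sup>2 \<and>
            (\<lambda>n. (cmod (cinner f (y n)))\<^sup>2) summable_on {N..} \<and>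
            (\<Sum>\<^sub>\<infinity>n\<in>{N..}. (cmod (cinner f (y n)))\<^sup>2) \<le> C' N * (norm f)\<^sup>2)) \<and>
       C \<longlonglongrightarrow> 1 \<and> C' \<longlonglongrightarrow> 1)"
    (is "_ \<longleftrightarrow> _ \<and> ?bessel")
proof
  assume x: "AO_basis x"
  obtain A B where A: "invertible_op A" "\<And>n. A (ell2_basis n) = x n" "asymp_isometric A"
      and B: "invertible_op B" "\<And>n. B (ell2_basis n) = y n" "asymp_isometric B"
    by (rule AO_basis_dual_pair[OF x xy]) blast
  have b: "bounded_op A" "bounded_op B"
    using A(1) B(1) by (simp_all add: invertible_op_def)
  obtain C where C: "\<And>N. C N > 0"
      "\<And>N a. a \<in> tail_space N \<Longrightarrow> (norm (A a))\<^sup>2 \<le> C N * (norm a)\<^sup>2" "C \<longlonglongrightarrow> 1"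
    by (rule asymp_isometric_constants[OF A(1,3)]) blast
  obtain C' where C': "\<And>N. C' N > 0"
      "\<And>N a. a \<in> tail_space N \<Longrightarrow> (norm (B a))\<^sup>2 \<le> C' N * (norm a)\<^sup>2" "C' \<longlonglongrightarrow> 1"
    by (rule asymp_isometric_constants[OF B(1,3)]) blast
  have cA: "cinner f (x n) = coord (adj A f) n" for f n
    by (simp add: coord_adj[OF b(1)] A(2))
  have cB: "cinner f (y n) = coord (adj B f) n" for f n
    by (simp add: coord_adj[OF b(2)] B(2))
  have "?bessel"
    unfolding cA cB sums_of_squares_tail(2)
    using sums_of_squares_tail(1) C C' tail_adj_bound[OF b(1) less_imp_le[OF C(1)] C(2)]
      tail_adj_bound[OF b(2) less_imp_le[OF C'(1)] C'(2)]
    by (intro exI[of _ C] exI[of _ C']) blast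
  moreover have "complete_seq y"
    by (rule AO_basis_complete[OF AO_basis_dual[OF x xy]])
  ultimately show "complete_seq y \<and> ?bessel" by blast
next
  assume "complete_seq y \<and> ?bessel"
  then obtain C C' :: "nat \<Rightarrow> real" where C: "\<forall>N. C N > 0 \<and> C' N > 0 \<and>
         (\<forall>f.
            (\<lambda>n. (cmod (cinner f (x n)))\<^sup>2) summable_on {N..} \<and>
            (\<Sum>\<^sub>\<infinity>n\<in>{N..}. (cmod (cinner f (x n)))\<^sup>2) \<le> C N * (norm f)\<^sup>2 \<and>
            (\<lambda>n. (cmod (cinner f (y n)))\<^sup>2) summable_on {N..} \<and>
            (\<Sum>\<^sub>\<infinity>n\<in>{N..}. (cmod (cinner f (y n)))\<^sup>2) \<le> C' N * (norm f)\<^sup>2)"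
    and lim: "C \<longlonglongrightarrow> 1" "C' \<longlonglongrightarrow> 1"
    by (elim exE conjE)
  have pos: "C N > 0" "C' N > 0" for N
    using C by simp_all
  have sum_x: "(\<lambda>n. (cmod (cinner f (x n)))\<^sup>2) summable_on {N..}"
      "(\<Sum>\<^sub>\<infinity>n\<in>{N..}. (cmod (cinner f (x n)))\<^sup>2) \<le> C N * (norm f)\<^sup>2"
    and sum_y: "(\<lambda>n. (cmod (cinner f (y n)))\<^sup>2) summable_on {N..}"
      "(\<Sum>\<^sub>\<infinity>n\<in>{N..}. (cmod (cinner f (y n)))\<^sup>2) \<le> C' N * (norm f)\<^sup>2" for N f
    using C by blast+
  have "\<exists>A. bounded_op A \<and> (\<forall>n. A (ell2_basis n) = x n)"
    by (rule bessel_synthesis_op[OF less_imp_le[OF pos(1)] sum_x])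
  then obtain A where A: "bounded_op A" "\<And>n. A (ell2_basis n) = x n" by blast
  have "\<exists>B. bounded_op B \<and> (\<forall>n. B (ell2_basis n) = y n)"
    by (rule bessel_synthesis_op[OF less_imp_le[OF pos(2)] sum_y])
  then obtain B where B: "bounded_op B" "\<And>n. B (ell2_basis n) = y n" by blast
  have BA: "adj B (A a) = a" for a
    by (rule adj_dual_synthesis[OF A(1) B(1)]) (simp add: A(2) B(2) xy)
  have cA: "cinner f (x n) = coord (adj A f) n" for f n
    by (simp add: coord_adj[OF A(1)] A(2))
  have cB: "cinner f (y n) = coord (adj B f) n" for f n
    by (simp add: coord_adj[OF B(1)] B(2))
  have tA: "(norm (tail N (adj A f)))\<^sup>2 \<le> C N * (norm f)\<^sup>2" for N f
    using sum_x(2)[of f N] unfolding cA sums_of_squares_tail(2) .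
  have tB: "(norm (tail N (adj B f)))\<^sup>2 \<le> C' N * (norm f)\<^sup>2" for N f
    using sum_y(2)[of f N] unfolding cB sums_of_squares_tail(2) .
  obtain M where M: "M > 0" "\<And>f. norm (adj B f) \<le> M * norm f"
    using bounded_op_bound[OF bounded_op_adj[OF B(1)]] by blast
  have "invertible_op A"
  proof (rule invertible_op_if_bounded_below[OF A(1) M(1)])
    show "norm a \<le> M * norm (A a)" for a
      using M(2)[of "A a"] by (simp add: BA)
    show "f = 0" if "\<And>n. cinner f (A (ell2_basis n)) = 0" for f
      using complete_seq_orth_zero[OF cx] that by (simp add: A(2))
  qed
  moreover have "asymp_isometric A"
  proof (rule asymp_isometricI_constants[OF _ _ lim])
    fix N a assume a: "a \<in> tail_space N"
    show "(norm (A a))\<^sup>2 \<le> C N * (norm a)\<^sup>2"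
      by (rule op_bound_if_tail_adj_bound[OF A(1) less_imp_le[OF pos(1)] tA a])
    show "(norm a)\<^sup>2 \<le> C' N * (norm (A a))\<^sup>2"
      using tB[of N "A a"] by (simp add: BA tail_eq_self[OF a])
  qed
  ultimately show "AO_basis x"
    by (intro AO_basisI[of A] A(2))
qed


subsection \<open>The Gram matrix\<close>

text \<open>Conjugation of coordinates. The matrix with entries \<open>cinner (x n) (x p)\<close>, applied to columns, is
  the entrywise conjugate of the matrix of the Gram operator \<open>adj A \<circ> A\<close>, so this map intertwines
  the two operators.\<close>

definition cnj_ell2 :: "ell2 \<Rightarrow> ell2" where
  "cnj_ell2 a = Abs_ell2 (\<lambda>n. cnj (coord a n))"

lemma coord_cnj_ell2 [simp]: "coord (cnj_ell2 a) n = cnj (coord a n)"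
  using summable_coord[of a] by (simp add: cnj_ell2_def Abs_ell2_inverse)

lemma cnj_ell2_cnj_ell2 [simp]: "cnj_ell2 (cnj_ell2 a) = a"
  by (rule ell2_eqI) simp

lemma cnj_ell2_add: "cnj_ell2 (a + b) = cnj_ell2 a + cnj_ell2 b"
  by (rule ell2_eqI) simp

lemma cnj_ell2_diff: "cnj_ell2 (a - b) = cnj_ell2 a - cnj_ell2 b"
  by (rule ell2_eqI) simp

lemma cnj_ell2_scaleC: "cnj_ell2 (c *\<^sub>C a) = cnj c *\<^sub>C cnj_ell2 a"
  by (rule ell2_eqI) simp

lemma norm_cnj_ell2 [simp]: "norm (cnj_ell2 a) = norm a"
  by (simp add: norm_ell2_def)

text \<open>The operator whose matrix is the entrywise conjugate of that of \<open>T\<close>. It is complex linear, although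
  \<open>cnj_ell2\<close> is not.\<close>

definition cnj_op :: "(ell2 \<Rightarrow> ell2) \<Rightarrow> ell2 \<Rightarrow> ell2" where
  "cnj_op T a = cnj_ell2 (T (cnj_ell2 a))"

lemma bounded_op_cnj_op:
  assumes T: "bounded_op T"
  shows "bounded_op (cnj_op T)"
proof -
  obtain M where M: "\<And>a. norm (T a) \<le> M * norm a"
    using bounded_op_bound[OF T] by blast
  show ?thesis
  proof (rule bounded_opI)
    show "cnj_op T (a + b) = cnj_op T a + cnj_op T b" for a b
      by (simp add: cnj_op_def cnj_ell2_add bounded_op_add[OF T])
    show "cnj_op T (c *\<^sub>C a) = c *\<^sub>C cnj_op T a" for c a
      by (simp add: cnj_op_def cnj_ell2_scaleC bounded_op_scaleC[OF T])
    show "norm (cnj_op T a) \<le> M * norm a" for a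
      using M[of "cnj_ell2 a"] by (simp add: cnj_op_def)
  qed
qed

lemma invertible_op_cnj_op:
  assumes "invertible_op T"
  shows "invertible_op (cnj_op T)"
proof -
  obtain S where S: "bounded_op T" "bounded_op S" "\<And>a. S (T a) = a" "\<And>a. T (S a) = a"
    by (rule invertible_opE[OF assms]) blast
  show ?thesis
    by (rule invertible_opI_inverse[OF bounded_op_cnj_op[OF S(1)] bounded_op_cnj_op[OF S(2)]])
      (simp_all add: cnj_op_def S)
qed

lemma compact_op_cnj_op:
  assumes K: "compact_op K"
  shows "compact_op (cnj_op K)"
proof (rule compact_op_netI[OF bounded_op_cnj_op[OF compact_op_bounded_op[OF K]]])
  fix e :: real assume "e > 0"
  obtain F where F: "finite F" "\<And>a. norm a \<le> 1 \<Longrightarrow> \<exists>y\<in>F. norm (K a - y) < e"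
    using compact_op_netE[OF K \<open>e > 0\<close>] by blast
  show "\<exists>F. finite F \<and> (\<forall>a. norm a \<le> 1 \<longrightarrow> (\<exists>y\<in>F. norm (cnj_op K a - y) < e))"
  proof (intro exI[of _ "cnj_ell2 ` F"] conjI allI impI)
    fix a :: ell2 assume "norm a \<le> 1"
    then have "norm (cnj_ell2 a) \<le> 1" by simp
    then obtain y where y: "y \<in> F" "norm (K (cnj_ell2 a) - y) < e"
      using F(2) by blast
    have "norm (cnj_op K a - cnj_ell2 y) = norm (K (cnj_ell2 a) - y)"
      unfolding cnj_op_def cnj_ell2_diff[symmetric] by simp
    then show "\<exists>w\<in>cnj_ell2 ` F. norm (cnj_op K a - w) < e"
      using y by (intro bexI[of _ "cnj_ell2 y"]) auto
  qed (use F in simp)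
qed

lemma sums_cinner_op:
  assumes A: "bounded_op A"
  shows "(\<lambda>p. coord a p * cinner (A (ell2_basis p)) f) sums cinner (A a) f"
proof -
  have "(\<lambda>m. cinner (A (head m a)) f) \<longlonglongrightarrow> cinner (A a) f"
    by (intro bounded_linear.tendsto[OF bounded_linear_cinner_left] bounded_op_tendsto[OF A]
        head_tendsto)
  then show ?thesis
    by (simp add: sums_def op_head[OF A] cinner_sum_left cinner_scaleC_left)
qed

lemma matrix_defines_gram_iff:
  fixes A :: "ell2 \<Rightarrow> 'a::complex_inner"
  assumes A: "bounded_op A" "\<And>n. A (ell2_basis n) = x n"
  shows "matrix_defines_op (gram_matrix x) T \<longleftrightarrow> T = cnj_op (\<lambda>a. adj A (A a))"
proof -
  have sums: "(\<lambda>p. gram_matrix x n p * coord a p) sums coord (cnj_op (\<lambda>a. adj A (A a)) a) n" for a n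
  proof -
    have "(\<lambda>p. cnj (coord (cnj_ell2 a) p * cinner (x p) (x n))) sums cnj (cinner (A (cnj_ell2 a)) (x n))"
      using sums_cinner_op[OF A(1), of "cnj_ell2 a" "x n"] unfolding sums_cnj by (simp only: A(2))
    moreover have "cnj (coord (cnj_ell2 a) p * cinner (x p) (x n)) = gram_matrix x n p * coord a p" for p
      using cinner_commute[of "x n" "x p"] by (simp add: gram_matrix_def mult.commute)
    ultimately show ?thesis
      by (simp only: cnj_op_def coord_cnj_ell2 coord_adj[OF A(1)] A(2))
  qed
  show ?thesis
  proof
    assume T: "matrix_defines_op (gram_matrix x) T"
    have "T a = cnj_op (\<lambda>a. adj A (A a)) a" for a
      by (rule ell2_eqI, rule sums_unique2[OF _ sums]) (use T in \<open>simp add: matrix_defines_op_def\<close>)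
    then show "T = cnj_op (\<lambda>a. adj A (A a))" by blast
  qed (simp add: matrix_defines_op_def sums)
qed

text \<open>The squared norm of a finite combination is \<open>cinner (T v) v\<close>, where \<open>v\<close> has the conjugated
  coefficients as coordinates.\<close>

lemma synthesis_op_if_matrix_defines_op:
  fixes x :: "nat \<Rightarrow> 'a::chilbert_space"
  assumes mat: "matrix_defines_op (gram_matrix x) T" and T: "bounded_op T"
  shows "\<exists>A. bounded_op A \<and> (\<forall>n. A (ell2_basis n) = x n)"
proof -
  obtain M where M: "M > 0" "\<And>a. norm (T a) \<le> M * norm a"
    using bounded_op_bound[OF T] by blast
  show ?thesis
  proof (rule synthesis_op_exists)
    show "M \<ge> 0" using M by simp
    fix F :: "nat set" and a :: "nat \<Rightarrow> complex"
    assume F: "finite F"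
    define v where "v = (\<Sum>n\<in>F. cnj (a n) *\<^sub>C ell2_basis n)"
    have v: "coord v k = (if k \<in> F then cnj (a k) else 0)" for k
      unfolding v_def by (rule norm_sq_finite_combination(2)[OF F])
    have nv: "(norm v)\<^sup>2 = (\<Sum>n\<in>F. (cmod (a n))\<^sup>2)"
      unfolding v_def norm_sq_finite_combination(1)[OF F] by simp
    have Tv: "coord (T v) n = (\<Sum>p\<in>F. cinner (x n) (x p) * cnj (a p))" for n
    proof -
      have "(\<lambda>p. cinner (x n) (x p) * coord v p) sums coord (T v) n"
        using mat by (simp add: matrix_defines_op_def gram_matrix_def)
      moreover have "(\<lambda>p. cinner (x n) (x p) * coord v p)
          sums (\<Sum>p\<in>F. cinner (x n) (x p) * coord v p)"
        by (rule sums_finite[OF F]) (simp add: v)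
      ultimately have "coord (T v) n = (\<Sum>p\<in>F. cinner (x n) (x p) * coord v p)"
        by (rule sums_unique2)
      then show ?thesis by (simp add: v)
    qed
    have "cinner (T v) v = (\<Sum>n\<in>F. coord (T v) n * a n)"
    proof -
      have "cinner (T v) v = (\<Sum>n\<in>F. a n * cinner (T v) (ell2_basis n))"
        by (subst (2) v_def) (simp add: cinner_sum_right cinner_scaleC_right)
      then show ?thesis by (simp add: cinner_basis mult.commute)
    qed
    also have "\<dots> = cinner (\<Sum>n\<in>F. a n *\<^sub>C x n) (\<Sum>p\<in>F. a p *\<^sub>C x p)"
      by (simp add: Tv cinner_sum_left cinner_sum_right cinner_scaleC_left cinner_scaleC_right
          sum_distrib_left sum_distrib_right ac_simps)
        (rule sum.swap)
    finally have "cinner (\<Sum>n\<in>F. a n *\<^sub>C x n) (\<Sum>p\<in>F. a p *\<^sub>C x p) = cinner (T v) v" ..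
    then have "(norm (\<Sum>n\<in>F. a n *\<^sub>C x n))\<^sup>2 = inner (T v) v"
      by (simp add: power2_norm_eq_inner inner_eq_Re_cinner)
    also have "\<dots> \<le> norm (T v) * norm v"
      by (rule norm_cauchy_schwarz)
    also have "\<dots> \<le> M * norm v * norm v"
      by (intro mult_right_mono M) simp
    finally show "(norm (\<Sum>n\<in>F. a n *\<^sub>C x n))\<^sup>2 \<le> M * (\<Sum>n\<in>F. (cmod (a n))\<^sup>2)"
      unfolding nv[symmetric] by (simp add: power2_eq_square mult.assoc)
  qed
qed

text \<open>If the Gram operator is invertible, then \<open>\<parallel>a\<parallel> \<le> M \<parallel>A a\<parallel>\<close> because \<open>a\<close> is recovered from
  \<open>adj A (A a)\<close>. Together with completeness this makes \<open>A\<close> invertible.\<close>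

lemma AO_basis_iff_gram:
  fixes x :: "nat \<Rightarrow> 'a::chilbert_space"
  assumes cx: "complete_seq x"
  shows "AO_basis x \<longleftrightarrow> (\<exists>T. matrix_defines_op (gram_matrix x) T \<and> invertible_op T \<and>
       (\<exists>K. compact_op K \<and> T = (\<lambda>a. a + K a)))"
proof
  assume "AO_basis x"
  then obtain A where A: "invertible_op A" "\<And>n. A (ell2_basis n) = x n" "asymp_isometric A"
    unfolding AO_basis_def by blast
  then have bA: "bounded_op A" by (simp add: invertible_op_def)
  define G where "G = (\<lambda>a. adj A (A a))"
  obtain U where U: "bounded_op U" "\<And>a. U (A a) = a" "\<And>f. A (U f) = f"
    by (rule invertible_opE[OF A(1)]) blast
  obtain B where B: "invertible_op B" "\<And>b. adj A (B b) = b" "\<And>f. B (adj A f) = f"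
    by (rule dual_op_exists[OF A(1)]) blast
  have bB: "bounded_op B"
    using B(1) by (simp add: invertible_op_def)
  have "invertible_op G"
    unfolding G_def
    by (rule invertible_opI_inverse[OF bounded_op_gram[OF bA] bounded_op_compose[OF U(1) bB]])
      (simp_all add: U B)
  then have "invertible_op (cnj_op G)"
    by (rule invertible_op_cnj_op)
  moreover have "compact_op (cnj_op (\<lambda>a. G a - a))"
    unfolding G_def by (rule compact_op_cnj_op[OF compact_gram_if_asymp_isometric[OF bA A(3)]])
  moreover have "cnj_op G = (\<lambda>a. a + cnj_op (\<lambda>a. G a - a) a)"
    by (simp add: fun_eq_iff cnj_op_def cnj_ell2_diff)
  moreover have "matrix_defines_op (gram_matrix x) (cnj_op G)"
    unfolding G_def matrix_defines_gram_iff[OF bA A(2)] ..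
  ultimately show "\<exists>T. matrix_defines_op (gram_matrix x) T \<and> invertible_op T \<and>
       (\<exists>K. compact_op K \<and> T = (\<lambda>a. a + K a))"
    by blast
next
  assume "\<exists>T. matrix_defines_op (gram_matrix x) T \<and> invertible_op T \<and>
       (\<exists>K. compact_op K \<and> T = (\<lambda>a. a + K a))"
  then obtain T K where T: "matrix_defines_op (gram_matrix x) T" "invertible_op T"
    and K: "compact_op K" "T = (\<lambda>a. a + K a)"
    by blast
  have "\<exists>A. bounded_op A \<and> (\<forall>n. A (ell2_basis n) = x n)"
    by (rule synthesis_op_if_matrix_defines_op[OF T(1)]) (use T(2) in \<open>simp add: invertible_op_def\<close>)
  then obtain A where A: "bounded_op A" "\<And>n. A (ell2_basis n) = x n" by blast
  have "T = cnj_op (\<lambda>a. adj A (A a))"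
    using T(1) unfolding matrix_defines_gram_iff[OF A] .
  then have G: "(\<lambda>a. adj A (A a)) = cnj_op T"
    by (simp add: fun_eq_iff cnj_op_def)
  have "invertible_op (\<lambda>a. adj A (A a))"
    unfolding G by (rule invertible_op_cnj_op[OF T(2)])
  then obtain H where H: "bounded_op H" "\<And>a. H (adj A (A a)) = a"
    by (rule invertible_opE) blast
  have "bounded_op (\<lambda>f. H (adj A f))"
    by (rule bounded_op_compose[OF H(1) bounded_op_adj[OF A(1)]])
  then obtain M where M: "M > 0" "\<And>f. norm (H (adj A f)) \<le> M * norm f"
    using bounded_op_bound by blast
  have "invertible_op A"
  proof (rule invertible_op_if_bounded_below[OF A(1) M(1)])
    show "norm a \<le> M * norm (A a)" for a
      using M(2)[of "A a"] by (simp add: H)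
    show "f = 0" if "\<And>n. cinner f (A (ell2_basis n)) = 0" for f
      using complete_seq_orth_zero[OF cx] that by (simp add: A(2))
  qed
  moreover have "asymp_isometric A"
  proof (rule asymp_isometric_if_compact_gram[OF A(1)])
    have "adj A (A a) - a = cnj_op K a" for a
      using fun_cong[OF G, of a] by (simp add: cnj_op_def K(2) cnj_ell2_add)
    then show "compact_op (\<lambda>a. adj A (A a) - a)"
      using compact_op_cnj_op[OF K(1)] by simp
  qed
  ultimately show "AO_basis x"
    by (intro AO_basisI[of A] A(2))
qed


section \<open>The equivalence\<close>

theorem proposition2p4:
  fixes x :: "nat \<Rightarrow> 'a::chilbert_space"
  assumes "complete_seq x" and "minimal_seq x"
  shows "all_equivalent
    [AOB x,

     \<exists>U\<in>UK. \<forall>n. U (x n) = ell2_basis n,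

     \<exists>T. matrix_defines_op (gram_matrix x) T \<and> invertible_op T \<and>
       (\<exists>K. compact_op K \<and> T = (\<lambda>a. a + K a)),

     \<exists>J\<in>UK. \<forall>f. coord (J f) = interpolation_map x f,

     complete_seq (biorthogonal x) \<and> AOB (biorthogonal x),

     \<exists>U :: 'a \<Rightarrow> ell2. invertible_op U \<and> (\<forall>n. U (x n) = ell2_basis n) \<and>
       (\<lambda>N. onorm_on (closed_span (x ` {N..})) U) \<longlonglongrightarrow> 1 \<and>
       (\<lambda>N. onorm_on (closed_span (ell2_basis ` {N..}))
              (inv_into (closed_span (x ` {N..})) U)) \<longlonglongrightarrow> 1,

     \<exists>C C' :: nat \<Rightarrow> real.
       (\<forall>N. C N > 0 \<and> C' N > 0 \<and>
         (\<forall>f \<in> orth_complement (closed_span (x ` {..<N})).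
            (\<lambda>n. (cmod (cinner f (x n)))\<^sup>2) summable_on {N..} \<and>
            inverse (C' N) * (norm f)\<^sup>2 \<le> (\<Sum>\<^sub>\<infinity>n\<in>{N..}. (cmod (cinner f (x n)))\<^sup>2) \<and>
            (\<Sum>\<^sub>\<infinity>n\<in>{N..}. (cmod (cinner f (x n)))\<^sup>2) \<le> C N * (norm f)\<^sup>2)) \<and>
       C \<longlonglongrightarrow> 1 \<and> C' \<longlonglongrightarrow> 1,

     complete_seq (biorthogonal x) \<and>
     (\<exists>C C' :: nat \<Rightarrow> real.
       (\<forall>N. C N > 0 \<and> C' N > 0 \<and>
         (\<forall>f.
            (\<lambda>n. (cmod (cinner f (x n)))\<^sup>2) summable_on {N..} \<and>
            (\<Sum>\<^sub>\<infinity>n\<in>{N..}. (cmod (cinner f (x n)))\<^sup>2) \<le> C N * (norm f)\<^sup>2 \<and>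
            (\<lambda>n. (cmod (cinner f (biorthogonal x n)))\<^sup>2) summable_on {N..} \<and>
            (\<Sum>\<^sub>\<infinity>n\<in>{N..}. (cmod (cinner f (biorthogonal x n)))\<^sup>2) \<le> C' N * (norm f)\<^sup>2)) \<and>
       C \<longlonglongrightarrow> 1 \<and> C' \<longlonglongrightarrow> 1)]"
proof -
  note xy = cinner_biorthogonal[OF assms]
  have yx: "cinner (biorthogonal x l) (x n) = (if l = n then 1 else 0)" for l n
    using cinner_commute[of "biorthogonal x l" "x n"] xy[of n l] by simp
  have i: "AOB x \<longleftrightarrow> AO_basis x"
    using AO_basis_if_AOB[OF assms(1)] AOB_if_AO_basis by blast
  have v: "complete_seq (biorthogonal x) \<and> AOB (biorthogonal x) \<longleftrightarrow> AO_basis (biorthogonal x)"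
    using AO_basis_if_AOB[of "biorthogonal x"] AOB_if_AO_basis[of "biorthogonal x"]
      AO_basis_complete[of "biorthogonal x"] by blast
  have dual: "AO_basis (biorthogonal x) \<longleftrightarrow> AO_basis x"
    using AO_basis_dual[OF _ xy] AO_basis_dual[OF _ yx] by blast
  show ?thesis
    unfolding i v dual interpolation_UK_iff[OF xy]
      AO_basis_iff_UK[symmetric] AO_basis_iff_gram[OF assms(1), symmetric]
      AO_basis_iff_restriction_norms[symmetric]
      AO_basis_biorthogonal_iff_frame_bounds[OF xy, symmetric]
      AO_basis_iff_bessel_bounds[OF assms(1) xy, symmetric]
    by (simp add: all_equivalent_def)
qed

end
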